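(* Suppose the semigroup $S$ embeds into a group $G$. Then there is a $*$-isomorphism $\kappa:C^*_s(S)\to C^*_0(I_l(S))$ such that $\kappa(v_s)=\lambda_s$ for each $s\in S$ (where $\lambda_s$ also denotes its canonical image in $C^*_0(I_l(S))$).
   Context: A semigroup means a set with associative product and identity element $1$; homomorphisms preserve identities. $S$ is viewed as a subsemigroup of $G$. For $X\subset S$, $sX=\{sx:x\in X\}$ and $t^{-1}X=\{r\in S:tr\in X\}$. $J(S)$ is the set of all finite intersections of subsets of $S$ of the form $t_1^{-1}s_1\cdots t_n^{-1}s_nS$ ($n\ge1$, $s_i,t_i\in S$); in fact every element of $J(S)$ is itself of this form. $C^*_s(S)$ (Li) is the universal $C^*$-algebra generated by isometries $\{v_s:s\in S\}$ and projections $\{e_X:X\in J(S)\cup\{\varnothing\}\}$ subject to: $v_{st}=v_sv_t$ for $s,t\in S$; $e_\varnothing=0$; and whenever $s_1,\dots,s_n,t_1,\dots,t_n\in S$ satisfy $t_1^{-1}s_1\cdots t_n^{-1}s_n=1$ in $G$, then $v_{t_1}^*v_{s_1}\cdots v_{t_n}^*v_{s_n}=e_X$ with $X=t_1^{-1}s_1\cdots t_n^{-1}s_nS\subset S$. For $s\in S$ let $\lambda_s:S\to sS$, $\lambda_s(t)=st$. $I(S)$ is the inverse semigroup of all partially defined bijections of $S$ (product $fg$ is composition on $g^{-1}(\mathrm{dom} f)$; $f^*$ is the inverse map; the empty map is the zero $0$). $I_l(S)$ is the inverse subsemigroup of $I(S)$ generated by $\{\lambda_s\}_{s\in S}$. For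 an inverse semigroup $P$, $C^*(P)$ is the full $C^*$-algebra of $P$: the enveloping $C^*$-algebra of the convolution algebra $\ell^1(P)$, universal for representations of $P$ by partial isometries (homomorphisms $P\to A$, $A$ a $C^*$-algebra, onto a multiplicative semigroup of partial isometries); $P$ is identified with its image in $C^*(P)$. For $P=I_l(S)$, $C^*_0(P)=C^*(P)/\mathbb{C}0$ if the empty map $0$ lies in $P$, and $C^*_0(P)=C^*(P)$ otherwise. *)

theory Defs
  imports "HOL-Analysis.Infinite_Sum" "HOL-Algebra.QuotRing" "HOL-Algebra.Module"
begin

section \<open>Star-algebras and $C^*$-algebras on explicit carriers\<close>

record 'a star_algebra = "(complex, 'a) module" +
  astar :: "'a \<Rightarrow> 'a"

record 'a normed_star_algebra = "'a star_algebra" +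
  nrm :: "'a \<Rightarrow> real"

text \<open>Unital complex star-algebras; the zero algebra is allowed.\<close>

locale complex_star_algebra = ring A for A :: "('a, 'b) star_algebra_scheme" (structure) +
  assumes smult_closed: "x \<in> carrier A \<Longrightarrow> c \<odot> x \<in> carrier A"
    and smult_add_left: "x \<in> carrier A \<Longrightarrow> (c + d) \<odot> x = c \<odot> x \<oplus> d \<odot> x"
    and smult_add_right: "\<lbrakk>x \<in> carrier A; y \<in> carrier A\<rbrakk> \<Longrightarrow> c \<odot> (x \<oplus> y) = c \<odot> x \<oplus> c \<odot> y"
    and smult_assoc: "x \<in> carrier A \<Longrightarrow> (c * d) \<odot> x = c \<odot> (d \<odot> x)"
    and smult_1: "x \<in> carrier A \<Longrightarrow> 1 \<odot> x = x"
    and smult_mult_left: "\<lbrakk>x \<in> carrier A; y \<in> carrier A\<rbrakk> \<Longrightarrow> (c \<odot> x) \<otimes> y = c \<odot> (x \<otimes> y)"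
    and smult_mult_right: "\<lbrakk>x \<in> carrier A; y \<in> carrier A\<rbrakk> \<Longrightarrow> x \<otimes> (c \<odot> y) = c \<odot> (x \<otimes> y)"
    and star_closed: "x \<in> carrier A \<Longrightarrow> astar A x \<in> carrier A"
    and star_add: "\<lbrakk>x \<in> carrier A; y \<in> carrier A\<rbrakk> \<Longrightarrow> astar A (x \<oplus> y) = astar A x \<oplus> astar A y"
    and star_smult: "x \<in> carrier A \<Longrightarrow> astar A (c \<odot> x) = cnj c \<odot> astar A x"
    and star_mult: "\<lbrakk>x \<in> carrier A; y \<in> carrier A\<rbrakk> \<Longrightarrow> astar A (x \<otimes> y) = astar A y \<otimes> astar A x"
    and star_star: "x \<in> carrier A \<Longrightarrow> astar A (astar A x) = x"

definition cstar_seminorm :: "('a, 'b) star_algebra_scheme \<Rightarrow> ('a \<Rightarrow> real) \<Rightarrow> bool" where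
  "cstar_seminorm A p \<longleftrightarrow>
     (\<forall>x\<in>carrier A. 0 \<le> p x) \<and>
     (\<forall>x\<in>carrier A. \<forall>c. p (c \<odot>\<^bsub>A\<^esub> x) = cmod c * p x) \<and>
     (\<forall>x\<in>carrier A. \<forall>y\<in>carrier A. p (x \<oplus>\<^bsub>A\<^esub> y) \<le> p x + p y) \<and>
     (\<forall>x\<in>carrier A. \<forall>y\<in>carrier A. p (x \<otimes>\<^bsub>A\<^esub> y) \<le> p x * p y) \<and>
     (\<forall>x\<in>carrier A. p (astar A x \<otimes>\<^bsub>A\<^esub> x) = (p x)\<^sup>2)"

definition Cauchy_for :: "('a, 'b) star_algebra_scheme \<Rightarrow> ('a \<Rightarrow> real) \<Rightarrow> (nat \<Rightarrow> 'a) \<Rightarrow> bool" where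
  "Cauchy_for A p X \<longleftrightarrow> (\<forall>n. X n \<in> carrier A) \<and>
     (\<forall>e>0. \<exists>N. \<forall>m\<ge>N. \<forall>n\<ge>N. p (X m \<ominus>\<^bsub>A\<^esub> X n) < e)"

locale cstar_algebra = complex_star_algebra A for A :: "('a, 'b) normed_star_algebra_scheme" (structure) +
  assumes cstar_norm: "cstar_seminorm A (nrm A)"
    and norm_definite: "\<lbrakk>x \<in> carrier A; nrm A x = 0\<rbrakk> \<Longrightarrow> x = \<zero>"
    and complete: "Cauchy_for A (nrm A) X \<Longrightarrow>
      \<exists>x\<in>carrier A. (\<lambda>n. nrm A (X n \<ominus> x)) \<longlonglongrightarrow> 0"

definition star_hom ::
  "('a, 'c) star_algebra_scheme \<Rightarrow> ('b, 'd) star_algebra_scheme \<Rightarrow> ('a \<Rightarrow> 'b) set" where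
  "star_hom A B = {h \<in> ring_hom A B.
     (\<forall>x\<in>carrier A. \<forall>c. h (c \<odot>\<^bsub>A\<^esub> x) = c \<odot>\<^bsub>B\<^esub> h x) \<and>
     (\<forall>x\<in>carrier A. h (astar A x) = astar B (h x))}"

definition star_iso ::
  "('a, 'c) star_algebra_scheme \<Rightarrow> ('b, 'd) star_algebra_scheme \<Rightarrow> ('a \<Rightarrow> 'b) set" where
  "star_iso A B = {h \<in> star_hom A B. bij_betw h (carrier A) (carrier B)}"


section \<open>Quotients and Hausdorff completions\<close>

text \<open>Quotient by a star-invariant ideal, with the quotient (semi)norm.\<close>

definition star_quot :: "('a, 'b) star_algebra_scheme \<Rightarrow> ('a \<Rightarrow> real) \<Rightarrow> 'a set \<Rightarrow> 'a set normed_star_algebra" where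
  "star_quot A p I =
    \<lparr>carrier = carrier (A Quot I), mult = mult (A Quot I), one = one (A Quot I),
     zero = zero (A Quot I), add = add (A Quot I),
     smult = (\<lambda>c U. \<Union>x\<in>U. I +>\<^bsub>A\<^esub> (c \<odot>\<^bsub>A\<^esub> x)),
     astar = (\<lambda>U. \<Union>x\<in>U. I +>\<^bsub>A\<^esub> astar A x),
     nrm = (\<lambda>U. Inf (p ` U))\<rparr>"

definition Cauchy_algebra :: "('a, 'b) star_algebra_scheme \<Rightarrow> ('a \<Rightarrow> real) \<Rightarrow> (nat \<Rightarrow> 'a) star_algebra" where
  "Cauchy_algebra A p =
    \<lparr>carrier = Collect (Cauchy_for A p),
     mult = (\<lambda>X Y n. X n \<otimes>\<^bsub>A\<^esub> Y n), one = (\<lambda>n. \<one>\<^bsub>A\<^esub>),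
     zero = (\<lambda>n. \<zero>\<^bsub>A\<^esub>), add = (\<lambda>X Y n. X n \<oplus>\<^bsub>A\<^esub> Y n),
     smult = (\<lambda>c X n. c \<odot>\<^bsub>A\<^esub> X n), astar = (\<lambda>X n. astar A (X n))\<rparr>"

definition null_sequences :: "('a, 'b) star_algebra_scheme \<Rightarrow> ('a \<Rightarrow> real) \<Rightarrow> (nat \<Rightarrow> 'a) set" where
  "null_sequences A p = {X. Cauchy_for A p X \<and> (\<lambda>n. p (X n)) \<longlonglongrightarrow> 0}"

definition completion ::
  "('a, 'b) star_algebra_scheme \<Rightarrow> ('a \<Rightarrow> real) \<Rightarrow> (nat \<Rightarrow> 'a) set normed_star_algebra" where
  "completion A p =
     star_quot (Cauchy_algebra A p) (\<lambda>X. lim (\<lambda>n. p (X n))) (null_sequences A p)"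

definition to_completion :: "('a, 'b) star_algebra_scheme \<Rightarrow> ('a \<Rightarrow> real) \<Rightarrow> 'a \<Rightarrow> (nat \<Rightarrow> 'a) set" where
  "to_completion A p x = null_sequences A p +>\<^bsub>Cauchy_algebra A p\<^esub> (\<lambda>n. x)"

text \<open>Every homomorphism \<open>h\<close> from \<open>A\<close> to a \<open>C\<^sup>*\<close>-algebra induces the \<open>C\<^sup>*\<close>-seminorm
  \<open>x \<mapsto> \<parallel>h x\<parallel>\<close>, and every \<open>C\<^sup>*\<close>-seminorm is of this form, by passing to its Hausdorff completion.
  Thus the supremum over all \<open>C\<^sup>*\<close>-seminorms of a certain kind is the usual supremum over
  all representations of that kind, without reference to a type in which these take values.\<close>

definition sup_seminorm :: "('a \<Rightarrow> real) set \<Rightarrow> 'a \<Rightarrow> real" where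
  "sup_seminorm N x = (SUP p\<in>N. p x)"


section \<open>Convolution algebras\<close>

record 'a star_monoid = "'a monoid" +
  mstar :: "'a \<Rightarrow> 'a"

definition delta :: "'a \<Rightarrow> 'a \<Rightarrow> complex" where
  "delta x = (\<lambda>y. if y = x then 1 else 0)"

definition conv_algebra ::
  "('a, 'b) star_monoid_scheme \<Rightarrow> ('a \<Rightarrow> complex) set \<Rightarrow> ('a \<Rightarrow> complex) star_algebra" where
  "conv_algebra P F =
    \<lparr>carrier = F,
     mult = (\<lambda>f g r. \<Sum>\<^sub>\<infinity>(s, t)\<in>{(s, t). s \<in> carrier P \<and> t \<in> carrier P \<and> s \<otimes>\<^bsub>P\<^esub> t = r}. f s * g t),
     one = delta \<one>\<^bsub>P\<^esub>, zero = (\<lambda>r. 0), add = (\<lambda>f g r. f r + g r),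
     smult = (\<lambda>c f r. c * f r),
     astar = (\<lambda>f r. if r \<in> carrier P then cnj (f (mstar P r)) else 0)\<rparr>"

definition finite_algebra :: "('a, 'b) star_monoid_scheme \<Rightarrow> ('a \<Rightarrow> complex) star_algebra" where
  "finite_algebra P = conv_algebra P {f. finite {x. f x \<noteq> 0} \<and> {x. f x \<noteq> 0} \<subseteq> carrier P}"

definition ell1_algebra :: "('a, 'b) star_monoid_scheme \<Rightarrow> ('a \<Rightarrow> complex) star_algebra" where
  "ell1_algebra P = conv_algebra P {f. f abs_summable_on carrier P \<and> {x. f x \<noteq> 0} \<subseteq> carrier P}"

definition ell1_norm :: "('a, 'b) star_monoid_scheme \<Rightarrow> ('a \<Rightarrow> complex) \<Rightarrow> real" where
  "ell1_norm P f = (\<Sum>\<^sub>\<infinity>x\<in>carrier P. cmod (f x))"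

text \<open>The finitely supported functions on the following words form the free unital star-algebra
  on \<open>X\<close>; a letter \<open>(x, True)\<close> stands for the adjoint of the generator \<open>x\<close>.\<close>

definition free_star_monoid :: "'x set \<Rightarrow> ('x \<times> bool) list star_monoid" where
  "free_star_monoid X =
    \<lparr>carrier = lists (X \<times> UNIV), mult = (@), one = [],
     mstar = (\<lambda>w. rev (map (\<lambda>(x, b). (x, \<not> b)) w))\<rparr>"

abbreviation free_star_algebra :: "'x set \<Rightarrow> (('x \<times> bool) list \<Rightarrow> complex) star_algebra" where
  "free_star_algebra X \<equiv> finite_algebra (free_star_monoid X)"


section \<open>The universal $C^*$-algebra of generators and relations\<close>

text \<open>A pair \<open>(x, y)\<close> in \<open>R\<close> is the relation \<open>x = y\<close>.\<close>

definition presented_seminorm ::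
  "'x set \<Rightarrow> ((('x \<times> bool) list \<Rightarrow> complex) \<times> (('x \<times> bool) list \<Rightarrow> complex)) set
    \<Rightarrow> (('x \<times> bool) list \<Rightarrow> complex) \<Rightarrow> real" where
  "presented_seminorm X R = sup_seminorm {p. cstar_seminorm (free_star_algebra X) p \<and>
     (\<forall>(x, y)\<in>R. p (x \<ominus>\<^bsub>free_star_algebra X\<^esub> y) = 0)}"

definition presented_cstar ::
  "'x set \<Rightarrow> ((('x \<times> bool) list \<Rightarrow> complex) \<times> (('x \<times> bool) list \<Rightarrow> complex)) set
    \<Rightarrow> (nat \<Rightarrow> ('x \<times> bool) list \<Rightarrow> complex) set normed_star_algebra" where
  "presented_cstar X R = completion (free_star_algebra X) (presented_seminorm X R)"

definition presented_generator ::
  "'x set \<Rightarrow> ((('x \<times> bool) list \<Rightarrow> complex) \<times> (('x \<times> bool) list \<Rightarrow> complex)) set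
    \<Rightarrow> 'x \<Rightarrow> (nat \<Rightarrow> ('x \<times> bool) list \<Rightarrow> complex) set" where
  "presented_generator X R x =
     to_completion (free_star_algebra X) (presented_seminorm X R) (delta [(x, False)])"


section \<open>The full $C^*$-algebra of an inverse monoid\<close>

text \<open>The convolution \<open>\<ell>\<^sup>1\<close>-algebra is a Banach star-algebra, so its \<open>C\<^sup>*\<close>-seminorms are automatically
  bounded by the \<open>\<ell>\<^sup>1\<close>-norm. The bound is stated explicitly, as usual for the enveloping
  \<open>C\<^sup>*\<close>-algebra of a normed star-algebra.\<close>

definition full_seminorm :: "('a, 'b) star_monoid_scheme \<Rightarrow> ('a \<Rightarrow> complex) \<Rightarrow> real" where
  "full_seminorm P = sup_seminorm {p. cstar_seminorm (ell1_algebra P) p \<and>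
     (\<forall>f\<in>carrier (ell1_algebra P). p f \<le> ell1_norm P f)}"

definition full_cstar ::
  "('a, 'b) star_monoid_scheme \<Rightarrow> (nat \<Rightarrow> 'a \<Rightarrow> complex) set normed_star_algebra" where
  "full_cstar P = completion (ell1_algebra P) (full_seminorm P)"

definition full_gen :: "('a, 'b) star_monoid_scheme \<Rightarrow> 'a \<Rightarrow> (nat \<Rightarrow> 'a \<Rightarrow> complex) set" where
  "full_gen P x = to_completion (ell1_algebra P) (full_seminorm P) (delta x)"

text \<open>For monoids of partial maps, pass to the quotient by the span of the empty map, if present.
  In the other case the quotient by \<open>{\<zero>}\<close> is taken, merely to obtain an algebra of the same type.\<close>

definition zero_ideal ::
  "('a \<rightharpoonup> 'a, 'b) star_monoid_scheme \<Rightarrow> (nat \<Rightarrow> ('a \<rightharpoonup> 'a) \<Rightarrow> complex) set set" where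
  "zero_ideal P = (if Map.empty \<in> carrier P
     then {c \<odot>\<^bsub>full_cstar P\<^esub> full_gen P Map.empty | c. True}
     else {\<zero>\<^bsub>full_cstar P\<^esub>})"

definition full_cstar0 ::
  "('a \<rightharpoonup> 'a, 'b) star_monoid_scheme \<Rightarrow> (nat \<Rightarrow> ('a \<rightharpoonup> 'a) \<Rightarrow> complex) set set normed_star_algebra" where
  "full_cstar0 P = star_quot (full_cstar P) (nrm (full_cstar P)) (zero_ideal P)"

definition full_gen0 ::
  "('a \<rightharpoonup> 'a, 'b) star_monoid_scheme \<Rightarrow> ('a \<rightharpoonup> 'a) \<Rightarrow> (nat \<Rightarrow> ('a \<rightharpoonup> 'a) \<Rightarrow> complex) set set" where
  "full_gen0 P x = zero_ideal P +>\<^bsub>full_cstar P\<^esub> full_gen P x"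


section \<open>The left inverse hull\<close>

definition partial_inverse :: "('a \<rightharpoonup> 'b) \<Rightarrow> ('b \<rightharpoonup> 'a)" where
  "partial_inverse f = (\<lambda>y. if y \<in> ran f then Some (THE x. f x = Some y) else None)"

definition left_mult :: "('g, 'b) monoid_scheme \<Rightarrow> 'g set \<Rightarrow> 'g \<Rightarrow> ('g \<rightharpoonup> 'g)" where
  "left_mult G S s = (\<lambda>t. if t \<in> S then Some (s \<otimes>\<^bsub>G\<^esub> t) else None)"

inductive_set left_hull_set :: "('g, 'b) monoid_scheme \<Rightarrow> 'g set \<Rightarrow> ('g \<rightharpoonup> 'g) set"
  for G (structure) and S where
  gen: "s \<in> S \<Longrightarrow> left_mult G S s \<in> left_hull_set G S"
| comp: "\<lbrakk>f \<in> left_hull_set G S; g \<in> left_hull_set G S\<rbrakk> \<Longrightarrow> f \<circ>\<^sub>m g \<in> left_hull_set G S"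
| inv: "f \<in> left_hull_set G S \<Longrightarrow> partial_inverse f \<in> left_hull_set G S"

definition left_hull :: "('g, 'b) monoid_scheme \<Rightarrow> 'g set \<Rightarrow> ('g \<rightharpoonup> 'g) star_monoid" where
  "left_hull G S =
    \<lparr>carrier = left_hull_set G S, mult = (\<circ>\<^sub>m), one = left_mult G S \<one>\<^bsub>G\<^esub>, mstar = partial_inverse\<rparr>"


section \<open>Li's semigroup $C^*$-algebra\<close>

text \<open>A list \<open>[(t\<^sub>1, s\<^sub>1), \<dots>, (t\<^sub>n, s\<^sub>n)]\<close> encodes the formal product of the
  \<open>t\<^sub>i\<^sup>-\<^sup>1 s\<^sub>i\<close>, to be read in the group, as a right ideal of \<open>S\<close>, or in the algebra.\<close>

context
  fixes G :: "('g, 'b) monoid_scheme" (structure) and S :: "'g set"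
begin

definition word_value :: "('g \<times> 'g) list \<Rightarrow> 'g" where
  "word_value ts = foldr (\<lambda>(t, s) g. inv t \<otimes> s \<otimes> g) ts \<one>"

definition word_ideal :: "('g \<times> 'g) list \<Rightarrow> 'g set" where
  "word_ideal ts = foldr (\<lambda>(t, s) X. {r \<in> S. t \<otimes> r \<in> (\<lambda>x. s \<otimes> x) ` X}) ts S"

definition constructible_ideals :: "'g set set" where
  "constructible_ideals = {\<Inter>\<X> | \<X>. finite \<X> \<and> \<X> \<noteq> {} \<and>
     \<X> \<subseteq> {word_ideal ts | ts. ts \<noteq> [] \<and> set ts \<subseteq> S \<times> S}}"

end

datatype 'g li_generator = V 'g | E "'g set"

definition li_generators :: "('g, 'b) monoid_scheme \<Rightarrow> 'g set \<Rightarrow> 'g li_generator set" where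
  "li_generators G S = V ` S \<union> E ` (constructible_ideals G S \<union> {{}})"

abbreviation (input) pos :: "'x \<Rightarrow> 'x \<times> bool" where "pos x \<equiv> (x, False)"
abbreviation (input) adj :: "'x \<Rightarrow> 'x \<times> bool" where "adj x \<equiv> (x, True)"

inductive_set li_relations :: "('g, 'b) monoid_scheme \<Rightarrow> 'g set \<Rightarrow>
    ((('g li_generator \<times> bool) list \<Rightarrow> complex) \<times> (('g li_generator \<times> bool) list \<Rightarrow> complex)) set"
  for G (structure) and S where
  isometry: "s \<in> S \<Longrightarrow> (delta [adj (V s), pos (V s)], delta []) \<in> li_relations G S"
| idempotent: "X \<in> constructible_ideals G S \<union> {{}} \<Longrightarrow>
    (delta [pos (E X), pos (E X)], delta [pos (E X)]) \<in> li_relations G S"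
| selfadjoint: "X \<in> constructible_ideals G S \<union> {{}} \<Longrightarrow>
    (delta [adj (E X)], delta [pos (E X)]) \<in> li_relations G S"
| mult: "\<lbrakk>s \<in> S; t \<in> S\<rbrakk> \<Longrightarrow>
    (delta [pos (V (s \<otimes> t))], delta [pos (V s), pos (V t)]) \<in> li_relations G S"
| empty: "(delta [pos (E {})], (\<lambda>w. 0)) \<in> li_relations G S"
| word: "\<lbrakk>ts \<noteq> []; set ts \<subseteq> S \<times> S; word_value G ts = \<one>\<rbrakk> \<Longrightarrow>
    (delta (concat (map (\<lambda>(t, s). [adj (V t), pos (V s)]) ts)), delta [pos (E (word_ideal G S ts))])
      \<in> li_relations G S"

definition li_cstar :: "('g, 'b) monoid_scheme \<Rightarrow> 'g set \<Rightarrow>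
    (nat \<Rightarrow> ('g li_generator \<times> bool) list \<Rightarrow> complex) set normed_star_algebra" where
  "li_cstar G S = presented_cstar (li_generators G S) (li_relations G S)"

definition li_v :: "('g, 'b) monoid_scheme \<Rightarrow> 'g set \<Rightarrow> 'g \<Rightarrow>
    (nat \<Rightarrow> ('g li_generator \<times> bool) list \<Rightarrow> complex) set" where
  "li_v G S s = presented_generator (li_generators G S) (li_relations G S) (V s)"


section \<open>Completions are $C^*$-algebras and have the expected universal property\<close>

text \<open>The statements are \<open>completion_cstar\<close>, \<open>completion_universal\<close> and
  \<open>cstar_seminorm_sup\<close>. In \<open>completion_universal\<close> the extension is unique among contractive
  homomorphisms, since the image of \<open>A\<close> is dense by \<open>nrm_iota_tendsto\<close>.\<close>

context complex_star_algebra
begin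

lemma smult_0_left: "x \<in> carrier A \<Longrightarrow> 0 \<odot> x = \<zero>"
  using smult_add_left[of x 0 0] smult_closed[of x 0] by (simp add: add.r_cancel_one')

lemma uminus_eq_smult: "x \<in> carrier A \<Longrightarrow> \<ominus> x = (- 1) \<odot> x"
  using smult_add_left[of x "- 1" 1] smult_closed[of x "- 1"]
  by (intro minus_equality) (auto simp: smult_1 smult_0_left)

lemma smult_eq_mult: "x \<in> carrier A \<Longrightarrow> c \<odot> x = (c \<odot> \<one>) \<otimes> x"
  by (simp add: smult_mult_left)

lemma star_zero: "astar A \<zero> = \<zero>"
  using star_smult[of \<zero> 0] by (simp add: smult_0_left star_closed)

lemma star_uminus: "x \<in> carrier A \<Longrightarrow> astar A (\<ominus> x) = \<ominus> astar A x"
  by (simp add: uminus_eq_smult star_smult star_closed)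

lemma star_minus: "\<lbrakk>x \<in> carrier A; y \<in> carrier A\<rbrakk> \<Longrightarrow> astar A (x \<ominus> y) = astar A x \<ominus> astar A y"
  by (simp add: minus_eq star_add star_uminus)

lemma smult_minus: "\<lbrakk>x \<in> carrier A; y \<in> carrier A\<rbrakk> \<Longrightarrow> c \<odot> (x \<ominus> y) = c \<odot> x \<ominus> c \<odot> y"
  by (simp add: minus_eq smult_add_right smult_closed uminus_eq_smult flip: smult_assoc)

end

locale seminormed_star_algebra = complex_star_algebra A
  for A :: "('a, 'b) star_algebra_scheme" (structure) +
  fixes p :: "'a \<Rightarrow> real"
  assumes seminorm: "cstar_seminorm A p"
begin

lemma p_nonneg: "x \<in> carrier A \<Longrightarrow> 0 \<le> p x"
  and p_smult: "x \<in> carrier A \<Longrightarrow> p (c \<odot> x) = cmod c * p x"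
  and p_add: "\<lbrakk>x \<in> carrier A; y \<in> carrier A\<rbrakk> \<Longrightarrow> p (x \<oplus> y) \<le> p x + p y"
  and p_mult: "\<lbrakk>x \<in> carrier A; y \<in> carrier A\<rbrakk> \<Longrightarrow> p (x \<otimes> y) \<le> p x * p y"
  and p_cstar: "x \<in> carrier A \<Longrightarrow> p (astar A x \<otimes> x) = (p x)\<^sup>2"
  using seminorm unfolding cstar_seminorm_def by auto

lemma p_zero: "p \<zero> = 0"
  using p_smult[of \<zero> 0] by (simp add: smult_0_left)

lemma p_uminus: "x \<in> carrier A \<Longrightarrow> p (\<ominus> x) = p x"
  by (simp add: uminus_eq_smult p_smult)

lemma p_minus: "\<lbrakk>x \<in> carrier A; y \<in> carrier A\<rbrakk> \<Longrightarrow> p (x \<ominus> y) \<le> p x + p y"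
  using p_add[of x "\<ominus> y"] by (simp add: minus_eq p_uminus)

lemma p_minus_commute: "\<lbrakk>x \<in> carrier A; y \<in> carrier A\<rbrakk> \<Longrightarrow> p (x \<ominus> y) = p (y \<ominus> x)"
  using p_uminus[of "x \<ominus> y"] by (simp add: minus_eq minus_add a_comm)

lemma p_triangle: "\<lbrakk>x \<in> carrier A; y \<in> carrier A; z \<in> carrier A\<rbrakk> \<Longrightarrow> p (x \<ominus> z) \<le> p (x \<ominus> y) + p (y \<ominus> z)"
proof -
  assume a: "x \<in> carrier A" "y \<in> carrier A" "z \<in> carrier A"
  have "x \<ominus> z = (x \<ominus> y) \<oplus> (y \<ominus> z)" using a by algebra
  then show ?thesis using p_add[of "x \<ominus> y" "y \<ominus> z"] a by simp
qed

lemma p_diff: "\<lbrakk>x \<in> carrier A; y \<in> carrier A\<rbrakk> \<Longrightarrow> \<bar>p x - p y\<bar> \<le> p (x \<ominus> y)"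
proof -
  assume a: "x \<in> carrier A" "y \<in> carrier A"
  have "x = (x \<ominus> y) \<oplus> y" "y = (y \<ominus> x) \<oplus> x" using a by algebra+
  then have "p x \<le> p (x \<ominus> y) + p y" "p y \<le> p (y \<ominus> x) + p x"
    using a p_add[of "x \<ominus> y" y] p_add[of "y \<ominus> x" x] by auto
  then show ?thesis using p_minus_commute[OF a] by linarith
qed

lemma p_star: "x \<in> carrier A \<Longrightarrow> p (astar A x) = p x"
proof -
  have le: "p y \<le> p (astar A y)" if "y \<in> carrier A" for y
  proof -
    have "p y * p y \<le> p (astar A y) * p y"
      using p_cstar[OF that] p_mult[of "astar A y" y] that by (simp add: star_closed power2_eq_square)
    then show ?thesis
      using p_nonneg[OF that] p_nonneg[OF star_closed[OF that]] by (cases "p y = 0") auto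
  qed
  show "x \<in> carrier A \<Longrightarrow> p (astar A x) = p x"
    using le[of x] le[of "astar A x"] by (simp add: star_closed star_star)
qed

abbreviation (input) "C \<equiv> Cauchy_algebra A p"
abbreviation (input) "I \<equiv> null_sequences A p"

lemma Cauchy_carr: "Cauchy_for A p X \<Longrightarrow> X n \<in> carrier A"
  by (simp add: Cauchy_for_def)

lemma Cauchy_bound:
  assumes X: "Cauchy_for A p X" obtains b where "b > 0" "\<And>n. p (X n) \<le> b"
proof -
  obtain N where N: "\<And>n. n \<ge> N \<Longrightarrow> p (X n \<ominus> X N) < 1"
    using X unfolding Cauchy_for_def by (meson le_refl zero_less_one)
  define b where "b = Max (insert 1 ((\<lambda>n. p (X n)) ` {..N})) + 1"
  have bm: "p (X n) \<le> b - 1" if "n \<le> N" for n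
    unfolding b_def using that by (simp add: le_max_iff_disj Max_ge)
  have "b \<ge> 2" unfolding b_def by (simp add: Max_ge_iff)
  have "p (X n) \<le> b" for n
  proof (cases "n \<le> N")
    case False
    then have "p (X n) \<le> p (X N) + 1"
      using N[of n] p_diff[of "X n" "X N"] X by (simp add: Cauchy_carr)
    then show ?thesis using bm[of N] by simp
  qed (use bm[of n] in simp)
  then show ?thesis using that[of b] \<open>b \<ge> 2\<close> by force
qed

lemma Cauchy_real: "Cauchy_for A p X \<Longrightarrow> convergent (\<lambda>n. p (X n))"
proof -
  assume X: "Cauchy_for A p X"
  have "Cauchy (\<lambda>n. p (X n))"
    unfolding Cauchy_altdef2 dist_real_def
    using X p_diff unfolding Cauchy_for_def by (meson le_less_trans le_refl)
  then show ?thesis by (simp add: Cauchy_convergent_iff)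
qed

lemma Cauchy_I:
  assumes "\<And>n. Z n \<in> carrier A"
    and "\<And>e. e > 0 \<Longrightarrow> \<exists>N. \<forall>m\<ge>N. \<forall>n\<ge>N. p (Z m \<ominus> Z n) < e"
  shows "Cauchy_for A p Z"
  using assms unfolding Cauchy_for_def by blast

text \<open>Cauchy condition from domination by sum of two Cauchy differences.\<close>
lemma Cauchy_dom:
  assumes X: "Cauchy_for A p X" and Y: "Cauchy_for A p Y" and c: "c > 0"
    and Z: "\<And>n. Z n \<in> carrier A"
    and le: "\<And>m n. p (Z m \<ominus> Z n) \<le> c * (p (X m \<ominus> X n) + p (Y m \<ominus> Y n))"
  shows "Cauchy_for A p Z"
proof (rule Cauchy_I[OF Z])
  fix e :: real assume "e > 0"
  then have e: "e / (2 * c) > 0" using c by simp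
  obtain N1 where N1: "\<And>m n. m \<ge> N1 \<Longrightarrow> n \<ge> N1 \<Longrightarrow> p (X m \<ominus> X n) < e / (2*c)"
    using X e unfolding Cauchy_for_def by meson
  obtain N2 where N2: "\<And>m n. m \<ge> N2 \<Longrightarrow> n \<ge> N2 \<Longrightarrow> p (Y m \<ominus> Y n) < e / (2*c)"
    using Y e unfolding Cauchy_for_def by meson
  have "p (Z m \<ominus> Z n) < e" if "m \<ge> max N1 N2" "n \<ge> max N1 N2" for m n
  proof -
    have "p (X m \<ominus> X n) + p (Y m \<ominus> Y n) < e / (2*c) + e / (2*c)"
      using N1[of m n] N2[of m n] that by (intro add_strict_mono) auto
    also have "\<dots> = e / c" by simp
    finally have "c * (p (X m \<ominus> X n) + p (Y m \<ominus> Y n)) < c * (e / c)"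
      using c by (intro mult_strict_left_mono)
    then show ?thesis using le[of m n] c by simp
  qed
  then show "\<exists>N. \<forall>m\<ge>N. \<forall>n\<ge>N. p (Z m \<ominus> Z n) < e" by blast
qed

lemma Cauchy_const: "x \<in> carrier A \<Longrightarrow> Cauchy_for A p (\<lambda>n. x)"
  by (rule Cauchy_I) (auto simp: p_zero minus_eq r_neg)

lemma Cauchy_add: 
  assumes X: "Cauchy_for A p X" and Y: "Cauchy_for A p Y"
  shows "Cauchy_for A p (\<lambda>n. X n \<oplus> Y n)"
proof (rule Cauchy_dom[OF X Y zero_less_one])
  fix m n
  have c: "X m \<in> carrier A" "X n \<in> carrier A" "Y m \<in> carrier A" "Y n \<in> carrier A"
    using X Y by (auto simp: Cauchy_carr)
  have "X m \<oplus> Y m \<ominus> (X n \<oplus> Y n) = (X m \<ominus> X n) \<oplus> (Y m \<ominus> Y n)" using c by algebra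
  then show "p (X m \<oplus> Y m \<ominus> (X n \<oplus> Y n)) \<le> 1 * (p (X m \<ominus> X n) + p (Y m \<ominus> Y n))"
    using p_add[of "X m \<ominus> X n" "Y m \<ominus> Y n"] c by simp
qed (use X Y in \<open>auto simp: Cauchy_carr\<close>)

lemma Cauchy_smult: 
  assumes X: "Cauchy_for A p X" 
  shows "Cauchy_for A p (\<lambda>n. c \<odot> X n)"
proof (rule Cauchy_dom[OF X X, of "cmod c + 1"])
  fix m n
  have c: "X m \<in> carrier A" "X n \<in> carrier A" using X by (auto simp: Cauchy_carr)
  have "p (c \<odot> X m \<ominus> c \<odot> X n) = cmod c * p (X m \<ominus> X n)"
    using c by (simp add: p_smult flip: smult_minus)
  also have "\<dots> \<le> (cmod c + 1) * (p (X m \<ominus> X n) + p (X m \<ominus> X n))"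
    using p_nonneg[of "X m \<ominus> X n"] c by (intro mult_mono) auto
  finally show "p (c \<odot> X m \<ominus> c \<odot> X n) \<le> (cmod c + 1) * (p (X m \<ominus> X n) + p (X m \<ominus> X n))" .
qed (use X in \<open>auto simp: Cauchy_carr smult_closed add_nonneg_pos\<close>)

lemma Cauchy_star: 
  assumes X: "Cauchy_for A p X" 
  shows "Cauchy_for A p (\<lambda>n. astar A (X n))"
proof (rule Cauchy_dom[OF X X zero_less_one])
  fix m n
  have c: "X m \<in> carrier A" "X n \<in> carrier A" using X by (auto simp: Cauchy_carr)
  show "p (astar A (X m) \<ominus> astar A (X n)) \<le> 1 * (p (X m \<ominus> X n) + p (X m \<ominus> X n))"
    using c p_nonneg[of "X m \<ominus> X n"] by (simp add: p_star flip: star_minus)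
qed (use X in \<open>auto simp: Cauchy_carr star_closed\<close>)

lemma p_mult_diff:
  assumes c: "x \<in> carrier A" "x' \<in> carrier A" "y \<in> carrier A" "y' \<in> carrier A"
  shows "p (x \<otimes> y \<ominus> x' \<otimes> y') \<le> p x * p (y \<ominus> y') + p (x \<ominus> x') * p y'"
proof -
  have "x \<otimes> y \<ominus> x' \<otimes> y' = x \<otimes> (y \<ominus> y') \<oplus> (x \<ominus> x') \<otimes> y'" using c by algebra
  then show ?thesis
    using p_add[of "x \<otimes> (y \<ominus> y')" "(x \<ominus> x') \<otimes> y'"] p_mult[of x "y \<ominus> y'"] p_mult[of "x \<ominus> x'" y'] c
    by simp
qed

lemma Cauchy_mult: 
  assumes X: "Cauchy_for A p X" and Y: "Cauchy_for A p Y"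
  shows "Cauchy_for A p (\<lambda>n. X n \<otimes> Y n)"
proof -
  obtain a where a: "a > 0" "\<And>n. p (X n) \<le> a" using Cauchy_bound[OF X] by blast
  obtain b where b: "b > 0" "\<And>n. p (Y n) \<le> b" using Cauchy_bound[OF Y] by blast
  show ?thesis
  proof (rule Cauchy_dom[OF X Y, of "a + b"])
    fix m n
    have c: "X m \<in> carrier A" "X n \<in> carrier A" "Y m \<in> carrier A" "Y n \<in> carrier A"
      using X Y by (auto simp: Cauchy_carr)
    have "p (X m) * p (Y m \<ominus> Y n) \<le> (a + b) * p (Y m \<ominus> Y n)"
      using a(2)[of m] b(1) c by (intro mult_right_mono) (auto simp: p_nonneg)
    moreover have "p (X m \<ominus> X n) * p (Y n) \<le> p (X m \<ominus> X n) * (a + b)"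
      using b(2)[of n] a(1) c by (intro mult_left_mono) (auto simp: p_nonneg)
    ultimately show "p (X m \<otimes> Y m \<ominus> X n \<otimes> Y n) \<le> (a + b) * (p (X m \<ominus> X n) + p (Y m \<ominus> Y n))"
      using p_mult_diff[OF c] by (simp add: algebra_simps)
  qed (use X Y a b in \<open>auto simp: Cauchy_carr\<close>)
qed

lemma Cauchy_alg_simps:
  "carrier C = Collect (Cauchy_for A p)" "mult C X Y = (\<lambda>n. X n \<otimes> Y n)" "one C = (\<lambda>n. \<one>)"
  "zero C = (\<lambda>n. \<zero>)" "add C X Y = (\<lambda>n. X n \<oplus> Y n)"
  "smult C c X = (\<lambda>n. c \<odot> X n)" "astar C X = (\<lambda>n. astar A (X n))"
  by (simp_all add: Cauchy_algebra_def)

lemma Cauchy_uminus: "Cauchy_for A p X \<Longrightarrow> Cauchy_for A p (\<lambda>n. \<ominus> X n)"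
  using Cauchy_smult[of X "- 1"] by (simp add: uminus_eq_smult Cauchy_carr)

lemma Cauchy_ring: "ring C"
proof (intro ringI abelian_groupI monoidI)
  fix X assume "X \<in> carrier C"
  then show "\<exists>Y\<in>carrier C. Y \<oplus>\<^bsub>C\<^esub> X = \<zero>\<^bsub>C\<^esub>"
    by (intro bexI[of _ "\<lambda>n. \<ominus> X n"]) (auto simp: Cauchy_alg_simps Cauchy_uminus Cauchy_carr l_neg)
qed (auto simp: Cauchy_alg_simps Cauchy_add Cauchy_mult Cauchy_const Cauchy_carr a_ac m_assoc l_distr r_distr)

lemma Cauchy_star_algebra: "complex_star_algebra C"
proof -
  interpret C: ring C by (rule Cauchy_ring)
  show ?thesis
    by unfold_locales
      (auto simp: Cauchy_alg_simps Cauchy_smult Cauchy_star Cauchy_carr smult_add_left smult_add_right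
        smult_assoc smult_1 smult_mult_left smult_mult_right star_add star_smult star_mult star_star)
qed

lemma Cauchy_uminus_eq: "X \<in> carrier C \<Longrightarrow> \<ominus>\<^bsub>C\<^esub> X = (\<lambda>n. \<ominus> X n)"
proof -
  assume X: "X \<in> carrier C"
  interpret C: complex_star_algebra C by (rule Cauchy_star_algebra)
  show ?thesis using C.uminus_eq_smult[OF X] X by (auto simp: Cauchy_alg_simps uminus_eq_smult Cauchy_carr)
qed

lemma Cauchy_minus_eq: "Y \<in> carrier C \<Longrightarrow> X \<ominus>\<^bsub>C\<^esub> Y = (\<lambda>n. X n \<ominus> Y n)"
  by (simp add: a_minus_def Cauchy_uminus_eq) (simp add: Cauchy_alg_simps)

lemma null_ideal: "ideal I C"
proof -
  interpret C: complex_star_algebra C by (rule Cauchy_star_algebra)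
  have carr: "X \<in> I \<Longrightarrow> X \<in> carrier C" for X by (simp add: null_sequences_def Cauchy_alg_simps)
  have squeeze: "Z \<in> I" if "Z \<in> carrier C" "\<And>n. p (Z n) \<le> r n" "r \<longlonglongrightarrow> 0" for Z r
    using that tendsto_sandwich[of "\<lambda>n. 0" "\<lambda>n. p (Z n)" sequentially r 0]
    by (simp add: null_sequences_def Cauchy_alg_simps p_nonneg Cauchy_carr)
  have lm: "(\<lambda>n. p (X n)) \<longlonglongrightarrow> 0" if "X \<in> I" for X using that by (simp add: null_sequences_def)
  have sub: "subgroup I (add_monoid C)"
  proof (rule group.subgroupI[OF C.a_group])
    show "I \<subseteq> carrier (add_monoid C)" using carr by auto
    show "I \<noteq> {}" using Cauchy_const[of \<zero>] by (force simp: null_sequences_def p_zero)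
    fix X assume X: "X \<in> I"
    have "\<ominus>\<^bsub>C\<^esub> X \<in> I"
      by (rule squeeze[of _ "\<lambda>n. p (X n)"])
        (use X carr[OF X] in \<open>auto simp: lm Cauchy_uminus_eq p_uminus Cauchy_carr Cauchy_alg_simps Cauchy_uminus\<close>)
    then show "inv\<^bsub>add_monoid C\<^esub> X \<in> I" by (simp add: a_inv_def)
    fix Y assume Y: "Y \<in> I"
    have "X \<oplus>\<^bsub>C\<^esub> Y \<in> I"
      by (rule squeeze[of _ "\<lambda>n. p (X n) + p (Y n)"])
        (use carr[OF X] carr[OF Y] tendsto_add[OF lm[OF X] lm[OF Y]] in \<open>auto simp: p_add Cauchy_carr Cauchy_alg_simps Cauchy_add\<close>)
    then show "X \<otimes>\<^bsub>add_monoid C\<^esub> Y \<in> I" by simp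
  qed
  show ?thesis
  proof (intro idealI sub C.ring_axioms)
    fix X Y assume X: "X \<in> I" and Y: "Y \<in> carrier C"
    have Yc: "Cauchy_for A p Y" "Cauchy_for A p X" using Y carr[OF X] by (auto simp: Cauchy_alg_simps)
    obtain b where b: "b > 0" "\<And>n. p (Y n) \<le> b" using Cauchy_bound[OF Yc(1)] by blast
    have *: "p (X n) * p (Y n) \<le> p (X n) * b" for n
      using b(2) Yc by (intro mult_left_mono) (auto simp: p_nonneg Cauchy_carr)
    have l: "(\<lambda>n. p (X n) * b) \<longlonglongrightarrow> 0" using tendsto_mult_right[OF lm[OF X], of b] by simp
    show "Y \<otimes>\<^bsub>C\<^esub> X \<in> I"
    proof (rule squeeze[OF _ _ l])
      show "p ((Y \<otimes>\<^bsub>C\<^esub> X) n) \<le> p (X n) * b" for n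
        using *[of n] p_mult[of "Y n" "X n"] Yc by (simp add: Cauchy_alg_simps Cauchy_carr mult.commute)
    qed (use Y carr[OF X] in auto)
    show "X \<otimes>\<^bsub>C\<^esub> Y \<in> I"
    proof (rule squeeze[OF _ _ l])
      show "p ((X \<otimes>\<^bsub>C\<^esub> Y) n) \<le> p (X n) * b" for n
        using *[of n] p_mult[of "X n" "Y n"] Yc by (simp add: Cauchy_alg_simps Cauchy_carr)
    qed (use Y carr[OF X] in auto)
  qed
qed

end


lemma (in complex_star_algebra) star_quot:
  assumes I: "ideal I A" and star: "\<And>x. x \<in> I \<Longrightarrow> astar A x \<in> I"
  shows star_quot_carrier: "carrier (star_quot A q I) = (\<lambda>x. I +> x) ` carrier A"
    and star_quot_mult: "\<And>x y. \<lbrakk>x \<in> carrier A; y \<in> carrier A\<rbrakk> \<Longrightarrow>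
      (I +> x) \<otimes>\<^bsub>star_quot A q I\<^esub> (I +> y) = I +> x \<otimes> y"
    and star_quot_add: "\<And>x y. \<lbrakk>x \<in> carrier A; y \<in> carrier A\<rbrakk> \<Longrightarrow>
      (I +> x) \<oplus>\<^bsub>star_quot A q I\<^esub> (I +> y) = I +> (x \<oplus> y)"
    and star_quot_one: "\<one>\<^bsub>star_quot A q I\<^esub> = I +> \<one>"
    and star_quot_zero: "\<zero>\<^bsub>star_quot A q I\<^esub> = I +> \<zero>"
    and star_quot_smult: "\<And>x c. x \<in> carrier A \<Longrightarrow>
      c \<odot>\<^bsub>star_quot A q I\<^esub> (I +> x) = I +> c \<odot> x"
    and star_quot_star: "\<And>x. x \<in> carrier A \<Longrightarrow>
      astar (star_quot A q I) (I +> x) = I +> astar A x"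
    and star_quot_algebra: "complex_star_algebra (star_quot A q I)"
proof -
  interpret I: ideal I A by (rule I)
  let ?Q = "star_quot A q I"
  have h: "(+>) I \<in> ring_hom A (A Quot I)" by (rule I.rcos_ring_hom)
  have UN: "(\<Union>y\<in>I +> x. I +> f y) = I +> f x"
    if x: "x \<in> carrier A" and f: "\<And>y. y \<in> carrier A \<Longrightarrow> f y \<in> carrier A"
      and fI: "\<And>y. \<lbrakk>y \<in> carrier A; y \<ominus> x \<in> I\<rbrakk> \<Longrightarrow> f y \<ominus> f x \<in> I" for x f
  proof -
    have "I +> f y = I +> f x" if y: "y \<in> I +> x" for y
    proof -
      have "I +> x \<subseteq> carrier A" using x by (simp add: I.a_subset a_r_coset_subset_G)
      then have yc: "y \<in> carrier A" using y by auto
      have "I +> y = I +> x" by (rule a_repr_independence[OF y x I.a_subgroup, symmetric])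
      then have "y \<ominus> x \<in> I" using quotient_eq_iff_same_a_r_cos[OF I yc x] by simp
      then show ?thesis using fI[OF yc] quotient_eq_iff_same_a_r_cos[OF I f f, OF yc x] by simp
    qed
    then have "(\<Union>y\<in>I +> x. I +> f y) = (\<Union>y\<in>I +> x. I +> f x)" by (intro SUP_cong refl)
    also have "\<dots> = I +> f x" using I.a_rcos_self[OF x] by blast
    finally show ?thesis .
  qed
  have smI: "c \<odot> x \<in> I" if "x \<in> I" for c x
    using that I.I_l_closed[of x "c \<odot> \<one>"] smult_eq_mult[of x c] I.a_Hcarr[of x]
    by (auto simp: smult_closed)
  show carr: "carrier ?Q = (\<lambda>x. I +> x) ` carrier A"
    by (auto simp: star_quot_def FactRing_def A_RCOSETS_def' )
  show m: "(I +> x) \<otimes>\<^bsub>?Q\<^esub> (I +> y) = I +> x \<otimes> y" if "x \<in> carrier A" "y \<in> carrier A" for x y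
    using ring_hom_mult[OF h that] by (simp add: star_quot_def)
  show a: "(I +> x) \<oplus>\<^bsub>?Q\<^esub> (I +> y) = I +> (x \<oplus> y)" if "x \<in> carrier A" "y \<in> carrier A" for x y
    using ring_hom_add[OF h that] by (simp add: star_quot_def)
  show o: "\<one>\<^bsub>?Q\<^esub> = I +> \<one>" by (simp add: star_quot_def FactRing_def)
  show z: "\<zero>\<^bsub>?Q\<^esub> = I +> \<zero>"
    using I.a_subset by (simp add: star_quot_def FactRing_def)
  show s: "c \<odot>\<^bsub>?Q\<^esub> (I +> x) = I +> c \<odot> x" if "x \<in> carrier A" for x c
    using UN[of x "\<lambda>y. c \<odot> y"] that smI by (simp add: star_quot_def smult_closed flip: smult_minus)
  show st: "astar ?Q (I +> x) = I +> astar A x" if "x \<in> carrier A" for x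
    using UN[of x "astar A"] that star by (simp add: star_quot_def star_closed flip: star_minus)
  have "ring ?Q"
  proof (intro ringI abelian_groupI monoidI)
    fix U assume "U \<in> carrier ?Q"
    then obtain x where x: "x \<in> carrier A" "U = I +> x" by (auto simp: carr)
    then show "\<exists>V\<in>carrier ?Q. V \<oplus>\<^bsub>?Q\<^esub> U = \<zero>\<^bsub>?Q\<^esub>"
      by (intro bexI[of _ "I +> (\<ominus> x)"]) (auto simp: carr a z l_neg)
  qed (auto simp: carr m a o z a_ac m_assoc l_distr r_distr)
  then interpret Q: ring ?Q .
  show "complex_star_algebra ?Q"
    by unfold_locales
      (auto simp: carr m a s st smult_closed star_closed smult_add_left smult_add_right
        smult_assoc smult_1 smult_mult_left smult_mult_right star_add star_smult star_mult star_star)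
qed

context seminormed_star_algebra
begin

abbreviation (input) "Q \<equiv> completion A p"
abbreviation (input) "cls X \<equiv> I +>\<^bsub>C\<^esub> X"

lemma null_star: "X \<in> I \<Longrightarrow> astar C X \<in> I"
  by (auto simp: null_sequences_def Cauchy_alg_simps Cauchy_star p_star Cauchy_carr)

lemmas completion_quot = complex_star_algebra.star_quot[OF Cauchy_star_algebra null_ideal null_star,
    where q = "\<lambda>X. lim (\<lambda>n. p (X n))", folded completion_def]

lemma Q_star_algebra: "complex_star_algebra Q"
  by (rule completion_quot)

lemma cls_carrier: "U \<in> carrier Q \<longleftrightarrow> (\<exists>X. Cauchy_for A p X \<and> U = cls X)"
  by (auto simp: completion_quot(1) Cauchy_alg_simps)

lemma clsE: assumes "U \<in> carrier Q" obtains X where "Cauchy_for A p X" "U = cls X"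
  using assms cls_carrier by auto

lemma cls_ops:
  assumes X: "Cauchy_for A p X"
  shows "Cauchy_for A p Y \<Longrightarrow> cls X \<oplus>\<^bsub>Q\<^esub> cls Y = cls (\<lambda>n. X n \<oplus> Y n)"
    "Cauchy_for A p Y \<Longrightarrow> cls X \<otimes>\<^bsub>Q\<^esub> cls Y = cls (\<lambda>n. X n \<otimes> Y n)"
    "c \<odot>\<^bsub>Q\<^esub> cls X = cls (\<lambda>n. c \<odot> X n)"
    "astar Q (cls X) = cls (\<lambda>n. astar A (X n))"
    "\<one>\<^bsub>Q\<^esub> = cls (\<lambda>n. \<one>)" "\<zero>\<^bsub>Q\<^esub> = cls (\<lambda>n. \<zero>)"
  using assms completion_quot(2-7) by (auto simp: Cauchy_alg_simps)

lemma cls_minus: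
  assumes X: "Cauchy_for A p X" "Cauchy_for A p Y"
  shows "cls X \<ominus>\<^bsub>Q\<^esub> cls Y = cls (\<lambda>n. X n \<ominus> Y n)"
proof -
  interpret Q: complex_star_algebra Q by (rule Q_star_algebra)
  have "cls Y \<in> carrier Q" using X cls_carrier by auto
  then have "\<ominus>\<^bsub>Q\<^esub> cls Y = cls (\<lambda>n. (-1) \<odot> Y n)"
    by (simp add: Q.uminus_eq_smult cls_ops X)
  also have "(\<lambda>n. (-1) \<odot> Y n) = (\<lambda>n. \<ominus> Y n)" using X by (simp add: uminus_eq_smult Cauchy_carr)
  finally show ?thesis using X by (simp add: minus_eq a_minus_def cls_ops Cauchy_uminus)
qed

lemma cls_eq_iff:
  assumes "Cauchy_for A p X" "Cauchy_for A p Y"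
  shows "cls X = cls Y \<longleftrightarrow> (\<lambda>n. p (X n \<ominus> Y n)) \<longlonglongrightarrow> 0"
proof -
  interpret C: ring C by (rule Cauchy_ring)
  have "X \<ominus>\<^bsub>C\<^esub> Y \<in> I \<longleftrightarrow> cls X = cls Y"
    using C.quotient_eq_iff_same_a_r_cos[OF null_ideal] assms by (simp add: Cauchy_alg_simps)
  moreover have "X \<ominus>\<^bsub>C\<^esub> Y \<in> carrier C" using assms by (simp add: Cauchy_alg_simps(1)) (metis C.minus_closed Cauchy_alg_simps(1) mem_Collect_eq)
  ultimately show ?thesis
    using assms by (auto simp: Cauchy_minus_eq Cauchy_alg_simps(1) null_sequences_def)
qed

lemma cls_mem:
  assumes X: "Cauchy_for A p X"
  shows "Y \<in> cls X \<longleftrightarrow> Cauchy_for A p Y \<and> cls Y = cls X"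
proof -
  interpret C: ring C by (rule Cauchy_ring)
  interpret I: ideal I C by (rule null_ideal)
  have "X \<in> carrier C" using X by (simp add: Cauchy_alg_simps(1))
  then have "cls X \<subseteq> carrier C" by (simp add: I.a_subset C.a_r_coset_subset_G)
  note sub = this
  show ?thesis
  proof
    assume Y: "Y \<in> cls X"
    have "cls X = cls Y" by (rule C.a_repr_independence[OF Y \<open>X \<in> carrier C\<close> I.a_subgroup])
    moreover have "Cauchy_for A p Y" using sub Y by (auto simp: Cauchy_alg_simps(1))
    ultimately show "Cauchy_for A p Y \<and> cls Y = cls X" by simp
  next
    assume Y: "Cauchy_for A p Y \<and> cls Y = cls X"
    then have "Y \<in> cls Y" by (intro I.a_rcos_self) (simp add: Cauchy_alg_simps(1))
    with Y show "Y \<in> cls X" by simp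
  qed
qed

lemma nrm_cls:
  assumes X: "Cauchy_for A p X"
  shows "(\<lambda>n. p (X n)) \<longlonglongrightarrow> nrm Q (cls X)"
proof -
  have lX: "(\<lambda>n. p (X n)) \<longlonglongrightarrow> lim (\<lambda>n. p (X n))"
    using Cauchy_real[OF X] convergent_LIMSEQ_iff by auto
  have "lim (\<lambda>n. p (Y n)) = lim (\<lambda>n. p (X n))" if Y: "Y \<in> cls X" for Y
  proof -
    have Yc: "Cauchy_for A p Y" and l: "(\<lambda>n. p (Y n \<ominus> X n)) \<longlonglongrightarrow> 0"
      using Y X by (auto simp: cls_mem cls_eq_iff)
    have d: "\<bar>p (Y n) - p (X n)\<bar> \<le> p (Y n \<ominus> X n)" for n
      by (rule p_diff[OF Cauchy_carr[OF Yc] Cauchy_carr[OF X]])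
    have "(\<lambda>n. \<bar>p (Y n) - p (X n)\<bar>) \<longlonglongrightarrow> 0"
      by (rule tendsto_sandwich[OF _ _ tendsto_const l]) (simp_all add: d)
    then have "(\<lambda>n. p (Y n) - p (X n)) \<longlonglongrightarrow> 0" by (rule tendsto_rabs_zero_cancel)
    then have "(\<lambda>n. (p (Y n) - p (X n)) + p (X n)) \<longlonglongrightarrow> 0 + lim (\<lambda>n. p (X n))"
      using lX by (rule tendsto_add)
    then have "(\<lambda>n. p (Y n)) \<longlonglongrightarrow> lim (\<lambda>n. p (X n))" by simp
    then show ?thesis by (rule limI)
  qed
  moreover have "X \<in> cls X" using cls_mem[OF X] X by blast
  ultimately have "(\<lambda>X. lim (\<lambda>n. p (X n))) ` cls X = {lim (\<lambda>n. p (X n))}" by blast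
  then have "nrm Q (cls X) = lim (\<lambda>n. p (X n))" by (simp add: completion_def star_quot_def)
  then show ?thesis using lX by simp
qed

lemma Q_seminorm: "cstar_seminorm Q (nrm Q)"
  unfolding cstar_seminorm_def
proof (intro conjI ballI allI)
  fix U assume "U \<in> carrier Q"
  then obtain X where X: "Cauchy_for A p X" and U: "U = cls X" by (rule clsE)
  show "0 \<le> nrm Q U"
    unfolding U by (rule LIMSEQ_le_const[OF nrm_cls[OF X]]) (intro exI[of _ 0] allI impI p_nonneg Cauchy_carr[OF X])
  show "nrm Q (c \<odot>\<^bsub>Q\<^esub> U) = cmod c * nrm Q U" for c
  proof (rule LIMSEQ_unique)
    show "(\<lambda>n. p (c \<odot> X n)) \<longlonglongrightarrow> nrm Q (c \<odot>\<^bsub>Q\<^esub> U)"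
      using nrm_cls[OF Cauchy_smult[OF X]] by (simp add: U cls_ops X)
    show "(\<lambda>n. p (c \<odot> X n)) \<longlonglongrightarrow> cmod c * nrm Q U"
      using tendsto_mult_left[OF nrm_cls[OF X]] X by (simp add: U p_smult Cauchy_carr)
  qed
  show "nrm Q (astar Q U \<otimes>\<^bsub>Q\<^esub> U) = (nrm Q U)\<^sup>2"
  proof (rule LIMSEQ_unique)
    show "(\<lambda>n. p (astar A (X n) \<otimes> X n)) \<longlonglongrightarrow> nrm Q (astar Q U \<otimes>\<^bsub>Q\<^esub> U)"
      using nrm_cls[OF Cauchy_mult[OF Cauchy_star[OF X] X]] by (simp add: U cls_ops X Cauchy_star)
    show "(\<lambda>n. p (astar A (X n) \<otimes> X n)) \<longlonglongrightarrow> (nrm Q U)\<^sup>2"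
      using tendsto_power[OF nrm_cls[OF X], of 2] X by (simp add: U p_cstar Cauchy_carr)
  qed
  fix V assume "V \<in> carrier Q"
  then obtain Y where Y: "Cauchy_for A p Y" and V: "V = cls Y" by (rule clsE)
  show "nrm Q (U \<oplus>\<^bsub>Q\<^esub> V) \<le> nrm Q U + nrm Q V"
    unfolding U V cls_ops(1)[OF X Y]
    by (rule LIMSEQ_le[OF nrm_cls[OF Cauchy_add[OF X Y]] tendsto_add[OF nrm_cls[OF X] nrm_cls[OF Y]]])
      (intro exI[of _ 0] allI impI p_add Cauchy_carr[OF X] Cauchy_carr[OF Y])
  show "nrm Q (U \<otimes>\<^bsub>Q\<^esub> V) \<le> nrm Q U * nrm Q V"
    unfolding U V cls_ops(2)[OF X Y]
    by (rule LIMSEQ_le[OF nrm_cls[OF Cauchy_mult[OF X Y]] tendsto_mult[OF nrm_cls[OF X] nrm_cls[OF Y]]])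
      (intro exI[of _ 0] allI impI p_mult Cauchy_carr[OF X] Cauchy_carr[OF Y])
qed

abbreviation (input) "\<iota> \<equiv> to_completion A p"

lemma iota_eq: "\<iota> x = cls (\<lambda>n. x)" by (simp add: to_completion_def)

lemma iota_carrier: "x \<in> carrier A \<Longrightarrow> \<iota> x \<in> carrier Q"
  using Cauchy_const cls_carrier iota_eq by auto

lemma nrm_iota: "x \<in> carrier A \<Longrightarrow> nrm Q (\<iota> x) = p x"
  unfolding iota_eq by (rule LIMSEQ_unique[OF nrm_cls tendsto_const]) (rule Cauchy_const)

lemma nrm_iota_tendsto:
  assumes X: "Cauchy_for A p X"
  shows "(\<lambda>k. nrm Q (\<iota> (X k) \<ominus>\<^bsub>Q\<^esub> cls X)) \<longlonglongrightarrow> 0"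
proof (rule LIMSEQ_I)
  fix e :: real assume "e > 0"
  then obtain N where N: "\<And>m n. m \<ge> N \<Longrightarrow> n \<ge> N \<Longrightarrow> p (X m \<ominus> X n) < e / 2"
    using X unfolding Cauchy_for_def by (meson half_gt_zero)
  interpret Q: seminormed_star_algebra Q "nrm Q"
    using Q_star_algebra Q_seminorm by (simp add: seminormed_star_algebra_def seminormed_star_algebra_axioms_def)
  have clsX: "cls X \<in> carrier Q" using X cls_carrier by auto
  have "nrm Q (\<iota> (X k) \<ominus>\<^bsub>Q\<^esub> cls X) < e" if k: "k \<ge> N" for k
  proof -
    have Xk: "X k \<in> carrier A" using X by (rule Cauchy_carr)
    have "nrm Q (\<iota> (X k) \<ominus>\<^bsub>Q\<^esub> cls X) = nrm Q (cls X \<ominus>\<^bsub>Q\<^esub> \<iota> (X k))"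
      by (rule Q.p_minus_commute[OF iota_carrier[OF Xk] clsX])
    also have "\<dots> = nrm Q (cls (\<lambda>n. X n \<ominus> X k))"
      using Xk X by (simp add: iota_eq cls_minus Cauchy_const)
    also have "Cauchy_for A p (\<lambda>n. X n \<ominus> X k)"
      using Cauchy_add[OF X Cauchy_uminus[OF Cauchy_const[OF Xk]]] by (simp add: minus_eq)
    then have "nrm Q (cls (\<lambda>n. X n \<ominus> X k)) \<le> e / 2"
      using N k by (intro LIMSEQ_le_const2[OF nrm_cls]) (auto intro!: exI[of _ N] less_imp_le)
    finally show ?thesis using \<open>e > 0\<close> by simp
  qed
  moreover have "0 \<le> nrm Q (\<iota> (X k) \<ominus>\<^bsub>Q\<^esub> cls X)" for k
    by (rule Q.p_nonneg[OF Q.minus_closed[OF iota_carrier[OF Cauchy_carr[OF X]] clsX]])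
  ultimately show "\<exists>no. \<forall>k\<ge>no. norm (nrm Q (\<iota> (X k) \<ominus>\<^bsub>Q\<^esub> cls X) - 0) < e"
    by (intro exI[of _ N]) simp
qed

theorem completion_cstar: "cstar_algebra Q"
proof -
  interpret Q: seminormed_star_algebra Q "nrm Q"
    using Q_star_algebra Q_seminorm by (simp add: seminormed_star_algebra_def seminormed_star_algebra_axioms_def)
  show ?thesis
  proof unfold_locales
    show "cstar_seminorm Q (nrm Q)" by (rule Q_seminorm)
    fix U assume U: "U \<in> carrier Q" "nrm Q U = 0"
    then obtain X where X: "Cauchy_for A p X" and U': "U = cls X" by (auto elim: clsE)
    have "(\<lambda>n. p (X n)) \<longlonglongrightarrow> 0" using nrm_cls[OF X] U U' by simp
    then have "cls X = cls (\<lambda>n. \<zero>)"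
      using X by (subst cls_eq_iff) (auto simp: Cauchy_const minus_eq Cauchy_carr)
    then show "U = \<zero>\<^bsub>Q\<^esub>" using U' X cls_ops by simp
  next
    fix W assume W: "Cauchy_for Q (nrm Q) W"
    have "\<exists>x\<in>carrier A. nrm Q (\<iota> x \<ominus>\<^bsub>Q\<^esub> W k) < 1 / Suc k" for k
    proof -
      have "W k \<in> carrier Q" using W by (simp add: Cauchy_for_def)
      then obtain X where X: "Cauchy_for A p X" and Wk: "W k = cls X" by (rule clsE)
      have "\<forall>\<^sub>F n in sequentially. nrm Q (\<iota> (X n) \<ominus>\<^bsub>Q\<^esub> cls X) < 1 / Suc k"
        by (rule order_tendstoD(2)[OF nrm_iota_tendsto[OF X]]) simp
      then obtain n where "nrm Q (\<iota> (X n) \<ominus>\<^bsub>Q\<^esub> cls X) < 1 / Suc k"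
        using eventually_happens'[OF sequentially_bot] by blast
      then show ?thesis using X Wk Cauchy_carr by auto
    qed
    then obtain x where xc: "\<And>k. x k \<in> carrier A"
      and xW: "\<And>k. nrm Q (\<iota> (x k) \<ominus>\<^bsub>Q\<^esub> W k) < 1 / Suc k" by metis
    have Wc: "W k \<in> carrier Q" for k using W by (simp add: Cauchy_for_def)
    have l0: "(\<lambda>k. nrm Q (\<iota> (x k) \<ominus>\<^bsub>Q\<^esub> W k)) \<longlonglongrightarrow> 0"
      by (rule tendsto_sandwich[OF _ _ tendsto_const LIMSEQ_inverse_real_of_nat])
        (use xW in \<open>auto simp: Q.p_nonneg iota_carrier xc Wc less_imp_le inverse_eq_divide simp del: of_nat_Suc\<close>)
    have X: "Cauchy_for A p x"
    proof (rule Cauchy_I[OF xc])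
      fix e :: real assume e: "e > 0"
      then have e3: "e / 3 > 0" by simp
      obtain N1 where N1: "\<And>m n. m \<ge> N1 \<Longrightarrow> n \<ge> N1 \<Longrightarrow> nrm Q (W m \<ominus>\<^bsub>Q\<^esub> W n) < e / 3"
        using W e3 unfolding Cauchy_for_def by meson
      obtain N2 where N2: "\<And>n. n \<ge> N2 \<Longrightarrow> nrm Q (\<iota> (x n) \<ominus>\<^bsub>Q\<^esub> W n) < e / 3"
        using order_tendstoD(2)[OF l0 e3] unfolding eventually_sequentially by auto
      have "p (x m \<ominus> x n) < e" if "m \<ge> max N1 N2" "n \<ge> max N1 N2" for m n
      proof -
        have c: "\<iota> (x m) \<in> carrier Q" "\<iota> (x n) \<in> carrier Q" "W m \<in> carrier Q" "W n \<in> carrier Q"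
          using xc Wc iota_carrier by auto
        have "p (x m \<ominus> x n) = nrm Q (\<iota> (x m \<ominus> x n))" using xc by (simp add: nrm_iota)
        also have "\<dots> = nrm Q (\<iota> (x m) \<ominus>\<^bsub>Q\<^esub> \<iota> (x n))"
          using xc by (simp add: iota_eq cls_minus Cauchy_const)
        also have "\<dots> \<le> nrm Q (\<iota> (x m) \<ominus>\<^bsub>Q\<^esub> W m) + (nrm Q (W m \<ominus>\<^bsub>Q\<^esub> W n) + nrm Q (W n \<ominus>\<^bsub>Q\<^esub> \<iota> (x n)))"
          using Q.p_triangle[of "\<iota> (x m)" "W m" "\<iota> (x n)"] Q.p_triangle[of "W m" "W n" "\<iota> (x n)"] c by linarith
        also have "nrm Q (W n \<ominus>\<^bsub>Q\<^esub> \<iota> (x n)) = nrm Q (\<iota> (x n) \<ominus>\<^bsub>Q\<^esub> W n)"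
          using c by (intro Q.p_minus_commute)
        finally show ?thesis using N1[of m n] N2[of m] N2[of n] that by simp
      qed
      then show "\<exists>N. \<forall>m\<ge>N. \<forall>n\<ge>N. p (x m \<ominus> x n) < e" by blast
    qed
    have clsX: "cls x \<in> carrier Q" using X cls_carrier by auto
    have "(\<lambda>n. nrm Q (W n \<ominus>\<^bsub>Q\<^esub> cls x)) \<longlonglongrightarrow> 0"
    proof (rule tendsto_sandwich[OF _ _ tendsto_const])
      show "(\<lambda>n. nrm Q (\<iota> (x n) \<ominus>\<^bsub>Q\<^esub> W n) + nrm Q (\<iota> (x n) \<ominus>\<^bsub>Q\<^esub> cls x)) \<longlonglongrightarrow> 0"
        using tendsto_add[OF l0 nrm_iota_tendsto[OF X]] by simp
      show "\<forall>\<^sub>F n in sequentially. nrm Q (W n \<ominus>\<^bsub>Q\<^esub> cls x) \<le>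
          nrm Q (\<iota> (x n) \<ominus>\<^bsub>Q\<^esub> W n) + nrm Q (\<iota> (x n) \<ominus>\<^bsub>Q\<^esub> cls x)"
        using Q.p_triangle[OF Wc iota_carrier[OF xc] clsX] Q.p_minus_commute[OF Wc iota_carrier[OF xc]]
        by (intro always_eventually allI) metis
    qed (use Wc clsX in \<open>auto simp: Q.p_nonneg\<close>)
    then show "\<exists>U\<in>carrier Q. (\<lambda>n. nrm Q (W n \<ominus>\<^bsub>Q\<^esub> U)) \<longlonglongrightarrow> 0" using clsX by blast
  qed
qed

theorem completion_universal:
  assumes D: "cstar_algebra D" and h: "h \<in> star_hom A D"
    and hp: "\<And>x. x \<in> carrier A \<Longrightarrow> nrm D (h x) \<le> p x"
  shows "\<exists>k\<in>star_hom (completion A p) D. (\<forall>x\<in>carrier A. k (\<iota> x) = h x) \<and>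
    (\<forall>U\<in>carrier (completion A p). nrm D (k U) \<le> nrm (completion A p) U)"
proof -
  interpret D: seminormed_star_algebra D "nrm D"
    using D by (simp add: cstar_algebra_def cstar_algebra_axioms_def
        seminormed_star_algebra_def seminormed_star_algebra_axioms_def)
  interpret DC: cstar_algebra D by (rule D)
  have hc: "h x \<in> carrier D" if "x \<in> carrier A" for x
    using h that by (auto simp: star_hom_def ring_hom_def)
  have ha: "h (x \<oplus> y) = h x \<oplus>\<^bsub>D\<^esub> h y" and hm: "h (x \<otimes> y) = h x \<otimes>\<^bsub>D\<^esub> h y"
    if "x \<in> carrier A" "y \<in> carrier A" for x y
    using h that by (auto simp: star_hom_def ring_hom_def)
  have h1: "h \<one> = \<one>\<^bsub>D\<^esub>" using h by (auto simp: star_hom_def ring_hom_def)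
  have hs: "h (c \<odot> x) = c \<odot>\<^bsub>D\<^esub> h x" and hst: "h (astar A x) = astar D (h x)"
    if "x \<in> carrier A" for x c
    using h that by (auto simp: star_hom_def)
  have hminus: "h (x \<ominus> y) = h x \<ominus>\<^bsub>D\<^esub> h y" if "x \<in> carrier A" "y \<in> carrier A" for x y
    using that by (simp add: minus_eq a_minus_def ha uminus_eq_smult hs smult_closed D.uminus_eq_smult hc)
  have hCau: "Cauchy_for D (nrm D) (\<lambda>n. h (X n))" if X: "Cauchy_for A p X" for X
  proof (rule D.Cauchy_I)
    show "h (X n) \<in> carrier D" for n using X by (intro hc Cauchy_carr)
    fix e :: real assume "e > 0"
    then obtain N where N: "\<And>m n. m \<ge> N \<Longrightarrow> n \<ge> N \<Longrightarrow> p (X m \<ominus> X n) < e"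
      using X unfolding Cauchy_for_def by meson
    have "nrm D (h (X m) \<ominus>\<^bsub>D\<^esub> h (X n)) < e" if "m \<ge> N" "n \<ge> N" for m n
      using N[OF that] hp[of "X m \<ominus> X n"] X by (simp add: hminus Cauchy_carr)
    then show "\<exists>N. \<forall>m\<ge>N. \<forall>n\<ge>N. nrm D (h (X m) \<ominus>\<^bsub>D\<^esub> h (X n)) < e" by blast
  qed
  define lm where "lm Z y \<longleftrightarrow> y \<in> carrier D \<and> (\<lambda>n. nrm D (Z n \<ominus>\<^bsub>D\<^esub> y)) \<longlonglongrightarrow> 0" for Z y
  have lmI: "lm Z y" if "y \<in> carrier D" "\<And>n. Z n \<in> carrier D"
    "\<And>n. nrm D (Z n \<ominus>\<^bsub>D\<^esub> y) \<le> r n" "r \<longlonglongrightarrow> 0" for Z y r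
    unfolding lm_def
  proof
    show "(\<lambda>n. nrm D (Z n \<ominus>\<^bsub>D\<^esub> y)) \<longlonglongrightarrow> 0"
      by (rule tendsto_sandwich[OF _ _ tendsto_const that(4)])
        (simp_all add: that D.p_nonneg)
  qed (rule that)
  have lm_unique: "y = z" if "lm Z y" "lm Z z" and Z: "\<And>n. Z n \<in> carrier D" for Z y z
  proof -
    have c: "y \<in> carrier D" "z \<in> carrier D" using that by (auto simp: lm_def)
    have le: "nrm D (y \<ominus>\<^bsub>D\<^esub> z) \<le> nrm D (Z n \<ominus>\<^bsub>D\<^esub> y) + nrm D (Z n \<ominus>\<^bsub>D\<^esub> z)" for n
      using D.p_triangle[OF c(1) Z c(2)] D.p_minus_commute[OF c(1) Z] by metis
    have l: "(\<lambda>n. nrm D (Z n \<ominus>\<^bsub>D\<^esub> y) + nrm D (Z n \<ominus>\<^bsub>D\<^esub> z)) \<longlonglongrightarrow> 0"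
      using tendsto_add[of _ 0 sequentially _ 0] that by (fastforce simp: lm_def)
    have "nrm D (y \<ominus>\<^bsub>D\<^esub> z) \<le> 0"
      by (rule LIMSEQ_le_const[OF l]) (use le in blast)
    then have "nrm D (y \<ominus>\<^bsub>D\<^esub> z) = 0" using D.p_nonneg[of "y \<ominus>\<^bsub>D\<^esub> z"] c by simp
    then have "y \<ominus>\<^bsub>D\<^esub> z = \<zero>\<^bsub>D\<^esub>" using DC.norm_definite c by simp
    moreover have "y = (y \<ominus>\<^bsub>D\<^esub> z) \<oplus>\<^bsub>D\<^esub> z" using c by algebra
    ultimately show ?thesis using c by simp
  qed
  define rep where "rep U = (SOME X. Cauchy_for A p X \<and> U = cls X)" for U
  have rep: "Cauchy_for A p (rep U)" "cls (rep U) = U" if "U \<in> carrier Q" for U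
    using someI_ex[of "\<lambda>X. Cauchy_for A p X \<and> U = cls X"] that cls_carrier
    unfolding rep_def by auto
  define k where "k U = (SOME y. lm (\<lambda>n. h (rep U n)) y)" for U
  have k0: "lm (\<lambda>n. h (rep U n)) (k U)" if U: "U \<in> carrier Q" for U
  proof -
    have "\<exists>y. lm (\<lambda>n. h (rep U n)) y"
      using DC.complete[OF hCau[OF rep(1)[OF U]]] by (auto simp: lm_def)
    then show ?thesis unfolding k_def by (rule someI_ex)
  qed
  have k: "lm (\<lambda>n. h (X n)) (k (cls X))" if X: "Cauchy_for A p X" for X
  proof -
    define Y where "Y = rep (cls X)"
    have U: "cls X \<in> carrier Q" using X cls_carrier by auto
    have Y: "Cauchy_for A p Y" and YX: "cls Y = cls X" using rep[OF U] by (auto simp: Y_def)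
    have kY: "lm (\<lambda>n. h (Y n)) (k (cls X))" using k0[OF U] by (simp add: Y_def)
    then have kc: "k (cls X) \<in> carrier D" by (simp add: lm_def)
    have hX: "h (X n) \<in> carrier D" and hY: "h (Y n) \<in> carrier D" for n
      by (intro hc Cauchy_carr[OF X]) (intro hc Cauchy_carr[OF Y])
    have l: "(\<lambda>n. p (X n \<ominus> Y n)) \<longlonglongrightarrow> 0" using cls_eq_iff[OF X Y] YX by simp
    show ?thesis
    proof (rule lmI[OF kc hX])
      fix n
      have "nrm D (h (X n) \<ominus>\<^bsub>D\<^esub> h (Y n)) \<le> p (X n \<ominus> Y n)"
        using hp[of "X n \<ominus> Y n"] Cauchy_carr[OF X] Cauchy_carr[OF Y] by (simp add: hminus)
      then show "nrm D (h (X n) \<ominus>\<^bsub>D\<^esub> k (cls X)) \<le> p (X n \<ominus> Y n) + nrm D (h (Y n) \<ominus>\<^bsub>D\<^esub> k (cls X))"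
        using D.p_triangle[OF hX hY kc, of n n] by linarith
      show "(\<lambda>n. p (X n \<ominus> Y n) + nrm D (h (Y n) \<ominus>\<^bsub>D\<^esub> k (cls X))) \<longlonglongrightarrow> 0"
        using tendsto_add[OF l, of _ 0] kY by (simp add: lm_def)
    qed
  qed
  have keq: "k (cls X) = y" if "Cauchy_for A p X" "lm (\<lambda>n. h (X n)) y" for X y
    using lm_unique[OF k[OF that(1)] that(2)] hc Cauchy_carr[OF that(1)] by blast
  have kc: "k (cls X) \<in> carrier D" and kl: "(\<lambda>n. nrm D (h (X n) \<ominus>\<^bsub>D\<^esub> k (cls X))) \<longlonglongrightarrow> 0"
    if "Cauchy_for A p X" for X
    using k[OF that] by (auto simp: lm_def)
  have kiota: "k (\<iota> x) = h x" if "x \<in> carrier A" for x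
    unfolding iota_eq
    by (rule keq[OF Cauchy_const[OF that]]) (use that in \<open>simp add: lm_def hc D.minus_eq D.r_neg D.p_zero\<close>)
  have kadd: "k (cls (\<lambda>n. X n \<oplus> Y n)) = k (cls X) \<oplus>\<^bsub>D\<^esub> k (cls Y)"
    and kmult: "k (cls (\<lambda>n. X n \<otimes> Y n)) = k (cls X) \<otimes>\<^bsub>D\<^esub> k (cls Y)"
    if X: "Cauchy_for A p X" and Y: "Cauchy_for A p Y" for X Y
  proof -
    let ?x = "k (cls X)" and ?y = "k (cls Y)"
    have Xn: "X n \<in> carrier A" and Yn: "Y n \<in> carrier A" for n
      by (rule Cauchy_carr[OF X], rule Cauchy_carr[OF Y])
    have xy: "?x \<in> carrier D" "?y \<in> carrier D" using kc X Y by auto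
    have "lm (\<lambda>n. h (X n \<oplus> Y n)) (?x \<oplus>\<^bsub>D\<^esub> ?y)"
    proof (rule lmI)
      fix n
      have "h (X n \<oplus> Y n) \<ominus>\<^bsub>D\<^esub> (?x \<oplus>\<^bsub>D\<^esub> ?y) = (h (X n) \<ominus>\<^bsub>D\<^esub> ?x) \<oplus>\<^bsub>D\<^esub> (h (Y n) \<ominus>\<^bsub>D\<^esub> ?y)"
        using hc[OF Xn[of n]] hc[OF Yn[of n]] xy by (simp add: ha Xn Yn) algebra
      then show "nrm D (h (X n \<oplus> Y n) \<ominus>\<^bsub>D\<^esub> (?x \<oplus>\<^bsub>D\<^esub> ?y)) \<le> nrm D (h (X n) \<ominus>\<^bsub>D\<^esub> ?x) + nrm D (h (Y n) \<ominus>\<^bsub>D\<^esub> ?y)"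
        using D.p_add[of "h (X n) \<ominus>\<^bsub>D\<^esub> ?x" "h (Y n) \<ominus>\<^bsub>D\<^esub> ?y"] xy by (simp add: hc Xn Yn)
      show "(\<lambda>n. nrm D (h (X n) \<ominus>\<^bsub>D\<^esub> ?x) + nrm D (h (Y n) \<ominus>\<^bsub>D\<^esub> ?y)) \<longlonglongrightarrow> 0"
        using tendsto_add[OF kl[OF X] kl[OF Y]] by simp
    qed (use xy in \<open>simp_all add: hc Xn Yn\<close>)
    then show "k (cls (\<lambda>n. X n \<oplus> Y n)) = ?x \<oplus>\<^bsub>D\<^esub> ?y" by (rule keq[OF Cauchy_add[OF X Y]])
    obtain b where b: "b > 0" "\<And>n. nrm D (h (X n)) \<le> b" using D.Cauchy_bound[OF hCau[OF X]] by blast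
    have "lm (\<lambda>n. h (X n \<otimes> Y n)) (?x \<otimes>\<^bsub>D\<^esub> ?y)"
    proof (rule lmI)
      fix n
      have c: "h (X n) \<in> carrier D" "h (Y n) \<in> carrier D" using hc Xn Yn by auto
      have "nrm D (h (X n)) * nrm D (h (Y n) \<ominus>\<^bsub>D\<^esub> ?y) \<le> b * nrm D (h (Y n) \<ominus>\<^bsub>D\<^esub> ?y)"
        using b(2)[of n] c xy by (intro mult_right_mono D.p_nonneg) auto
      then show "nrm D (h (X n \<otimes> Y n) \<ominus>\<^bsub>D\<^esub> (?x \<otimes>\<^bsub>D\<^esub> ?y)) \<le> b * nrm D (h (Y n) \<ominus>\<^bsub>D\<^esub> ?y) + nrm D (h (X n) \<ominus>\<^bsub>D\<^esub> ?x) * nrm D ?y"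
        using D.p_mult_diff[OF c(1) xy(1) c(2) xy(2)] by (simp add: hm Xn Yn)
      show "(\<lambda>n. b * nrm D (h (Y n) \<ominus>\<^bsub>D\<^esub> ?y) + nrm D (h (X n) \<ominus>\<^bsub>D\<^esub> ?x) * nrm D ?y) \<longlonglongrightarrow> 0"
        using tendsto_add[OF tendsto_mult_left[OF kl[OF Y], of b] tendsto_mult_right[OF kl[OF X], of "nrm D ?y"]]
        by simp
    qed (use xy in \<open>simp_all add: hc Xn Yn\<close>)
    then show "k (cls (\<lambda>n. X n \<otimes> Y n)) = ?x \<otimes>\<^bsub>D\<^esub> ?y" by (rule keq[OF Cauchy_mult[OF X Y]])
  qed
  have ksmult: "k (cls (\<lambda>n. c \<odot> X n)) = c \<odot>\<^bsub>D\<^esub> k (cls X)"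
    and kstar: "k (cls (\<lambda>n. astar A (X n))) = astar D (k (cls X))"
    if X: "Cauchy_for A p X" for X c
  proof -
    let ?x = "k (cls X)"
    have Xn: "X n \<in> carrier A" for n by (rule Cauchy_carr[OF X])
    have x: "?x \<in> carrier D" using kc X by auto
    have "lm (\<lambda>n. h (c \<odot> X n)) (c \<odot>\<^bsub>D\<^esub> ?x)"
    proof (rule lmI)
      show "nrm D (h (c \<odot> X n) \<ominus>\<^bsub>D\<^esub> c \<odot>\<^bsub>D\<^esub> ?x) \<le> cmod c * nrm D (h (X n) \<ominus>\<^bsub>D\<^esub> ?x)" for n
        using x by (simp add: hs hc Xn D.p_smult flip: D.smult_minus)
      show "(\<lambda>n. cmod c * nrm D (h (X n) \<ominus>\<^bsub>D\<^esub> ?x)) \<longlonglongrightarrow> 0"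
        using tendsto_mult_left[OF kl[OF X], of "cmod c"] by simp
    qed (use x in \<open>simp_all add: hc Xn smult_closed D.smult_closed\<close>)
    then show "k (cls (\<lambda>n. c \<odot> X n)) = c \<odot>\<^bsub>D\<^esub> ?x" by (rule keq[OF Cauchy_smult[OF X]])
    have "lm (\<lambda>n. h (astar A (X n))) (astar D ?x)"
    proof (rule lmI)
      show "nrm D (h (astar A (X n)) \<ominus>\<^bsub>D\<^esub> astar D ?x) \<le> nrm D (h (X n) \<ominus>\<^bsub>D\<^esub> ?x)" for n
        using x by (simp add: hst hc Xn D.p_star flip: D.star_minus)
    qed (use x kl[OF X] in \<open>simp_all add: hc Xn star_closed D.star_closed\<close>)
    then show "k (cls (\<lambda>n. astar A (X n))) = astar D ?x" by (rule keq[OF Cauchy_star[OF X]])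
  qed
  have knrm: "nrm D (k (cls X)) \<le> nrm Q (cls X)" if X: "Cauchy_for A p X" for X
  proof -
    have Xn: "X n \<in> carrier A" for n by (rule Cauchy_carr[OF X])
    have l: "(\<lambda>n. nrm D (h (X n) \<ominus>\<^bsub>D\<^esub> k (cls X)) + p (X n)) \<longlonglongrightarrow> nrm Q (cls X)"
      using tendsto_add[OF kl[OF X] nrm_cls[OF X]] by simp
    have "nrm D (k (cls X)) \<le> nrm D (h (X n) \<ominus>\<^bsub>D\<^esub> k (cls X)) + p (X n)" for n
      using D.p_diff[OF hc[OF Xn[of n]] kc[OF X]] hp[OF Xn[of n]] by linarith
    then show ?thesis by (intro LIMSEQ_le_const[OF l]) blast
  qed
  have "k \<in> star_hom Q D"
    unfolding star_hom_def mem_Collect_eq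
  proof (intro conjI ballI allI ring_hom_memI)
    show "k \<one>\<^bsub>Q\<^esub> = \<one>\<^bsub>D\<^esub>"
      using kiota[of \<one>] h1 cls_ops(5)[OF Cauchy_const[OF one_closed]] by (simp add: iota_eq)
    fix U c assume "U \<in> carrier Q"
    then obtain X where X: "Cauchy_for A p X" and U: "U = cls X" by (rule clsE)
    show "k U \<in> carrier D" using kc[OF X] U by simp
    show "k (c \<odot>\<^bsub>Q\<^esub> U) = c \<odot>\<^bsub>D\<^esub> k U" unfolding U cls_ops(3)[OF X] by (rule ksmult[OF X])
    show "k (astar Q U) = astar D (k U)" unfolding U cls_ops(4)[OF X] by (rule kstar[OF X])
    fix V assume "V \<in> carrier Q"
    then obtain Y where Y: "Cauchy_for A p Y" and V: "V = cls Y" by (rule clsE)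
    show "k (U \<oplus>\<^bsub>Q\<^esub> V) = k U \<oplus>\<^bsub>D\<^esub> k V" unfolding U V cls_ops(1)[OF X Y] by (rule kadd[OF X Y])
    show "k (U \<otimes>\<^bsub>Q\<^esub> V) = k U \<otimes>\<^bsub>D\<^esub> k V" unfolding U V cls_ops(2)[OF X Y] by (rule kmult[OF X Y])
  qed
  moreover have "nrm D (k U) \<le> nrm Q U" if "U \<in> carrier Q" for U
    using that knrm by (auto elim!: clsE)
  ultimately show ?thesis using kiota by blast
qed

end

lemma (in complex_star_algebra) cstar_seminorm_sup:
  assumes N: "\<And>q. q \<in> N \<Longrightarrow> cstar_seminorm A q" and ne: "N \<noteq> {}"
    and bd: "\<And>x. x \<in> carrier A \<Longrightarrow> bdd_above ((\<lambda>q. q x) ` N)"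
  shows "cstar_seminorm A (sup_seminorm N)"
    and "\<And>q x. \<lbrakk>q \<in> N; x \<in> carrier A\<rbrakk> \<Longrightarrow> q x \<le> sup_seminorm N x"
    and "\<And>x. \<lbrakk>x \<in> carrier A; \<And>q. q \<in> N \<Longrightarrow> q x = 0\<rbrakk> \<Longrightarrow> sup_seminorm N x = 0"
proof -
  let ?s = "sup_seminorm N"
  have S: "seminormed_star_algebra A q" if "q \<in> N" for q
    using N[OF that] complex_star_algebra_axioms
    by (simp add: seminormed_star_algebra_def seminormed_star_algebra_axioms_def)
  show up: "q x \<le> ?s x" if "q \<in> N" "x \<in> carrier A" for q x
    unfolding sup_seminorm_def by (rule cSUP_upper[OF that(1) bd[OF that(2)]])
  have least: "?s x \<le> b" if "\<And>q. q \<in> N \<Longrightarrow> q x \<le> b" for x b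
    unfolding sup_seminorm_def by (rule cSUP_least[OF ne that])
  show "?s x = 0" if "\<And>q. q \<in> N \<Longrightarrow> q x = 0" for x
  proof -
    have "(\<lambda>q. q x) ` N = {0}" using ne that by (force simp: image_def)
    then show ?thesis by (simp add: sup_seminorm_def)
  qed
  obtain q0 where q0: "q0 \<in> N" using ne by auto
  have nn: "0 \<le> ?s x" if "x \<in> carrier A" for x
    using up[OF q0 that] seminormed_star_algebra.p_nonneg[OF S[OF q0] that] by linarith
  have sm: "?s (c \<odot> x) \<le> cmod c * ?s x" if "x \<in> carrier A" for c x
    by (rule least) (auto simp: seminormed_star_algebra.p_smult[OF S] that intro!: mult_left_mono up)
  have sq: "q x ^ 2 \<le> ?s (astar A x \<otimes> x)" if "q \<in> N" "x \<in> carrier A" for q x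
    using up[OF that(1), of "astar A x \<otimes> x"] seminormed_star_algebra.p_cstar[OF S[OF that(1)] that(2)] that
    by (simp add: star_closed)
  show "cstar_seminorm A ?s"
    unfolding cstar_seminorm_def
  proof (intro conjI ballI allI)
    fix x assume x: "x \<in> carrier A"
    show "0 \<le> ?s x" by (rule nn[OF x])
    show "?s (c \<odot> x) = cmod c * ?s x" for c
    proof (cases "c = 0")
      case True
      then show ?thesis using sm[OF x, of 0] nn[of "0 \<odot> x"] x by (simp add: smult_closed)
    next
      case False
      have "cmod c * ?s x = cmod c * ?s (inverse c \<odot> (c \<odot> x))"
        using x False by (simp add: smult_1 flip: smult_assoc)
      also have "\<dots> \<le> cmod c * (cmod (inverse c) * ?s (c \<odot> x))"
        using x by (intro mult_left_mono sm smult_closed) auto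
      also have "\<dots> = ?s (c \<odot> x)" using False by (simp add: norm_inverse)
      finally show ?thesis using sm[OF x, of c] by linarith
    qed
    show "?s (astar A x \<otimes> x) = (?s x)\<^sup>2"
    proof (rule antisym)
      show "?s (astar A x \<otimes> x) \<le> (?s x)\<^sup>2"
      proof (rule least)
        fix q assume q: "q \<in> N"
        show "q (astar A x \<otimes> x) \<le> (?s x)\<^sup>2"
          using seminormed_star_algebra.p_cstar[OF S[OF q] x] up[OF q x]
            seminormed_star_algebra.p_nonneg[OF S[OF q] x] by (simp add: power_mono)
      qed
      have "?s x \<le> sqrt (?s (astar A x \<otimes> x))"
        by (rule least) (use sq[OF _ x] in \<open>simp add: real_le_rsqrt\<close>)
      then have "(?s x)\<^sup>2 \<le> (sqrt (?s (astar A x \<otimes> x)))\<^sup>2" using nn[OF x] by (rule power_mono)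
      then show "(?s x)\<^sup>2 \<le> ?s (astar A x \<otimes> x)"
        using nn[of "astar A x \<otimes> x"] x by (simp add: star_closed)
    qed
    fix y assume y: "y \<in> carrier A"
    show "?s (x \<oplus> y) \<le> ?s x + ?s y"
    proof (rule least)
      fix q assume q: "q \<in> N"
      show "q (x \<oplus> y) \<le> ?s x + ?s y"
        using seminormed_star_algebra.p_add[OF S[OF q] x y] up[OF q x] up[OF q y] by linarith
    qed
    show "?s (x \<otimes> y) \<le> ?s x * ?s y"
    proof (rule least)
      fix q assume q: "q \<in> N"
      have "q x * q y \<le> ?s x * ?s y"
        by (intro mult_mono up q x y nn seminormed_star_algebra.p_nonneg[OF S[OF q] y])
      then show "q (x \<otimes> y) \<le> ?s x * ?s y"
        using seminormed_star_algebra.p_mult[OF S[OF q] x y] by linarith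
    qed
  qed
qed

end

theory Submission
  imports Defs
begin

text \<open>A word in the generators \<open>v\<^sub>s\<close>, \<open>e\<^sub>X\<close> and their adjoints acts on \<open>S\<close> as a partial bijection.
  This gives a star-homomorphism \<open>Phi\<close> from the free star-algebra to \<open>\<ell>\<^sup>1(I\<^sub>l(S))\<close> with dense range.
  The crucial point is that \<open>p x \<le> \<parallel>Phi x\<parallel>\<^sub>1\<close> for every \<open>C\<^sup>*\<close>-seminorm \<open>p\<close> respecting Li's relations.
  Indeed, let two words of the form \<open>t\<^sub>1\<^sup>-\<^sup>1s\<^sub>1 \<dots> t\<^sub>n\<^sup>-\<^sup>1s\<^sub>n\<close> have the same nonempty partial bijection \<open>f\<close>. As \<open>f\<close> acts by
  multiplication with the value of the word in \<open>G\<close>, the values agree, so the last relation shows that the images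
  \<open>a\<close>, \<open>b\<close> of the words in the completion satisfy \<open>a a\<^sup>* = a b\<^sup>* = b a\<^sup>* = b b\<^sup>* = e\<^sub>Y\<close>, where \<open>Y\<close> is the range of \<open>f\<close>.
  Hence \<open>(a - b)(a - b)\<^sup>* = 0\<close> and \<open>a = b\<close>; similarly \<open>a = 0\<close> if \<open>f\<close> is empty.

  Let \<open>z\<close> be the central projection of \<open>\<ell>\<^sup>1(I\<^sub>l(S))\<close> given by the empty map (or \<open>0\<close> if it is absent), and \<open>q\<close>
  the full \<open>C\<^sup>*\<close>-seminorm. By the estimate, the universal seminorm \<open>p\<close> extends along \<open>Phi\<close> to a seminorm
  on \<open>\<ell>\<^sup>1(I\<^sub>l(S))\<close> that vanishes at \<open>z\<close>, so \<open>p x \<le> q ((1 - z) Phi x)\<close>; the converse holds because the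
  right-hand side respects the relations. Thus \<open>Phi\<close>, cut down by \<open>1 - z\<close>, is isometric, and its extension to the
  completions is the isomorphism with the quotient by \<open>\<complex>z\<close>.\<close>

section \<open>Push-forward of summable functions\<close>

text \<open>Convolution, involution and the map \<open>Phi\<close> below are all push-forwards along
  some map, so identities between them reduce to identities between the maps and to
  functoriality.\<close>

definition push :: "('a \<Rightarrow> 'b) \<Rightarrow> 'a set \<Rightarrow> ('a \<Rightarrow> complex) \<Rightarrow> 'b \<Rightarrow> complex" where
  "push m A f = (\<lambda>b. \<Sum>\<^sub>\<infinity>a\<in>{a \<in> A. m a = b}. f a)"

definition tensor :: "('a \<Rightarrow> complex) \<Rightarrow> ('b \<Rightarrow> complex) \<Rightarrow> 'a \<times> 'b \<Rightarrow> complex" where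
  "tensor f g = (\<lambda>(a, b). f a * g b)"

lemma push_cong:
  assumes "A = A'" "\<And>a. a \<in> A' \<Longrightarrow> m a = m' a" "\<And>a. a \<in> A' \<Longrightarrow> f a = f' a"
  shows "push m A f = push m' A' f'"
proof -
  have "{a \<in> A. m a = b} = {a \<in> A'. m' a = b}" for b using assms by auto
  then show ?thesis using assms by (auto simp: push_def intro!: infsum_cong)
qed

lemma abs_summable_fibre:
  "f abs_summable_on A \<Longrightarrow> f abs_summable_on {a \<in> A. R a}"
  by (rule summable_on_subset_banach) auto

lemma bij_betw_fibres:
  "bij_betw (\<lambda>a. (m a, a)) {a \<in> A. m a \<in> B} (Sigma B (\<lambda>b. {a \<in> A. m a = b}))"
  by (rule bij_betw_byWitness[where f' = snd]) auto

lemma abs_summable_fibres: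
  assumes "f abs_summable_on A"
  shows "(\<lambda>(b, a). f a) abs_summable_on (Sigma B (\<lambda>b. {a \<in> A. m a = b}))"
  using abs_summable_fibre[OF assms, of "\<lambda>a. m a \<in> B"]
    summable_on_reindex_bij_betw[OF bij_betw_fibres, of "\<lambda>(b, a). norm (f a)" m A B]
  by (simp add: case_prod_unfold)

text \<open>The bijection of \<open>bij_betw_fibres\<close> turns the iterated sum into a sum over
  the disjoint union of the fibres; absolute summability permits Fubini there.\<close>

lemma infsum_fibres:
  assumes "f abs_summable_on A"
  shows "(\<Sum>\<^sub>\<infinity>b\<in>B. \<Sum>\<^sub>\<infinity>a\<in>{a \<in> A. m a = b}. (f a :: 'c :: banach)) = (\<Sum>\<^sub>\<infinity>a\<in>{a \<in> A. m a \<in> B}. f a)"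
  using infsum_Sigma'_banach[of "\<lambda>b. f", OF abs_summable_summable] abs_summable_fibres[OF assms, of B m]
    infsum_reindex_bij_betw[OF bij_betw_fibres, of "\<lambda>(b, a). f a" m A B]
  by (simp add: case_prod_unfold)

text \<open>Functoriality. Points of \<open>A\<close> whose image misses \<open>B\<close> are lost
  in the second push; for \<open>Phi\<close> these are the words whose map is not in the
  hull.\<close>

lemma push_push:
  assumes "f abs_summable_on A"
  shows "push n B (push m A f) = push (\<lambda>a. n (m a)) {a \<in> A. m a \<in> B} f"
proof
  fix r
  show "push n B (push m A f) r = push (\<lambda>a. n (m a)) {a \<in> A. m a \<in> B} f r"
    using infsum_fibres[OF assms, of m "{b \<in> B. n b = r}"]
    by (simp add: push_def conj_ac)
qed

text \<open>The triangle inequality on every fibre, followed by summation over the disjoint fibres: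
  push-forward contracts the \<ell>1 norm.\<close>

lemma push_abs_summable:
  assumes "f abs_summable_on A"
  shows "push m A f abs_summable_on B"
    and "(\<Sum>\<^sub>\<infinity>b\<in>B. cmod (push m A f b)) \<le> (\<Sum>\<^sub>\<infinity>a\<in>A. cmod (f a))"
proof -
  let ?g = "\<lambda>b. \<Sum>\<^sub>\<infinity>a\<in>{a \<in> A. m a = b}. cmod (f a)"
  have g: "?g summable_on B"
    using summable_on_Sigma_banach[of "\<lambda>b a. cmod (f a)", OF _] abs_summable_fibres[OF assms, of B m]
    by (simp add: case_prod_unfold)
  have le: "cmod (push m A f b) \<le> ?g b" for b
    unfolding push_def by (rule norm_infsum_bound[OF abs_summable_fibre[OF assms]])
  show s: "push m A f abs_summable_on B"
    by (rule abs_summable_on_comparison_test'[OF g le])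
  have "(\<Sum>\<^sub>\<infinity>b\<in>B. cmod (push m A f b)) \<le> infsum ?g B"
    by (rule infsum_mono[OF s g le])
  also have "\<dots> = (\<Sum>\<^sub>\<infinity>a\<in>{a \<in> A. m a \<in> B}. cmod (f a))"
    using infsum_fibres[of "\<lambda>a. cmod (f a)" A m B] assms by simp
  also have "\<dots> \<le> (\<Sum>\<^sub>\<infinity>a\<in>A. cmod (f a))"
    using assms abs_summable_fibre[OF assms, of "\<lambda>a. m a \<in> B"] by (intro infsum_mono_neutral) auto
  finally show "(\<Sum>\<^sub>\<infinity>b\<in>B. cmod (push m A f b)) \<le> (\<Sum>\<^sub>\<infinity>a\<in>A. cmod (f a))" .
qed

lemma push_add:
  assumes "f abs_summable_on A" "g abs_summable_on A"
  shows "push m A (\<lambda>a. f a + g a) = (\<lambda>b. push m A f b + push m A g b)"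
  unfolding push_def
  by (intro ext infsum_add) (simp_all add: abs_summable_summable abs_summable_fibre assms)

lemma push_cmult: "push m A (\<lambda>a. c * f a) = (\<lambda>b. c * push m A f b)"
  by (simp add: push_def infsum_cmult_right')

lemma push_delta: "a \<in> A \<Longrightarrow> push m A (delta a) = delta (m a)"
proof
  fix b assume a: "a \<in> A"
  show "push m A (delta a) b = delta (m a) b"
  proof (cases "m a = b")
    case True
    then have "push m A (delta a) b = (\<Sum>\<^sub>\<infinity>a\<in>{a}. delta a a)"
      unfolding push_def using a by (intro infsum_cong_neutral) (auto simp: delta_def)
    then show ?thesis using True by (simp add: delta_def)
  next
    case False
    then have "push m A (delta a) b = 0"
      unfolding push_def by (intro infsum_0) (auto simp: delta_def)
    then show ?thesis using False by (simp add: delta_def)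
  qed
qed

lemma delta_finite: "{y. delta x y \<noteq> 0} = {x}"
  by (auto simp: delta_def)

lemma abs_summable_finite: "finite {x. f x \<noteq> 0} \<Longrightarrow> f abs_summable_on A"
  by (rule summable_on_cong_neutral[THEN iffD1, OF _ _ _ summable_on_finite[of "{x \<in> A. f x \<noteq> 0}"]]) auto

lemma tensor_abs_summable:
  assumes "f abs_summable_on A" "g abs_summable_on B"
  shows "tensor f g abs_summable_on (A \<times> B)"
    and "(\<Sum>\<^sub>\<infinity>x\<in>A \<times> B. cmod (tensor f g x)) = (\<Sum>\<^sub>\<infinity>a\<in>A. cmod (f a)) * (\<Sum>\<^sub>\<infinity>b\<in>B. cmod (g b))"
proof -
  show s: "tensor f g abs_summable_on (A \<times> B)"
    unfolding abs_summable_on_Sigma_iff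
    using assms by (auto simp: tensor_def norm_mult infsum_cmult_right' abs_mult infsum_nonneg
        intro!: summable_on_cmult_right summable_on_cmult_left)
  have "(\<Sum>\<^sub>\<infinity>x\<in>A \<times> B. cmod (tensor f g x)) = (\<Sum>\<^sub>\<infinity>a\<in>A. \<Sum>\<^sub>\<infinity>b\<in>B. cmod (tensor f g (a, b)))"
    by (rule infsum_Sigma_banach[OF s, symmetric])
  then show "(\<Sum>\<^sub>\<infinity>x\<in>A \<times> B. cmod (tensor f g x)) = (\<Sum>\<^sub>\<infinity>a\<in>A. cmod (f a)) * (\<Sum>\<^sub>\<infinity>b\<in>B. cmod (g b))"
    by (simp add: tensor_def norm_mult infsum_cmult_right' infsum_cmult_left')
qed

text \<open>A fibre of the product map is a product of fibres, and absolute summability turns the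
  product of the two sums into one sum over it.\<close>

lemma tensor_push: 
  "tensor (push m A f) (push n B g) x = push (\<lambda>(a, b). (m a, n b)) (A \<times> B) (tensor f g) x"
  if "f abs_summable_on A" "g abs_summable_on B"
proof -
  obtain b c where x: "x = (b, c)" by force
  have "(\<Sum>\<^sub>\<infinity>a\<in>{a \<in> A. m a = b}. f a) * (\<Sum>\<^sub>\<infinity>a\<in>{a \<in> B. n a = c}. g a)
      = (\<Sum>\<^sub>\<infinity>a\<in>{a \<in> A. m a = b}. \<Sum>\<^sub>\<infinity>a'\<in>{a \<in> B. n a = c}. tensor f g (a, a'))"
    by (simp add: tensor_def infsum_cmult_right' infsum_cmult_left')
  also have "\<dots> = (\<Sum>\<^sub>\<infinity>y\<in>{a \<in> A. m a = b} \<times> {a \<in> B. n a = c}. tensor f g y)"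
    by (rule infsum_Sigma_banach[OF abs_summable_summable[OF tensor_abs_summable(1)]])
      (intro that abs_summable_fibre)+
  also have "{a \<in> A. m a = b} \<times> {a \<in> B. n a = c} = {y \<in> A \<times> B. (case y of (a, d) \<Rightarrow> (m a, n d)) = (b, c)}"
    by auto
  finally show ?thesis by (simp add: x push_def tensor_def)
qed

lemma push_id: "{x. f x \<noteq> 0} \<subseteq> A \<Longrightarrow> push (\<lambda>x. x) A f = f"
proof
  fix b assume *: "{x. f x \<noteq> 0} \<subseteq> A"
  have "push (\<lambda>x. x) A f b = (\<Sum>\<^sub>\<infinity>x\<in>{b}. f x)"
    unfolding push_def using * by (intro infsum_cong_neutral) auto
  then show "push (\<lambda>x. x) A f b = f b" by simp
qed

lemma push_reindex:
  assumes "bij_betw k A' A"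
  shows "push m A f = push (\<lambda>a. m (k a)) A' (\<lambda>a. f (k a))"
proof
  fix b
  have "bij_betw k {a \<in> A'. m (k a) = b} {a \<in> A. m a = b}"
    using assms by (fastforce simp: bij_betw_def inj_on_def image_def)
  from infsum_reindex_bij_betw[OF this, of f]
  show "push m A f b = push (\<lambda>a. m (k a)) A' (\<lambda>a. f (k a)) b" by (simp add: push_def)
qed

lemma push_supp: "{b. push m A f b \<noteq> 0} \<subseteq> m ` {a \<in> A. f a \<noteq> 0}"
proof (rule subsetI, rule ccontr)
  fix b assume b: "b \<in> {b. push m A f b \<noteq> 0}" "b \<notin> m ` {a \<in> A. f a \<noteq> 0}"
  then have "push m A f b = 0" unfolding push_def by (intro infsum_0) auto
  then show False using b by simp
qed

lemma push_finite: "finite {a. f a \<noteq> 0} \<Longrightarrow> finite {b. push m A f b \<noteq> 0}"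
  by (rule finite_subset[OF push_supp]) (simp add: rev_finite_subset)

lemma cnj_push: "cnj (push m A f b) = push m A (\<lambda>a. cnj (f a)) b"
  by (simp add: push_def)

lemma supp_add: "\<lbrakk>{x. f x \<noteq> 0} \<subseteq> A; {x. g x \<noteq> 0} \<subseteq> A\<rbrakk> \<Longrightarrow> {x. f x + g x \<noteq> (0 :: complex)} \<subseteq> A"
  by (auto simp: subset_iff) (metis add.left_neutral)

lemma tensor_finite:
  assumes "finite {a. f a \<noteq> 0}" "finite {b. g b \<noteq> 0}" shows "finite {x. tensor f g x \<noteq> 0}"
  by (rule finite_subset[OF _ finite_cartesian_product[OF assms]]) (auto simp: tensor_def)

text \<open>The product in the form used from here on: the push-forward of a tensor along
  multiplication.\<close>

lemma conv_algebra_simps: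
  "carrier (conv_algebra P F) = F"
  "f \<otimes>\<^bsub>conv_algebra P F\<^esub> g = push (\<lambda>(s, t). s \<otimes>\<^bsub>P\<^esub> t) (carrier P \<times> carrier P) (tensor f g)"
  "\<one>\<^bsub>conv_algebra P F\<^esub> = delta \<one>\<^bsub>P\<^esub>"
  "\<zero>\<^bsub>conv_algebra P F\<^esub> = (\<lambda>r. 0)"
  "f \<oplus>\<^bsub>conv_algebra P F\<^esub> g = (\<lambda>r. f r + g r)"
  "c \<odot>\<^bsub>conv_algebra P F\<^esub> f = (\<lambda>r. c * f r)"
  "astar (conv_algebra P F) f = (\<lambda>r. if r \<in> carrier P then cnj (f (mstar P r)) else 0)"
  by (simp_all add: conv_algebra_def push_def tensor_def case_prod_unfold mem_Times_iff conj_assoc)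

section \<open>Convolution algebras of involutive monoids\<close>

locale involutive_monoid = monoid P for P :: "('a, 'b) star_monoid_scheme" (structure) +
  assumes mstar_closed: "x \<in> carrier P \<Longrightarrow> mstar P x \<in> carrier P"
    and mstar_mult: "\<lbrakk>x \<in> carrier P; y \<in> carrier P\<rbrakk> \<Longrightarrow> mstar P (x \<otimes> y) = mstar P y \<otimes> mstar P x"
    and mstar_mstar: "x \<in> carrier P \<Longrightarrow> mstar P (mstar P x) = x"
begin

abbreviation (input) "PP \<equiv> carrier P \<times> carrier P"
abbreviation (input) "conv f g \<equiv> push (\<lambda>(s, t). s \<otimes> t) PP (tensor f g)"
abbreviation (input) "star f \<equiv> \<lambda>r. if r \<in> carrier P then cnj (f (mstar P r)) else 0"

definition ell1 :: "('a \<Rightarrow> complex) set" where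
  "ell1 = {f. f abs_summable_on carrier P \<and> {x. f x \<noteq> 0} \<subseteq> carrier P}"

lemma ell1D: "f \<in> ell1 \<Longrightarrow> f abs_summable_on carrier P" "f \<in> ell1 \<Longrightarrow> {x. f x \<noteq> 0} \<subseteq> carrier P"
  by (auto simp: ell1_def)

lemma ell1_finite: "\<lbrakk>finite {x. f x \<noteq> 0}; {x. f x \<noteq> 0} \<subseteq> carrier P\<rbrakk> \<Longrightarrow> f \<in> ell1"
  by (simp add: ell1_def abs_summable_finite)

lemma ell1_delta: "x \<in> carrier P \<Longrightarrow> delta x \<in> ell1"
  by (rule ell1_finite) (auto simp: delta_finite)

lemma ell1_add:
  assumes "f \<in> ell1" "g \<in> ell1" shows "(\<lambda>r. f r + g r) \<in> ell1"
proof -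
  have "(\<lambda>r. cmod (f r) + cmod (g r)) summable_on carrier P"
    using assms by (intro summable_on_add) (auto simp: ell1D)
  then have "(\<lambda>r. f r + g r) abs_summable_on carrier P"
    by (rule abs_summable_on_comparison_test') (rule norm_triangle_ineq)
  then show ?thesis using supp_add[OF ell1D(2)[OF assms(1)] ell1D(2)[OF assms(2)]] by (simp add: ell1_def)
qed

lemma ell1_smult: "f \<in> ell1 \<Longrightarrow> (\<lambda>r. c * f r) \<in> ell1"
  by (auto simp: ell1_def norm_mult intro!: summable_on_cmult_right)

lemma supp_conv: "{x. conv f g x \<noteq> 0} \<subseteq> carrier P"
  by (rule order_trans[OF push_supp]) auto

lemma ell1_conv: "\<lbrakk>f \<in> ell1; g \<in> ell1\<rbrakk> \<Longrightarrow> conv f g \<in> ell1"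
  using supp_conv[of f g] by (auto simp: ell1_def intro!: push_abs_summable(1) tensor_abs_summable(1))

text \<open>As \<open>mstar P\<close> is its own inverse on the carrier, its fibre over
  \<open>r\<close> is the single point \<open>mstar P r\<close>.\<close>

lemma star_eq_push: "star f = push (mstar P) (carrier P) (\<lambda>r. cnj (f r))"
proof
  fix r
  have "{a \<in> carrier P. mstar P a = r} = (if r \<in> carrier P then {mstar P r} else {})"
    using mstar_closed mstar_mstar by auto
  then show "star f r = push (mstar P) (carrier P) (\<lambda>r. cnj (f r)) r" by (simp add: push_def)
qed

lemma ell1_star: "f \<in> ell1 \<Longrightarrow> star f \<in> ell1"
proof -
  assume "f \<in> ell1"
  then have "push (mstar P) (carrier P) (\<lambda>r. cnj (f r)) abs_summable_on carrier P"
    by (intro push_abs_summable(1)) (simp add: ell1D)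
  then show ?thesis unfolding star_eq_push[of f, symmetric] by (auto simp: ell1_def)
qed

text \<open>Functoriality once more: pushing along \<open>m\<close> and \<open>n\<close> and then
  multiplying is one push along the pointwise product. Associativity, units and involution follow by
  choosing \<open>m\<close> and \<open>n\<close>.\<close>

lemma conv_push:
  assumes "f abs_summable_on A" "g abs_summable_on B" "m ` A \<subseteq> carrier P" "n ` B \<subseteq> carrier P"
  shows "conv (push m A f) (push n B g) = push (\<lambda>(a, b). m a \<otimes> n b) (A \<times> B) (tensor f g)"
proof -
  have "tensor (push m A f) (push n B g) = push (\<lambda>(a, b). (m a, n b)) (A \<times> B) (tensor f g)"
    by (rule ext) (rule tensor_push[OF assms(1,2)])
  then show ?thesis
    using assms(3,4) push_push[OF tensor_abs_summable(1)[OF assms(1,2)],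
        of "\<lambda>(s, t). s \<otimes> t" PP "\<lambda>(a, b). (m a, n b)"]
    by (auto intro!: push_cong)
qed

lemma conv_assoc:
  assumes "f \<in> ell1" "g \<in> ell1" "h \<in> ell1"
  shows "conv (conv f g) h = conv f (conv g h)"
proof -
  let ?c = "carrier P"
  have fg: "tensor f g abs_summable_on PP" "tensor g h abs_summable_on PP"
    using assms by (auto intro!: tensor_abs_summable(1) simp: ell1D)
  \<comment> \<open>Writing \<open>h\<close> as a push along the identity brings the product into
    the form of \<open>conv_push\<close>. Both bracketings then become the push of one triple tensor
    along the triple product.\<close>
  have "conv (conv f g) h = conv (conv f g) (push (\<lambda>x. x) ?c h)"
    using assms by (simp add: push_id ell1D)
  also have "\<dots> = push (\<lambda>(a, b). (case a of (s, t) \<Rightarrow> s \<otimes> t) \<otimes> b) (PP \<times> ?c) (tensor (tensor f g) h)"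
    by (rule conv_push) (use assms fg in \<open>auto simp: ell1D\<close>)
  also have "\<dots> = push (\<lambda>(a, b). a \<otimes> (case b of (s, t) \<Rightarrow> s \<otimes> t)) (?c \<times> PP) (tensor f (tensor g h))"
    by (subst push_reindex[of "\<lambda>(a, b, c). ((a, b), c)" "?c \<times> PP"])
      (auto intro!: push_cong bij_betw_byWitness[where f' = "\<lambda>((a, b), c). (a, b, c)"] simp: tensor_def m_assoc)
  also have "\<dots> = conv (push (\<lambda>x. x) ?c f) (conv g h)"
    by (rule conv_push[symmetric]) (use assms fg in \<open>auto simp: ell1D\<close>)
  finally show ?thesis using assms by (simp add: push_id ell1D)
qed

lemma conv_delta:
  assumes "s \<in> carrier P" "f \<in> ell1"
  shows "conv (delta s) f = push (\<lambda>t. s \<otimes> t) (carrier P) f"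
    and "conv f (delta s) = push (\<lambda>t. t \<otimes> s) (carrier P) f"
proof -
  \<comment> \<open>A point mass is pushed forward from a one-point set, so \<open>conv_push\<close>
    also covers translations.\<close>
  have d: "delta s = push (\<lambda>_. s) {()} (\<lambda>_. 1)"
    by (rule ext) (auto simp: push_def delta_def)
  have f: "f = push (\<lambda>x. x) (carrier P) f" using assms by (simp add: push_id ell1D)
  have "conv (delta s) f = conv (push (\<lambda>_. s) {()} (\<lambda>_. 1)) (push (\<lambda>x. x) (carrier P) f)"
    using d f by simp
  also have "\<dots> = push (\<lambda>(a, b). s \<otimes> b) ({()} \<times> carrier P) (tensor (\<lambda>_. 1) f)"
    by (rule conv_push) (use assms in \<open>auto simp: ell1D\<close>)
  also have "\<dots> = push (\<lambda>t. s \<otimes> t) (carrier P) f"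
    by (subst push_reindex[of "\<lambda>b. ((), b)" "carrier P"])
      (auto intro!: push_cong bij_betw_byWitness[where f' = snd] simp: tensor_def)
  finally show "conv (delta s) f = push (\<lambda>t. s \<otimes> t) (carrier P) f" .
  have "conv f (delta s) = conv (push (\<lambda>x. x) (carrier P) f) (push (\<lambda>_. s) {()} (\<lambda>_. 1))"
    using d f by simp
  also have "\<dots> = push (\<lambda>(a, b). a \<otimes> s) (carrier P \<times> {()}) (tensor f (\<lambda>_. 1))"
    by (rule conv_push) (use assms in \<open>auto simp: ell1D\<close>)
  also have "\<dots> = push (\<lambda>t. t \<otimes> s) (carrier P) f"
    by (subst push_reindex[of "\<lambda>b. (b, ())" "carrier P"])
      (auto intro!: push_cong bij_betw_byWitness[where f' = fst] simp: tensor_def)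
  finally show "conv f (delta s) = push (\<lambda>t. t \<otimes> s) (carrier P) f" .
qed

lemma conv_one:
  assumes "f \<in> ell1" shows "conv (delta \<one>) f = f" "conv f (delta \<one>) = f"
proof -
  have "push (\<lambda>t. \<one> \<otimes> t) (carrier P) f = push (\<lambda>t. t) (carrier P) f"
    "push (\<lambda>t. t \<otimes> \<one>) (carrier P) f = push (\<lambda>t. t) (carrier P) f" by (auto intro: push_cong)
  then show "conv (delta \<one>) f = f" "conv f (delta \<one>) = f"
    using assms by (auto simp: conv_delta push_id ell1D)
qed

lemma conv_add:
  assumes "f \<in> ell1" "g \<in> ell1" "h \<in> ell1"
  shows "conv (\<lambda>r. f r + g r) h = (\<lambda>r. conv f h r + conv g h r)"
    and "conv h (\<lambda>r. f r + g r) = (\<lambda>r. conv h f r + conv h g r)"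
proof -
  have *: "tensor (\<lambda>r. f r + g r) h = (\<lambda>x. tensor f h x + tensor g h x)"
    "tensor h (\<lambda>r. f r + g r) = (\<lambda>x. tensor h f x + tensor h g x)"
    by (auto simp: tensor_def algebra_simps)
  show "conv (\<lambda>r. f r + g r) h = (\<lambda>r. conv f h r + conv g h r)"
    "conv h (\<lambda>r. f r + g r) = (\<lambda>r. conv h f r + conv h g r)"
    unfolding * using assms by (auto intro!: push_add tensor_abs_summable(1) simp: ell1D)
qed

lemma conv_smult:
  "conv (\<lambda>r. c * f r) g = (\<lambda>r. c * conv f g r)" "conv f (\<lambda>r. c * g r) = (\<lambda>r. c * conv f g r)"
proof -
  have "tensor (\<lambda>r. c * f r) g = (\<lambda>x. c * tensor f g x)" "tensor f (\<lambda>r. c * g r) = (\<lambda>x. c * tensor f g x)"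
    by (auto simp: tensor_def)
  then show "conv (\<lambda>r. c * f r) g = (\<lambda>r. c * conv f g r)" "conv f (\<lambda>r. c * g r) = (\<lambda>r. c * conv f g r)"
    by (simp_all add: push_cmult)
qed

text \<open>Conjugation commutes with push-forward; swapping the two coordinates then matches the
  order reversal in \<open>mstar_mult\<close>.\<close>

lemma star_conv:
  assumes "f \<in> ell1" "g \<in> ell1"
  shows "star (conv f g) = conv (star g) (star f)"
proof -
  let ?m = "\<lambda>(s, t). s \<otimes> t"
  have t: "tensor (\<lambda>r. cnj (f r)) (\<lambda>r. cnj (g r)) abs_summable_on PP"
    using assms by (auto intro!: tensor_abs_summable(1) simp: ell1D)
  have "star (conv f g) = push (mstar P) (carrier P) (push ?m PP (\<lambda>x. cnj (tensor f g x)))"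
    using star_eq_push[of "conv f g"] by (simp add: cnj_push)
  also have "(\<lambda>x. cnj (tensor f g x)) = tensor (\<lambda>r. cnj (f r)) (\<lambda>r. cnj (g r))"
    by (auto simp: tensor_def)
  also have "push (mstar P) (carrier P) (push ?m PP \<dots>)
     = push (\<lambda>x. mstar P (?m x)) PP (tensor (\<lambda>r. cnj (f r)) (\<lambda>r. cnj (g r)))"
    unfolding push_push[OF t] by (rule push_cong) auto
  also have "\<dots> = push (\<lambda>(a, b). mstar P a \<otimes> mstar P b) PP (tensor (\<lambda>r. cnj (g r)) (\<lambda>r. cnj (f r)))"
    by (subst push_reindex[of prod.swap PP])
      (auto intro!: push_cong bij_betw_byWitness[where f' = prod.swap] simp: tensor_def mstar_mult)
  also have "\<dots> = conv (push (mstar P) (carrier P) (\<lambda>r. cnj (g r))) (push (mstar P) (carrier P) (\<lambda>r. cnj (f r)))"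
    by (rule conv_push[symmetric]) (use assms in \<open>auto simp: ell1D mstar_closed\<close>)
  finally show ?thesis unfolding star_eq_push .
qed

text \<open>All identities are inherited from \<open>ell1\<close>, and only closure of
  \<open>F\<close> has to be supplied. This treats the \<ell>1 algebra and the finitely supported
  functions at once.\<close>

lemma conv_algebra_star_algebra:
  assumes F: "F \<subseteq> ell1" and one: "delta \<one> \<in> F" 
    and add: "\<And>f g. \<lbrakk>f \<in> F; g \<in> F\<rbrakk> \<Longrightarrow> (\<lambda>r. f r + g r) \<in> F"
    and smult: "\<And>f c. f \<in> F \<Longrightarrow> (\<lambda>r. c * f r) \<in> F"
    and mult: "\<And>f g. \<lbrakk>f \<in> F; g \<in> F\<rbrakk> \<Longrightarrow> conv f g \<in> F"
    and star: "\<And>f. f \<in> F \<Longrightarrow> star f \<in> F"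
  shows "complex_star_algebra (conv_algebra P F)"
proof -
  let ?A = "conv_algebra P F"
  note simps = conv_algebra_simps
  have sub: "f \<in> F \<Longrightarrow> f \<in> ell1" for f using F by auto
  have zero: "(\<lambda>r. 0) \<in> F" using smult[OF one, of 0] by simp
  have "ring ?A"
  proof (intro ringI abelian_groupI monoidI)
    fix f assume "f \<in> carrier ?A"
    then show "\<exists>g\<in>carrier ?A. g \<oplus>\<^bsub>?A\<^esub> f = \<zero>\<^bsub>?A\<^esub>"
      using smult[of f "-1"] by (intro bexI[of _ "\<lambda>r. -1 * f r"]) (auto simp: simps)
  next
    fix f g h assume "f \<in> carrier ?A" "g \<in> carrier ?A" "h \<in> carrier ?A"
    then have c: "f \<in> ell1" "g \<in> ell1" "h \<in> ell1" using sub by (auto simp: simps)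
    show "f \<otimes>\<^bsub>?A\<^esub> g \<otimes>\<^bsub>?A\<^esub> h = f \<otimes>\<^bsub>?A\<^esub> (g \<otimes>\<^bsub>?A\<^esub> h)"
      unfolding simps by (rule conv_assoc[OF c])
    show "(f \<oplus>\<^bsub>?A\<^esub> g) \<otimes>\<^bsub>?A\<^esub> h = f \<otimes>\<^bsub>?A\<^esub> h \<oplus>\<^bsub>?A\<^esub> g \<otimes>\<^bsub>?A\<^esub> h"
      unfolding simps by (rule conv_add(1)[OF c])
    show "h \<otimes>\<^bsub>?A\<^esub> (f \<oplus>\<^bsub>?A\<^esub> g) = h \<otimes>\<^bsub>?A\<^esub> f \<oplus>\<^bsub>?A\<^esub> h \<otimes>\<^bsub>?A\<^esub> g"
      unfolding simps by (rule conv_add(2)[OF c])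
  qed (auto simp: simps add mult one zero conv_one sub)
  then interpret A: ring ?A .
  show ?thesis
  proof
    fix f g c assume "f \<in> carrier ?A" "g \<in> carrier ?A"
    then have c: "f \<in> ell1" "g \<in> ell1" using sub by (auto simp: simps)
    show "(c \<odot>\<^bsub>?A\<^esub> f) \<otimes>\<^bsub>?A\<^esub> g = c \<odot>\<^bsub>?A\<^esub> (f \<otimes>\<^bsub>?A\<^esub> g)"
      "f \<otimes>\<^bsub>?A\<^esub> (c \<odot>\<^bsub>?A\<^esub> g) = c \<odot>\<^bsub>?A\<^esub> (f \<otimes>\<^bsub>?A\<^esub> g)"
      unfolding simps by (rule conv_smult)+
    show "astar ?A (f \<otimes>\<^bsub>?A\<^esub> g) = astar ?A g \<otimes>\<^bsub>?A\<^esub> astar ?A f"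
      unfolding simps by (rule star_conv[OF c])
  next
    fix f assume "f \<in> carrier ?A"
    then show "astar ?A (astar ?A f) = f"
      using sub[of f] ell1D(2)[of f] by (auto simp: simps mstar_closed mstar_mstar fun_eq_iff)
  qed (auto simp: simps algebra_simps smult star)
qed

lemma ell1_algebra_star_algebra: "complex_star_algebra (ell1_algebra P)"
  unfolding ell1_algebra_def ell1_def[symmetric]
  by (rule conv_algebra_star_algebra)
    (auto intro: ell1_delta ell1_add ell1_smult ell1_conv ell1_star)

lemma finite_algebra_star_algebra: "complex_star_algebra (finite_algebra P)"
  unfolding finite_algebra_def
proof (rule conv_algebra_star_algebra, goal_cases)
  case (3 f g)
  then show ?case
    using supp_add[of f "carrier P" g]
    by (auto intro: finite_subset[of _ "{x. f x \<noteq> 0} \<union> {x. g x \<noteq> 0}"])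
next
  case (4 f c)
  then show ?case by (auto intro: finite_subset[of _ "{x. f x \<noteq> 0}"])
next
  case (5 f g)
  then show ?case using supp_conv[of f g] by (simp add: push_finite tensor_finite)
next
  case (6 f)
  then have "finite {r. push (mstar P) (carrier P) (\<lambda>r. cnj (f r)) r \<noteq> 0}"
    by (intro push_finite) simp
  then show ?case unfolding star_eq_push[of f, symmetric] by auto
qed (auto simp: ell1_finite delta_finite)

lemma ell1_algebra_simps:
  "carrier (ell1_algebra P) = ell1"
  "mult (ell1_algebra P) f g = conv f g"
  "one (ell1_algebra P) = delta \<one>" "zero (ell1_algebra P) = (\<lambda>r. 0)"
  "add (ell1_algebra P) f g = (\<lambda>r. f r + g r)"
  "smult (ell1_algebra P) c f = (\<lambda>r. c * f r)"
  "astar (ell1_algebra P) f = star f"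
  unfolding ell1_algebra_def conv_algebra_simps by (simp_all add: ell1_def)

lemma finite_algebra_simps:
  "carrier (finite_algebra P) = {f. finite {x. f x \<noteq> 0} \<and> {x. f x \<noteq> 0} \<subseteq> carrier P}"
  "mult (finite_algebra P) f g = conv f g"
  "one (finite_algebra P) = delta \<one>" "zero (finite_algebra P) = (\<lambda>r. 0)"
  "add (finite_algebra P) f g = (\<lambda>r. f r + g r)"
  "smult (finite_algebra P) c f = (\<lambda>r. c * f r)"
  "astar (finite_algebra P) f = star f"
  unfolding finite_algebra_def conv_algebra_simps by simp_all

lemma ell1_minus: "\<lbrakk>f \<in> ell1; g \<in> ell1\<rbrakk> \<Longrightarrow> f \<ominus>\<^bsub>ell1_algebra P\<^esub> g = (\<lambda>r. f r - g r)"
proof -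
  interpret A: complex_star_algebra "ell1_algebra P" by (rule ell1_algebra_star_algebra)
  assume "f \<in> ell1" "g \<in> ell1"
  then show ?thesis using A.uminus_eq_smult[of g] by (simp add: a_minus_def ell1_algebra_simps)
qed

lemma finite_minus:
  assumes "g \<in> carrier (finite_algebra P)"
  shows "f \<ominus>\<^bsub>finite_algebra P\<^esub> g = (\<lambda>r. f r - g r)"
proof -
  interpret A: complex_star_algebra "finite_algebra P" by (rule finite_algebra_star_algebra)
  show ?thesis using A.uminus_eq_smult[OF assms] by (simp add: a_minus_def finite_algebra_simps)
qed

lemma delta_conv_delta: "\<lbrakk>s \<in> carrier P; t \<in> carrier P\<rbrakk> \<Longrightarrow> conv (delta s) (delta t) = delta (s \<otimes> t)"
  by (simp add: conv_delta ell1_delta push_delta)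

lemma star_delta: "s \<in> carrier P \<Longrightarrow> star (delta s) = delta (mstar P s)"
  using mstar_mstar mstar_closed by (auto simp: delta_def fun_eq_iff)

section \<open>The \<ell>1 norm\<close>

lemma ell1_norm_nonneg: "0 \<le> ell1_norm P f"
  by (simp add: ell1_norm_def infsum_nonneg)

lemma ell1_norm_add:
  assumes "f \<in> ell1" "g \<in> ell1"
  shows "ell1_norm P (\<lambda>r. f r + g r) \<le> ell1_norm P f + ell1_norm P g"
proof -
  have "ell1_norm P (\<lambda>r. f r + g r) \<le> (\<Sum>\<^sub>\<infinity>r\<in>carrier P. cmod (f r) + cmod (g r))"
    unfolding ell1_norm_def
    by (rule infsum_mono) (use ell1D(1)[OF ell1_add[OF assms]] assms in \<open>auto simp: ell1D norm_triangle_ineq intro!: summable_on_add\<close>)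
  also have "\<dots> = ell1_norm P f + ell1_norm P g"
    unfolding ell1_norm_def using assms by (intro infsum_add) (auto simp: ell1D)
  finally show ?thesis .
qed

lemma ell1_norm_smult: "ell1_norm P (\<lambda>r. c * f r) = cmod c * ell1_norm P f"
  by (simp add: ell1_norm_def norm_mult infsum_cmult_right')

text \<open>The norm of a tensor is the product of the norms, and push-forward is
  contractive.\<close>

lemma ell1_norm_conv:
  assumes "f \<in> ell1" "g \<in> ell1"
  shows "ell1_norm P (conv f g) \<le> ell1_norm P f * ell1_norm P g"
proof -
  have t: "tensor f g abs_summable_on PP" using assms by (auto intro!: tensor_abs_summable(1) simp: ell1D)
  show ?thesis
    using push_abs_summable(2)[OF t, of "\<lambda>(s, t). s \<otimes> t" "carrier P"]
      tensor_abs_summable(2)[of f "carrier P" g "carrier P"] assms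
    by (simp add: ell1_norm_def ell1D)
qed

lemma ell1_norm_star: "ell1_norm P (star f) = ell1_norm P f"
proof -
  have "bij_betw (mstar P) (carrier P) (carrier P)"
    using mstar_closed mstar_mstar by (intro bij_betw_byWitness[where f' = "mstar P"]) auto
  from infsum_reindex_bij_betw[OF this, of "\<lambda>x. cmod (f x)"]
  have "(\<Sum>\<^sub>\<infinity>x\<in>carrier P. cmod (f (mstar P x))) = ell1_norm P f" by (simp add: ell1_norm_def)
  moreover have "ell1_norm P (star f) = (\<Sum>\<^sub>\<infinity>x\<in>carrier P. cmod (f (mstar P x)))"
    unfolding ell1_norm_def by (intro infsum_cong) auto
  ultimately show ?thesis by simp
qed

lemma ell1_approx:
  assumes f: "f \<in> ell1" and e: "e > 0"
  shows "\<exists>g\<in>carrier (finite_algebra P). ell1_norm P (\<lambda>r. f r - g r) < e"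
proof -
  \<comment> \<open>A finite set carrying all of the norm of \<open>f\<close> except less than
    \<open>e\<close>; the approximant is the restriction of \<open>f\<close> to it.\<close>
  obtain T where T: "finite T" "T \<subseteq> carrier P"
    "dist (\<Sum>x\<in>T. cmod (f x)) (ell1_norm P f) < e"
    using infsum_finite_approximation[of "\<lambda>x. cmod (f x)" "carrier P" "e / 2"] f e
    by (auto simp: ell1D ell1_norm_def dist_commute)
  define g where "g x = (if x \<in> T then f x else 0)" for x
  have s: "(\<lambda>x. cmod (f x)) summable_on carrier P" using f by (rule ell1D)
  have "ell1_norm P (\<lambda>r. f r - g r) = (\<Sum>\<^sub>\<infinity>x\<in>carrier P - T. cmod (f x))"
    unfolding ell1_norm_def by (intro infsum_cong_neutral) (auto simp: g_def)
  also have "\<dots> = ell1_norm P f - (\<Sum>x\<in>T. cmod (f x))"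
    using infsum_Diff[OF s _ T(2)] T(1) by (simp add: ell1_norm_def)
  also have "\<dots> < e" using T(3) by (simp add: dist_real_def abs_if split: if_splits)
  finally show ?thesis
    using T by (intro bexI[of _ g]) (auto simp: finite_algebra_simps g_def intro: finite_subset[of _ T])
qed

end

section \<open>Extension of $C^*$-seminorms\<close>

lemma star_homD:
  assumes "h \<in> star_hom A B"
  shows "\<And>x. x \<in> carrier A \<Longrightarrow> h x \<in> carrier B"
    and "\<And>x y. \<lbrakk>x \<in> carrier A; y \<in> carrier A\<rbrakk> \<Longrightarrow> h (x \<oplus>\<^bsub>A\<^esub> y) = h x \<oplus>\<^bsub>B\<^esub> h y"
    and "\<And>x y. \<lbrakk>x \<in> carrier A; y \<in> carrier A\<rbrakk> \<Longrightarrow> h (x \<otimes>\<^bsub>A\<^esub> y) = h x \<otimes>\<^bsub>B\<^esub> h y"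
    and "h \<one>\<^bsub>A\<^esub> = \<one>\<^bsub>B\<^esub>"
    and "\<And>x c. x \<in> carrier A \<Longrightarrow> h (c \<odot>\<^bsub>A\<^esub> x) = c \<odot>\<^bsub>B\<^esub> h x"
    and "\<And>x. x \<in> carrier A \<Longrightarrow> h (astar A x) = astar B (h x)"
  using assms by (auto simp: star_hom_def ring_hom_def)

lemma star_hom_minus:
  assumes A: "complex_star_algebra A" and B: "complex_star_algebra B" and h: "h \<in> star_hom A B"
    and x: "x \<in> carrier A" and y: "y \<in> carrier A"
  shows "h (x \<ominus>\<^bsub>A\<^esub> y) = h x \<ominus>\<^bsub>B\<^esub> h y"
proof -
  interpret A: complex_star_algebra A by (rule A)
  interpret B: complex_star_algebra B by (rule B)
  show ?thesis
    using x y by (simp add: a_minus_def A.uminus_eq_smult B.uminus_eq_smult A.smult_closed star_homD[OF h])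
qed

text \<open>The model is the \<ell>1 convolution algebra, whose norm is submultiplicative with
  isometric involution but in general violates the C*-identity.\<close>

locale star_normed_algebra = complex_star_algebra A for A :: "('a, 'b) star_algebra_scheme" (structure) +
  fixes N :: "'a \<Rightarrow> real"
  assumes N_nonneg: "x \<in> carrier A \<Longrightarrow> 0 \<le> N x"
    and N_smult: "x \<in> carrier A \<Longrightarrow> N (c \<odot> x) = cmod c * N x"
    and N_add: "\<lbrakk>x \<in> carrier A; y \<in> carrier A\<rbrakk> \<Longrightarrow> N (x \<oplus> y) \<le> N x + N y"
    and N_mult: "\<lbrakk>x \<in> carrier A; y \<in> carrier A\<rbrakk> \<Longrightarrow> N (x \<otimes> y) \<le> N x * N y"
    and N_star: "x \<in> carrier A \<Longrightarrow> N (astar A x) = N x"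
begin

lemma N_zero: "N \<zero> = 0"
  using N_smult[of \<zero> 0] by (simp add: smult_0_left)

lemma N_uminus: "x \<in> carrier A \<Longrightarrow> N (\<ominus> x) = N x"
  by (simp add: uminus_eq_smult N_smult)

lemma N_minus_commute: "\<lbrakk>x \<in> carrier A; y \<in> carrier A\<rbrakk> \<Longrightarrow> N (x \<ominus> y) = N (y \<ominus> x)"
  using N_uminus[of "x \<ominus> y"] by (simp add: minus_eq minus_add a_comm)

lemma N_triangle:
  assumes "x \<in> carrier A" "y \<in> carrier A" "z \<in> carrier A"
  shows "N (x \<ominus> z) \<le> N (x \<ominus> y) + N (y \<ominus> z)"
proof -
  have "x \<ominus> z = (x \<ominus> y) \<oplus> (y \<ominus> z)" using assms by algebra
  then show ?thesis using N_add[of "x \<ominus> y" "y \<ominus> z"] assms by simp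
qed

text \<open>The bound \<open>le\<close> makes \<open>p\<close> factor through \<open>h\<close> and
  makes the induced function 1-Lipschitz for \<open>N\<close> on the dense image. A Lipschitz
  extension to \<open>A\<close> exists, and every C*-seminorm law passes to it by
  approximation.\<close>

theorem cstar_seminorm_extension:
  assumes F: "seminormed_star_algebra F p" and h: "h \<in> star_hom F A"
    and dense: "\<And>a e. \<lbrakk>a \<in> carrier A; 0 < e\<rbrakk> \<Longrightarrow> \<exists>x\<in>carrier F. N (a \<ominus> h x) < e"
    and le: "\<And>x. x \<in> carrier F \<Longrightarrow> p x \<le> N (h x)"
  shows "\<exists>p'. cstar_seminorm A p' \<and> (\<forall>a\<in>carrier A. p' a \<le> N a) \<and> (\<forall>x\<in>carrier F. p' (h x) = p x)"
proof -
  interpret F: seminormed_star_algebra F p by (rule F)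
  note hD = star_homD[OF h]
  have hm: "h (x \<ominus>\<^bsub>F\<^esub> y) = h x \<ominus> h y" if "x \<in> carrier F" "y \<in> carrier F" for x y
    by (rule star_hom_minus[OF F.complex_star_algebra_axioms complex_star_algebra_axioms h that])
  \<comment> \<open>McShane extension: the largest function that is 1-Lipschitz for \<open>N\<close> and extends \<open>p\<close>\<close>
  define p' where "p' a = (INF x\<in>carrier F. p x + N (a \<ominus> h x))" for a
  have bdd: "bdd_below ((\<lambda>x. p x + N (a \<ominus> h x)) ` carrier F)" if "a \<in> carrier A" for a
    using that by (intro bdd_belowI2[of _ 0]) (simp add: F.p_nonneg N_nonneg hD)
  \<comment> \<open>The upper bound takes \<open>x\<close> itself in the infimum; the lower bound is
    the Lipschitz estimate \<open>\<bar>p x - p y\<bar> \<le> N (h x \<ominus> h y)\<close> with the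
    triangle inequality through \<open>a\<close>.\<close>
  have key: "\<bar>p' a - p x\<bar> \<le> N (a \<ominus> h x)" if a: "a \<in> carrier A" and x: "x \<in> carrier F" for a x
  proof -
    have "p' a \<le> p x + N (a \<ominus> h x)" unfolding p'_def by (rule cINF_lower[OF bdd[OF a] x])
    moreover have "p x - N (a \<ominus> h x) \<le> p' a"
      unfolding p'_def
    proof (rule cINF_greatest)
      fix y assume y: "y \<in> carrier F"
      have "p x \<le> p y + p (x \<ominus>\<^bsub>F\<^esub> y)" using F.p_diff[OF x y] by linarith
      also have "p (x \<ominus>\<^bsub>F\<^esub> y) \<le> N (h x \<ominus> h y)" using le[of "x \<ominus>\<^bsub>F\<^esub> y"] x y by (simp add: hm)
      also have "\<dots> \<le> N (a \<ominus> h x) + N (a \<ominus> h y)"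
        using N_triangle[of "h x" a "h y"] N_minus_commute[of "h x" a] x y a by (simp add: hD)
      finally show "p x - N (a \<ominus> h x) \<le> p y + N (a \<ominus> h y)" by simp
    qed auto
    ultimately show ?thesis by linarith
  qed
  define app where "app a X \<longleftrightarrow> (\<forall>n. X n \<in> carrier F) \<and> (\<lambda>n. N (a \<ominus> h (X n))) \<longlonglongrightarrow> 0" for a X
  have appI: "app a X" if "a \<in> carrier A" "\<And>n. X n \<in> carrier F" "\<And>n. N (a \<ominus> h (X n)) \<le> r n" "r \<longlonglongrightarrow> 0" for a X r
    unfolding app_def
  proof (intro conjI allI)
    show "(\<lambda>n. N (a \<ominus> h (X n))) \<longlonglongrightarrow> 0"
      by (rule tendsto_sandwich[OF _ _ tendsto_const that(4)]) (simp_all add: that N_nonneg hD)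
  qed (rule that)
  \<comment> \<open>By \<open>key\<close>, \<open>p' a\<close> is the limit of \<open>p\<close>
    along any sequence whose images approximate \<open>a\<close>. The laws for \<open>p'\<close> are
    limits of those for \<open>p\<close>, since such sequences are compatible with all
    operations.\<close>
  have lim: "(\<lambda>n. p (X n)) \<longlonglongrightarrow> p' a" if a: "a \<in> carrier A" and X: "app a X" for a X
  proof -
    have "(\<lambda>n. p (X n) - p' a) \<longlonglongrightarrow> 0"
    proof (rule metric_tendsto_imp_tendsto)
      show "\<forall>\<^sub>F n in sequentially. dist (p (X n) - p' a) 0 \<le> dist (N (a \<ominus> h (X n))) 0"
      proof (rule always_eventually, rule allI)
        show "dist (p (X n) - p' a) 0 \<le> dist (N (a \<ominus> h (X n))) 0" for n
          using key[OF a, of "X n"] X by (simp add: app_def)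
      qed
    qed (use X in \<open>simp add: app_def\<close>)
    then show ?thesis by (simp add: LIM_zero_iff)
  qed
  have ex: "\<exists>X. app a X" if a: "a \<in> carrier A" for a
  proof -
    have "\<forall>n. \<exists>x\<in>carrier F. N (a \<ominus> h x) < inverse (real (Suc n))" using dense[OF a] by simp
    then obtain X where "\<And>n. X n \<in> carrier F" "\<And>n. N (a \<ominus> h (X n)) < inverse (real (Suc n))" by metis
    then have "app a X" by (intro appI[OF a _ _ LIMSEQ_inverse_real_of_nat]) (auto simp: less_imp_le)
    then show ?thesis by blast
  qed
  have app_add: "app (a \<oplus> b) (\<lambda>n. X n \<oplus>\<^bsub>F\<^esub> Y n)"
    and app_mult: "app (a \<otimes> b) (\<lambda>n. X n \<otimes>\<^bsub>F\<^esub> Y n)"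
    if a: "a \<in> carrier A" and b: "b \<in> carrier A" and X: "app a X" and Y: "app b Y" for a b X Y
  proof -
    have Xn: "X n \<in> carrier F" "h (X n) \<in> carrier A" and Yn: "Y n \<in> carrier F" "h (Y n) \<in> carrier A" for n
      using X Y by (auto simp: app_def hD)
    have lX: "(\<lambda>n. N (a \<ominus> h (X n))) \<longlonglongrightarrow> 0" and lY: "(\<lambda>n. N (b \<ominus> h (Y n))) \<longlonglongrightarrow> 0"
      using X Y by (auto simp: app_def)
    show "app (a \<oplus> b) (\<lambda>n. X n \<oplus>\<^bsub>F\<^esub> Y n)"
    proof (rule appI)
      show "(\<lambda>n. N (a \<ominus> h (X n)) + N (b \<ominus> h (Y n))) \<longlonglongrightarrow> 0" using tendsto_add[OF lX lY] by simp
      fix n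
      have "a \<oplus> b \<ominus> h (X n \<oplus>\<^bsub>F\<^esub> Y n) = (a \<ominus> h (X n)) \<oplus> (b \<ominus> h (Y n))"
        unfolding hD(2)[OF Xn(1) Yn(1)] using a b Xn(2)[of n] Yn(2)[of n] by algebra
      then show "N (a \<oplus> b \<ominus> h (X n \<oplus>\<^bsub>F\<^esub> Y n)) \<le> N (a \<ominus> h (X n)) + N (b \<ominus> h (Y n))"
        using N_add[of "a \<ominus> h (X n)" "b \<ominus> h (Y n)"] a b Xn Yn by simp
    qed (use a b Xn Yn in auto)
    show "app (a \<otimes> b) (\<lambda>n. X n \<otimes>\<^bsub>F\<^esub> Y n)"
    proof (rule appI)
      \<comment> \<open>The bound splits \<open>a b - h (X n) h (Y n)\<close> as
        \<open>a (b - h (Y n)) + (a - h (X n)) h (Y n)\<close> and estimates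
        \<open>N (h (Y n))\<close> by \<open>N b\<close> plus the error, which avoids a separate
        boundedness argument.\<close>
      show "(\<lambda>n. N a * N (b \<ominus> h (Y n)) + N (a \<ominus> h (X n)) * (N b + N (b \<ominus> h (Y n)))) \<longlonglongrightarrow> 0"
        using tendsto_add[OF tendsto_mult_left[OF lY, of "N a"] tendsto_mult[OF lX tendsto_add[OF tendsto_const[of "N b"] lY]]] by simp
      fix n
      have "a \<otimes> b \<ominus> h (X n \<otimes>\<^bsub>F\<^esub> Y n) = a \<otimes> (b \<ominus> h (Y n)) \<oplus> (a \<ominus> h (X n)) \<otimes> h (Y n)"
        unfolding hD(3)[OF Xn(1) Yn(1)] using a b Xn(2)[of n] Yn(2)[of n] by algebra
      moreover have "N (a \<otimes> (b \<ominus> h (Y n))) \<le> N a * N (b \<ominus> h (Y n))" using a b Yn by (intro N_mult) auto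
      moreover have "N ((a \<ominus> h (X n)) \<otimes> h (Y n)) \<le> N (a \<ominus> h (X n)) * N (h (Y n))" using a b Xn Yn by (intro N_mult) auto
      moreover have "N (h (Y n)) \<le> N b + N (b \<ominus> h (Y n))"
      proof -
        have "h (Y n) = b \<oplus> \<ominus> (b \<ominus> h (Y n))" using b Yn[of n] by algebra
        then have "N (h (Y n)) \<le> N b + N (\<ominus> (b \<ominus> h (Y n)))"
          using N_add[of b "\<ominus> (b \<ominus> h (Y n))"] b Yn by simp
        then show ?thesis using b Yn by (simp add: N_uminus)
      qed
      then have "N (a \<ominus> h (X n)) * N (h (Y n)) \<le> N (a \<ominus> h (X n)) * (N b + N (b \<ominus> h (Y n)))"
        using a Xn by (intro mult_left_mono N_nonneg) auto
      ultimately show "N (a \<otimes> b \<ominus> h (X n \<otimes>\<^bsub>F\<^esub> Y n)) \<le> N a * N (b \<ominus> h (Y n)) + N (a \<ominus> h (X n)) * (N b + N (b \<ominus> h (Y n)))"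
        using N_add[of "a \<otimes> (b \<ominus> h (Y n))" "(a \<ominus> h (X n)) \<otimes> h (Y n)"] a b Xn Yn by simp
    qed (use a b Xn Yn in auto)
  qed
  have app_smult: "app (c \<odot> a) (\<lambda>n. c \<odot>\<^bsub>F\<^esub> X n)" and app_star: "app (astar A a) (\<lambda>n. astar F (X n))"
    if a: "a \<in> carrier A" and X: "app a X" for a X c
  proof -
    have Xn: "X n \<in> carrier F" "h (X n) \<in> carrier A" for n using X by (auto simp: app_def hD)
    have lX: "(\<lambda>n. N (a \<ominus> h (X n))) \<longlonglongrightarrow> 0" using X by (auto simp: app_def)
    show "app (c \<odot> a) (\<lambda>n. c \<odot>\<^bsub>F\<^esub> X n)"
      by (rule appI[OF _ _ _ tendsto_mult_right_zero[OF lX, of "cmod c"]])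
        (use a Xn in \<open>auto simp: smult_closed F.smult_closed hD N_smult simp flip: smult_minus\<close>)
    show "app (astar A a) (\<lambda>n. astar F (X n))"
      by (rule appI[OF _ _ _ lX])
        (use a Xn in \<open>auto simp: star_closed F.star_closed hD N_star simp flip: star_minus\<close>)
  qed
  have "cstar_seminorm A p'"
    unfolding cstar_seminorm_def
  proof (intro conjI ballI allI)
    fix a assume a: "a \<in> carrier A"
    obtain X where X: "app a X" using ex[OF a] by blast
    have Xn: "X n \<in> carrier F" for n using X by (simp add: app_def)
    show "0 \<le> p' a"
      by (rule LIMSEQ_le_const[OF lim[OF a X]]) (auto intro: F.p_nonneg Xn)
    show "p' (c \<odot> a) = cmod c * p' a" for c
    proof (rule LIMSEQ_unique)
      show "(\<lambda>n. p (c \<odot>\<^bsub>F\<^esub> X n)) \<longlonglongrightarrow> p' (c \<odot> a)"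
        by (rule lim[OF smult_closed[OF a] app_smult[OF a X]])
      show "(\<lambda>n. p (c \<odot>\<^bsub>F\<^esub> X n)) \<longlonglongrightarrow> cmod c * p' a"
        using tendsto_mult_left[OF lim[OF a X], of "cmod c"] by (simp add: F.p_smult Xn)
    qed
    show "p' (astar A a \<otimes> a) = (p' a)\<^sup>2"
    proof (rule LIMSEQ_unique)
      show "(\<lambda>n. p (astar F (X n) \<otimes>\<^bsub>F\<^esub> X n)) \<longlonglongrightarrow> p' (astar A a \<otimes> a)"
        by (rule lim[OF _ app_mult[OF star_closed[OF a] a app_star[OF a X] X]]) (simp add: a star_closed)
      show "(\<lambda>n. p (astar F (X n) \<otimes>\<^bsub>F\<^esub> X n)) \<longlonglongrightarrow> (p' a)\<^sup>2"
        using tendsto_power[OF lim[OF a X], of 2] by (simp add: F.p_cstar Xn)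
    qed
    fix b assume b: "b \<in> carrier A"
    obtain Y where Y: "app b Y" using ex[OF b] by blast
    have Yn: "Y n \<in> carrier F" for n using Y by (simp add: app_def)
    show "p' (a \<oplus> b) \<le> p' a + p' b"
      by (rule LIMSEQ_le[OF lim[OF _ app_add[OF a b X Y]] tendsto_add[OF lim[OF a X] lim[OF b Y]]])
        (use a b in \<open>auto intro: F.p_add Xn Yn\<close>)
    show "p' (a \<otimes> b) \<le> p' a * p' b"
      by (rule LIMSEQ_le[OF lim[OF _ app_mult[OF a b X Y]] tendsto_mult[OF lim[OF a X] lim[OF b Y]]])
        (use a b in \<open>auto intro: F.p_mult Xn Yn\<close>)
  qed
  \<comment> \<open>This is \<open>key\<close> at \<open>x = 0\<close>, where both \<open>p\<close>
    and \<open>h\<close> vanish.\<close>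
  moreover have "p' a \<le> N a" if a: "a \<in> carrier A" for a
    using key[OF a F.zero_closed] hD(5)[of "\<zero>\<^bsub>F\<^esub>" 0] a
    by (simp add: F.p_zero F.smult_0_left smult_0_left hD minus_eq)
  moreover have "p' (h x) = p x" if x: "x \<in> carrier F" for x
    using key[of "h x" x] x by (simp add: hD minus_eq r_neg N_zero)
  ultimately show ?thesis by blast
qed

end

section \<open>Cutting by a central projection\<close>

text \<open>\<open>h\<close> followed by multiplication with \<open>1 - z\<close>. It sends the unit
  to \<open>1 - z\<close> when \<open>h\<close> is unital, so it is not a \<open>star_hom\<close>;
  its properties are therefore listed one by one.\<close>

definition cut_off :: "('a, 'b) star_algebra_scheme \<Rightarrow> 'a \<Rightarrow> ('f \<Rightarrow> 'a) \<Rightarrow> 'f \<Rightarrow> 'a" where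
  "cut_off A z h x = h x \<ominus>\<^bsub>A\<^esub> z \<otimes>\<^bsub>A\<^esub> h x"

text \<open>Multiplication by the complement of a central projection respects all operations except
  the unit, and its values are annihilated by \<open>z\<close>.\<close>

lemma central_cut:
  assumes F: "complex_star_algebra F" and A: "complex_star_algebra A" and h: "h \<in> star_hom F A"
    and z: "z \<in> carrier A" "z \<otimes>\<^bsub>A\<^esub> z = z" "astar A z = z"
    and central: "\<And>a. a \<in> carrier A \<Longrightarrow> a \<otimes>\<^bsub>A\<^esub> z = z \<otimes>\<^bsub>A\<^esub> a"
  shows "\<And>x. x \<in> carrier F \<Longrightarrow> cut_off A z h x \<in> carrier A"
    and "\<And>x y. \<lbrakk>x \<in> carrier F; y \<in> carrier F\<rbrakk> \<Longrightarrow> cut_off A z h (x \<oplus>\<^bsub>F\<^esub> y) = cut_off A z h x \<oplus>\<^bsub>A\<^esub> cut_off A z h y"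
    and "\<And>x c. x \<in> carrier F \<Longrightarrow> cut_off A z h (c \<odot>\<^bsub>F\<^esub> x) = c \<odot>\<^bsub>A\<^esub> cut_off A z h x"
    and "\<And>x. x \<in> carrier F \<Longrightarrow> cut_off A z h (astar F x) = astar A (cut_off A z h x)"
    and "\<And>x y. \<lbrakk>x \<in> carrier F; y \<in> carrier F\<rbrakk> \<Longrightarrow> cut_off A z h (x \<otimes>\<^bsub>F\<^esub> y) = cut_off A z h x \<otimes>\<^bsub>A\<^esub> cut_off A z h y"
    and "\<And>x y. \<lbrakk>x \<in> carrier F; y \<in> carrier F\<rbrakk> \<Longrightarrow> cut_off A z h (x \<ominus>\<^bsub>F\<^esub> y) = cut_off A z h x \<ominus>\<^bsub>A\<^esub> cut_off A z h y"
    and "\<And>x. x \<in> carrier F \<Longrightarrow> z \<otimes>\<^bsub>A\<^esub> cut_off A z h x = \<zero>\<^bsub>A\<^esub>"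
proof -
  interpret F: complex_star_algebra F by (rule F)
  interpret A: complex_star_algebra A by (rule A)
  note hD = star_homD[OF h]
  let ?\<psi> = "cut_off A z h"
  note \<psi>_def = cut_off_def[of A z h]
  show \<psi>c: "?\<psi> x \<in> carrier A" if "x \<in> carrier F" for x using that z by (simp add: \<psi>_def hD)
  show \<psi>_add: "?\<psi> (x \<oplus>\<^bsub>F\<^esub> y) = ?\<psi> x \<oplus>\<^bsub>A\<^esub> ?\<psi> y" if "x \<in> carrier F" "y \<in> carrier F" for x y
    unfolding \<psi>_def hD(2)[OF that] using z(1) hD(1)[OF that(1)] hD(1)[OF that(2)] by algebra
  show \<psi>_smult: "?\<psi> (c \<odot>\<^bsub>F\<^esub> x) = c \<odot>\<^bsub>A\<^esub> ?\<psi> x" if "x \<in> carrier F" for x c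
    using z that by (simp add: \<psi>_def hD A.smult_minus A.smult_mult_right)
  show "?\<psi> (astar F x) = astar A (?\<psi> x)" if "x \<in> carrier F" for x
    using z that by (simp add: \<psi>_def hD A.star_minus A.star_mult A.star_closed central[of "astar A (h x)"])
  show z\<psi>: "z \<otimes>\<^bsub>A\<^esub> ?\<psi> x = \<zero>\<^bsub>A\<^esub>" if "x \<in> carrier F" for x
  proof -
    have hx: "h x \<in> carrier A" using that by (rule hD)
    have "z \<otimes>\<^bsub>A\<^esub> ?\<psi> x = z \<otimes>\<^bsub>A\<^esub> h x \<ominus>\<^bsub>A\<^esub> (z \<otimes>\<^bsub>A\<^esub> z) \<otimes>\<^bsub>A\<^esub> h x"
      unfolding \<psi>_def using hx z(1) by algebra
    then show ?thesis using hx z by (simp add: A.minus_eq A.r_neg)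
  qed
  show "?\<psi> (x \<otimes>\<^bsub>F\<^esub> y) = ?\<psi> x \<otimes>\<^bsub>A\<^esub> ?\<psi> y" if x: "x \<in> carrier F" and y: "y \<in> carrier F" for x y
  proof -
    have c: "h x \<in> carrier A" "h y \<in> carrier A" "?\<psi> y \<in> carrier A" using x y hD \<psi>c by auto
    have "?\<psi> x \<otimes>\<^bsub>A\<^esub> ?\<psi> y = h x \<otimes>\<^bsub>A\<^esub> ?\<psi> y \<ominus>\<^bsub>A\<^esub> (z \<otimes>\<^bsub>A\<^esub> h x) \<otimes>\<^bsub>A\<^esub> ?\<psi> y"
      unfolding \<psi>_def[of x] using c z(1) by algebra
    \<comment> \<open>Centrality moves \<open>z\<close> past \<open>h x\<close> onto the cut-off of
      \<open>y\<close>, where it gives zero; so only one of the two factors has to be cut.\<close>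
    also have "(z \<otimes>\<^bsub>A\<^esub> h x) \<otimes>\<^bsub>A\<^esub> ?\<psi> y = h x \<otimes>\<^bsub>A\<^esub> (z \<otimes>\<^bsub>A\<^esub> ?\<psi> y)"
      using c z central[OF c(1)] by (metis A.m_assoc)
    also have "h x \<otimes>\<^bsub>A\<^esub> ?\<psi> y = ?\<psi> (x \<otimes>\<^bsub>F\<^esub> y)"
    proof -
      have "h x \<otimes>\<^bsub>A\<^esub> ?\<psi> y = h x \<otimes>\<^bsub>A\<^esub> h y \<ominus>\<^bsub>A\<^esub> (h x \<otimes>\<^bsub>A\<^esub> z) \<otimes>\<^bsub>A\<^esub> h y"
        unfolding \<psi>_def using c z(1) by algebra
      then show ?thesis using c z x y by (simp add: \<psi>_def hD central[of "h x"] A.m_assoc)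
    qed
    finally show ?thesis using z\<psi>[OF y] c \<psi>c[OF F.m_closed[OF x y]] by (simp add: A.minus_eq)
  qed
  show "?\<psi> (x \<ominus>\<^bsub>F\<^esub> y) = ?\<psi> x \<ominus>\<^bsub>A\<^esub> ?\<psi> y" if "x \<in> carrier F" "y \<in> carrier F" for x y
    using that by (simp add: a_minus_def \<psi>_add F.uminus_eq_smult A.uminus_eq_smult \<psi>_smult \<psi>c F.smult_closed)
qed

text \<open>In the completion of \<open>A\<close> the image \<open>w\<close> of \<open>z\<close> is
  a central projection, and \<open>J\<close> is the summand it generates. The quotient by
  \<open>J\<close> is thus a copy of the complementary summand, onto which the completion of
  \<open>F\<close> maps isometrically by the extended cut-off. Density of \<open>h\<close> makes the
  map onto.\<close>

theorem completion_quotient_iso: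
  fixes F :: "('f, 'c) star_algebra_scheme" and A :: "('a, 'b) star_algebra_scheme" and r :: "(nat \<Rightarrow> 'a) set \<Rightarrow> real"
  assumes F: "seminormed_star_algebra F p" and A: "seminormed_star_algebra A q" and h: "h \<in> star_hom F A"
    and z: "z \<in> carrier A" "z \<otimes>\<^bsub>A\<^esub> z = z" "astar A z = z"
    and central: "\<And>a. a \<in> carrier A \<Longrightarrow> a \<otimes>\<^bsub>A\<^esub> z = z \<otimes>\<^bsub>A\<^esub> a"
    and iso: "\<And>x. x \<in> carrier F \<Longrightarrow> q (cut_off A z h x) = p x"
    and dense: "\<And>a e. \<lbrakk>a \<in> carrier A; 0 < e\<rbrakk> \<Longrightarrow> \<exists>x\<in>carrier F. q (a \<ominus>\<^bsub>A\<^esub> h x) < e"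
  defines "J \<equiv> (\<lambda>U. to_completion A q z \<otimes>\<^bsub>completion A q\<^esub> U) ` carrier (completion A q)"
  shows "\<exists>\<kappa>\<in>star_iso (completion F p) (star_quot (completion A q) r J).
    \<forall>x\<in>carrier F. \<kappa> (to_completion F p x) = J +>\<^bsub>completion A q\<^esub> to_completion A q (h x)"
proof -
  interpret F: seminormed_star_algebra F p by (rule F)
  interpret A: seminormed_star_algebra A q by (rule A)
  define C where "C = completion A q"
  define K where "K = completion F p"
  interpret C: cstar_algebra C unfolding C_def by (rule A.completion_cstar)
  note hD = star_homD[OF h]
  define clA where "clA X = null_sequences A q +>\<^bsub>Cauchy_algebra A q\<^esub> X" for X
  define clF where "clF X = null_sequences F p +>\<^bsub>Cauchy_algebra F p\<^esub> X" for X
  note A_ops = A.cls_ops[folded clA_def C_def] and F_ops = F.cls_ops[folded clF_def K_def]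
  note A_car = A.cls_carrier[folded clA_def C_def] and F_car = F.cls_carrier[folded clF_def K_def]
  note A_eq = A.cls_eq_iff[folded clA_def] and F_eq = F.cls_eq_iff[folded clF_def]
  note A_iota = A.iota_eq[folded clA_def] and F_iota = F.iota_eq[folded clF_def]
  have cl_C: "clA X \<in> carrier C" if "Cauchy_for A q X" for X using that A_car by auto
  define w where "w = to_completion A q z"
  have wC: "w \<in> carrier C" unfolding w_def C_def by (rule A.iota_carrier[OF z(1)])
  have w_cl: "w \<otimes>\<^bsub>C\<^esub> clA X = clA (\<lambda>n. z \<otimes>\<^bsub>A\<^esub> X n)" if "Cauchy_for A q X" for X
    using that by (simp add: w_def A_iota A_ops A.Cauchy_const z)
  have ww: "w \<otimes>\<^bsub>C\<^esub> w = w" using w_cl[OF A.Cauchy_const[OF z(1)]] by (simp add: w_def A_iota z)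
  have wst: "astar C w = w" using A.Cauchy_const[OF z(1)] by (simp add: w_def A_iota A_ops z)
  have wcen: "U \<otimes>\<^bsub>C\<^esub> w = w \<otimes>\<^bsub>C\<^esub> U" if U: "U \<in> carrier C" for U
  proof -
    obtain X where X: "Cauchy_for A q X" "U = clA X" using iffD1[OF A_car U] by blast
    have "U \<otimes>\<^bsub>C\<^esub> w = clA (\<lambda>n. X n \<otimes>\<^bsub>A\<^esub> z)"
      using X by (simp add: w_def A_iota A_ops A.Cauchy_const z)
    also have "\<dots> = w \<otimes>\<^bsub>C\<^esub> U" using X A.Cauchy_carr[OF X(1)] by (simp add: w_cl central[of "X _"])
    finally show ?thesis .
  qed
  have JI: "w \<otimes>\<^bsub>C\<^esub> U \<in> J" if "U \<in> carrier C" for U using that by (auto simp: J_def w_def C_def)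
  \<comment> \<open>As \<open>w\<close> is idempotent, the elements of \<open>J\<close> are fixed by
    \<open>w\<close>; the ideal laws follow from this and centrality.\<close>
  have JE: "U \<in> carrier C" "w \<otimes>\<^bsub>C\<^esub> U = U" if UJ: "U \<in> J" for U
  proof -
    obtain V where V: "V \<in> carrier C" "U = w \<otimes>\<^bsub>C\<^esub> V" using UJ by (auto simp: J_def w_def C_def)
    show "U \<in> carrier C" using V wC by simp
    show "w \<otimes>\<^bsub>C\<^esub> U = U" using V wC ww C.m_assoc[of w w V] by simp
  qed
  have J: "ideal J C"
  proof (intro idealI C.ring_axioms group.subgroupI[OF C.a_group])
    show "J \<subseteq> carrier (add_monoid C)" using JE by auto
    show "J \<noteq> {}" using JI[OF C.zero_closed] by auto
    fix U assume U: "U \<in> J"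
    show "inv\<^bsub>add_monoid C\<^esub> U \<in> J"
      using JI[of "\<ominus>\<^bsub>C\<^esub> U"] JE[OF U] wC by (simp add: a_inv_def[symmetric] C.r_minus)
    show "U \<otimes>\<^bsub>add_monoid C\<^esub> V \<in> J" if V: "V \<in> J" for V
      using JI[of "U \<oplus>\<^bsub>C\<^esub> V"] JE[OF U] JE[OF V] wC by (simp add: C.r_distr)
    fix V assume V: "V \<in> carrier C"
    show "U \<otimes>\<^bsub>C\<^esub> V \<in> J" using JI[of "U \<otimes>\<^bsub>C\<^esub> V"] JE[OF U] V wC by (simp flip: C.m_assoc)
    show "V \<otimes>\<^bsub>C\<^esub> U \<in> J"
      using JI[of "V \<otimes>\<^bsub>C\<^esub> U"] JE[OF U] V wC wcen[OF V] by (metis C.m_assoc C.m_closed)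
  qed
  have Jstar: "astar C U \<in> J" if "U \<in> J" for U
    using JI[OF C.star_closed, of U] JE[OF that] wC wst wcen[of "astar C U"] C.star_mult[of w U]
    by (simp add: C.star_closed)
  interpret J: ideal J C by (rule J)
  let ?Q = "star_quot C r J"
  have quot: "carrier ?Q = (\<lambda>U. J +>\<^bsub>C\<^esub> U) ` carrier C" "\<one>\<^bsub>?Q\<^esub> = J +>\<^bsub>C\<^esub> \<one>\<^bsub>C\<^esub>"
    "\<And>U V. \<lbrakk>U \<in> carrier C; V \<in> carrier C\<rbrakk> \<Longrightarrow> (J +>\<^bsub>C\<^esub> U) \<otimes>\<^bsub>?Q\<^esub> (J +>\<^bsub>C\<^esub> V) = J +>\<^bsub>C\<^esub> U \<otimes>\<^bsub>C\<^esub> V"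
    "\<And>U V. \<lbrakk>U \<in> carrier C; V \<in> carrier C\<rbrakk> \<Longrightarrow> (J +>\<^bsub>C\<^esub> U) \<oplus>\<^bsub>?Q\<^esub> (J +>\<^bsub>C\<^esub> V) = J +>\<^bsub>C\<^esub> (U \<oplus>\<^bsub>C\<^esub> V)"
    "\<And>U c. U \<in> carrier C \<Longrightarrow> c \<odot>\<^bsub>?Q\<^esub> (J +>\<^bsub>C\<^esub> U) = J +>\<^bsub>C\<^esub> c \<odot>\<^bsub>C\<^esub> U"
    "\<And>U. U \<in> carrier C \<Longrightarrow> astar ?Q (J +>\<^bsub>C\<^esub> U) = J +>\<^bsub>C\<^esub> astar C U"
    by (rule C.star_quot[OF J Jstar]; assumption)+
  have cos_eq: "J +>\<^bsub>C\<^esub> U = J +>\<^bsub>C\<^esub> V \<longleftrightarrow> U \<ominus>\<^bsub>C\<^esub> V \<in> J" if "U \<in> carrier C" "V \<in> carrier C" for U V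
    using C.quotient_eq_iff_same_a_r_cos[OF J that] by auto

  define \<psi> where "\<psi> = cut_off A z h"
  note cc = central_cut[OF F.complex_star_algebra_axioms A.complex_star_algebra_axioms h z central, folded \<psi>_def]
  note \<psi>c = cc(1) and \<psi>_add = cc(2) and \<psi>_smult = cc(3) and \<psi>_star = cc(4) and \<psi>_mult = cc(5)
    and \<psi>_minus = cc(6) and z\<psi> = cc(7)
  have q\<psi>: "q (\<psi> x) = p x" if "x \<in> carrier F" for x using iso[OF that] by (simp add: \<psi>_def)
  \<comment> \<open>\<open>\<psi>\<close> is additive and isometric, hence preserves Cauchy
    sequences. \<open>h\<close> alone need not, as \<open>p\<close> does not control its component
    along \<open>z\<close>.\<close>
  have \<psi>Cau: "Cauchy_for A q (\<lambda>n. \<psi> (X n))" if "Cauchy_for F p X" for X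
    using that unfolding Cauchy_for_def by (auto simp: \<psi>c q\<psi> simp flip: \<psi>_minus)
  define \<tau> where "\<tau> X = clA (\<lambda>n. \<psi> (X n))" for X
  have \<tau>C: "\<tau> X \<in> carrier C" if "Cauchy_for F p X" for X unfolding \<tau>_def by (rule cl_C[OF \<psi>Cau[OF that]])
  have \<tau>eq: "\<tau> X = \<tau> Y \<longleftrightarrow> clF X = clF Y" if X: "Cauchy_for F p X" and Y: "Cauchy_for F p Y" for X Y
    using F.Cauchy_carr[OF X] F.Cauchy_carr[OF Y]
    by (simp add: \<tau>_def A_eq[OF \<psi>Cau[OF X] \<psi>Cau[OF Y]] F_eq[OF X Y] q\<psi> flip: \<psi>_minus)
  have w\<tau>: "w \<otimes>\<^bsub>C\<^esub> \<tau> X = \<zero>\<^bsub>C\<^esub>" if X: "Cauchy_for F p X" for X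
    using F.Cauchy_carr[OF X] \<psi>Cau[OF X] A_ops(6)[OF \<psi>Cau[OF X]] by (simp add: \<tau>_def w_cl z\<psi>)
  \<comment> \<open>\<open>h\<close> and \<open>\<psi>\<close> differ by \<open>z\<close> times
    \<open>h\<close>, whose class lies in \<open>J\<close>. So \<open>h\<close> and
    \<open>\<psi>\<close> give the same coset whenever \<open>h\<close> does give a Cauchy
    sequence.\<close>
  have cos_h: "J +>\<^bsub>C\<^esub> \<tau> X = J +>\<^bsub>C\<^esub> clA (\<lambda>n. h (X n))"
    if X: "Cauchy_for F p X" and hX: "Cauchy_for A q (\<lambda>n. h (X n))" for X
  proof -
    have "Cauchy_for A q (\<lambda>n. z \<otimes>\<^bsub>A\<^esub> h (X n))" by (rule A.Cauchy_mult[OF A.Cauchy_const[OF z(1)] hX])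
    then have "\<tau> X \<oplus>\<^bsub>C\<^esub> w \<otimes>\<^bsub>C\<^esub> clA (\<lambda>n. h (X n)) = clA (\<lambda>n. \<psi> (X n) \<oplus>\<^bsub>A\<^esub> z \<otimes>\<^bsub>A\<^esub> h (X n))"
      by (simp add: \<tau>_def w_cl[OF hX] A_ops \<psi>Cau[OF X])
    also have "(\<lambda>n. \<psi> (X n) \<oplus>\<^bsub>A\<^esub> z \<otimes>\<^bsub>A\<^esub> h (X n)) = (\<lambda>n. h (X n))"
    proof
      fix n
      have "h (X n) \<in> carrier A" using F.Cauchy_carr[OF X] by (rule hD)
      then show "\<psi> (X n) \<oplus>\<^bsub>A\<^esub> z \<otimes>\<^bsub>A\<^esub> h (X n) = h (X n)" unfolding \<psi>_def cut_off_def using z(1) by algebra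
    qed
    finally have "clA (\<lambda>n. h (X n)) \<ominus>\<^bsub>C\<^esub> \<tau> X = w \<otimes>\<^bsub>C\<^esub> clA (\<lambda>n. h (X n))"
      using \<tau>C[OF X] cl_C[OF hX] wC by (metis C.add.inv_solve_right' C.m_closed C.minus_eq C.a_comm a_inv_def)
    then show ?thesis using cos_eq[OF cl_C[OF hX] \<tau>C[OF X]] JI[OF cl_C[OF hX]] by simp
  qed
  define rep where "rep U = (SOME X. Cauchy_for F p X \<and> U = clF X)" for U
  have rep: "Cauchy_for F p (rep U)" "U = clF (rep U)" if "U \<in> carrier K" for U
    using someI_ex[of "\<lambda>X. Cauchy_for F p X \<and> U = clF X"] that F_car unfolding rep_def by auto
  define \<kappa> where "\<kappa> U = J +>\<^bsub>C\<^esub> \<tau> (rep U)" for U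
  have \<kappa>cl: "\<kappa> (clF X) = J +>\<^bsub>C\<^esub> \<tau> X" if X: "Cauchy_for F p X" for X
  proof -
    have U: "clF X \<in> carrier K" using X F_car by auto
    show ?thesis using \<tau>eq[OF rep(1)[OF U] X] rep(2)[OF U] by (simp add: \<kappa>_def)
  qed
  have \<kappa>gen: "\<kappa> (to_completion F p x) = J +>\<^bsub>C\<^esub> to_completion A q (h x)" if x: "x \<in> carrier F" for x
    unfolding F_iota A_iota
    using \<kappa>cl[OF F.Cauchy_const[OF x]] cos_h[OF F.Cauchy_const[OF x] A.Cauchy_const[OF hD(1)[OF x]]] by simp
  have "\<kappa> \<in> star_hom K ?Q"
    unfolding star_hom_def mem_Collect_eq
  proof (intro conjI ballI allI ring_hom_memI)
    show "\<kappa> \<one>\<^bsub>K\<^esub> = \<one>\<^bsub>?Q\<^esub>"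
      using \<kappa>gen[OF F.one_closed] F_ops(5)[OF F.Cauchy_const[OF F.one_closed]]
        A_ops(5)[OF A.Cauchy_const[OF A.one_closed]]
      by (simp add: quot hD F_iota A_iota)
    fix U c assume "U \<in> carrier K"
    then obtain X where X: "Cauchy_for F p X" and U: "U = clF X" using F_car by blast
    have Xn: "X n \<in> carrier F" for n by (rule F.Cauchy_carr[OF X])
    show "\<kappa> U \<in> carrier ?Q" unfolding U \<kappa>cl[OF X] quot(1) using \<tau>C[OF X] by blast
    show "\<kappa> (c \<odot>\<^bsub>K\<^esub> U) = c \<odot>\<^bsub>?Q\<^esub> \<kappa> U"
      unfolding U F_ops(3)[OF X] \<kappa>cl[OF X] \<kappa>cl[OF F.Cauchy_smult[OF X]] quot(5)[OF \<tau>C[OF X]]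
      by (simp add: \<tau>_def \<psi>_smult Xn A_ops(3)[OF \<psi>Cau[OF X]])
    show "\<kappa> (astar K U) = astar ?Q (\<kappa> U)"
      unfolding U F_ops(4)[OF X] \<kappa>cl[OF X] \<kappa>cl[OF F.Cauchy_star[OF X]] quot(6)[OF \<tau>C[OF X]]
      by (simp add: \<tau>_def \<psi>_star Xn A_ops(4)[OF \<psi>Cau[OF X]])
    fix V assume "V \<in> carrier K"
    then obtain Y where Y: "Cauchy_for F p Y" and V: "V = clF Y" using F_car by blast
    have Yn: "Y n \<in> carrier F" for n by (rule F.Cauchy_carr[OF Y])
    show "\<kappa> (U \<oplus>\<^bsub>K\<^esub> V) = \<kappa> U \<oplus>\<^bsub>?Q\<^esub> \<kappa> V"
      unfolding U V F_ops(1)[OF X Y] \<kappa>cl[OF X] \<kappa>cl[OF Y] \<kappa>cl[OF F.Cauchy_add[OF X Y]] quot(4)[OF \<tau>C[OF X] \<tau>C[OF Y]]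
      by (simp add: \<tau>_def \<psi>_add Xn Yn A_ops(1)[OF \<psi>Cau[OF X] \<psi>Cau[OF Y]])
    show "\<kappa> (U \<otimes>\<^bsub>K\<^esub> V) = \<kappa> U \<otimes>\<^bsub>?Q\<^esub> \<kappa> V"
      unfolding U V F_ops(2)[OF X Y] \<kappa>cl[OF X] \<kappa>cl[OF Y] \<kappa>cl[OF F.Cauchy_mult[OF X Y]] quot(3)[OF \<tau>C[OF X] \<tau>C[OF Y]]
      by (simp add: \<tau>_def \<psi>_mult Xn Yn A_ops(2)[OF \<psi>Cau[OF X] \<psi>Cau[OF Y]])
  qed
  moreover have "bij_betw \<kappa> (carrier K) (carrier ?Q)"
    unfolding bij_betw_def
  proof
    show "inj_on \<kappa> (carrier K)"
    proof (rule inj_onI)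
      fix U V assume UV: "U \<in> carrier K" "V \<in> carrier K" and eq: "\<kappa> U = \<kappa> V"
      obtain X where X: "Cauchy_for F p X" and U: "U = clF X" using iffD1[OF F_car UV(1)] by blast
      obtain Y where Y: "Cauchy_for F p Y" and V: "V = clF Y" using iffD1[OF F_car UV(2)] by blast
      have c: "\<tau> X \<in> carrier C" "\<tau> Y \<in> carrier C" using \<tau>C X Y by auto
      \<comment> \<open>Elements of \<open>J\<close> are fixed by \<open>w\<close>, whereas both
        \<open>\<tau> X\<close> and \<open>\<tau> Y\<close> are annihilated by it, so the difference
        is zero.\<close>
      have "\<tau> X \<ominus>\<^bsub>C\<^esub> \<tau> Y \<in> J" using eq cos_eq[OF c] by (simp add: U V \<kappa>cl X Y)
      then have "\<tau> X \<ominus>\<^bsub>C\<^esub> \<tau> Y = w \<otimes>\<^bsub>C\<^esub> (\<tau> X \<ominus>\<^bsub>C\<^esub> \<tau> Y)" by (rule JE(2)[symmetric])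
      also have "\<dots> = w \<otimes>\<^bsub>C\<^esub> \<tau> X \<ominus>\<^bsub>C\<^esub> w \<otimes>\<^bsub>C\<^esub> \<tau> Y" using c wC by algebra
      finally have "\<tau> X \<ominus>\<^bsub>C\<^esub> \<tau> Y = \<zero>\<^bsub>C\<^esub>" by (simp add: w\<tau> X Y C.minus_eq)
      moreover have "\<tau> X = (\<tau> X \<ominus>\<^bsub>C\<^esub> \<tau> Y) \<oplus>\<^bsub>C\<^esub> \<tau> Y" using c by algebra
      ultimately have "\<tau> X = \<tau> Y" using c by simp
      then show "U = V" using \<tau>eq[OF X Y] U V by simp
    qed
    have "W \<in> \<kappa> ` carrier K" if W: "W \<in> carrier ?Q" for W
    proof -
      obtain U where U: "U \<in> carrier C" "W = J +>\<^bsub>C\<^esub> U" using W unfolding quot(1) by blast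
      obtain Y where Y: "Cauchy_for A q Y" and WY: "W = J +>\<^bsub>C\<^esub> clA Y"
        using iffD1[OF A_car U(1)] U(2) by blast
      have Yn: "Y n \<in> carrier A" for n by (rule A.Cauchy_carr[OF Y])
      \<comment> \<open>The representative \<open>Y\<close> is replaced by a sequence in the image
        of \<open>h\<close>. The error \<open>D\<close> is a null sequence, hence Cauchy, so the new
        sequence is Cauchy and represents the same class.\<close>
      have "\<forall>n. \<exists>x\<in>carrier F. q (Y n \<ominus>\<^bsub>A\<^esub> h x) < inverse (real (Suc n))" using dense[OF Yn] by simp
      then obtain x where x: "\<And>n. x n \<in> carrier F" "\<And>n. q (Y n \<ominus>\<^bsub>A\<^esub> h (x n)) < inverse (real (Suc n))" by metis
      have hx: "h (x n) \<in> carrier A" for n using x hD by auto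
      define D where "D n = Y n \<ominus>\<^bsub>A\<^esub> h (x n)" for n
      have Dn: "D n \<in> carrier A" for n using Yn hx by (simp add: D_def)
      have D0: "(\<lambda>n. q (D n)) \<longlonglongrightarrow> 0"
        by (rule tendsto_sandwich[OF _ _ tendsto_const LIMSEQ_inverse_real_of_nat])
          (use x Dn in \<open>auto simp: D_def A.p_nonneg less_imp_le simp del: of_nat_Suc\<close>)
      have DC: "Cauchy_for A q D"
      proof (rule A.Cauchy_I[OF Dn])
        fix e :: real assume "e > 0"
        then have "\<forall>\<^sub>F n in sequentially. q (D n) < e / 2" by (intro order_tendstoD(2)[OF D0]) simp
        then obtain N where N: "\<And>n. n \<ge> N \<Longrightarrow> q (D n) < e / 2" by (auto simp: eventually_sequentially)
        have "q (D m \<ominus>\<^bsub>A\<^esub> D n) < e" if "m \<ge> N" "n \<ge> N" for m n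
          using A.p_minus[OF Dn Dn, of m n] N[OF that(1)] N[OF that(2)] by linarith
        then show "\<exists>N. \<forall>m\<ge>N. \<forall>n\<ge>N. q (D m \<ominus>\<^bsub>A\<^esub> D n) < e" by blast
      qed
      have "Cauchy_for A q (\<lambda>n. Y n \<oplus>\<^bsub>A\<^esub> \<ominus>\<^bsub>A\<^esub> D n)" by (rule A.Cauchy_add[OF Y A.Cauchy_uminus[OF DC]])
      moreover have "Y n \<oplus>\<^bsub>A\<^esub> \<ominus>\<^bsub>A\<^esub> D n = h (x n)" for n
        using Yn[of n] hx[of n] unfolding D_def by algebra
      ultimately have hxC: "Cauchy_for A q (\<lambda>n. h (x n))" by simp
      \<comment> \<open>Multiplication by \<open>1 - z\<close> enlarges \<open>q\<close> by at most
        the factor \<open>1 + q z\<close>, so the Cauchy condition for \<open>h (x n)\<close> under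
        \<open>q\<close> gives that for \<open>x n\<close> under \<open>p\<close>.\<close>
      have xC: "Cauchy_for F p x"
      proof (rule F.Cauchy_I[OF x(1)])
        fix e :: real assume e: "e > 0"
        let ?k = "1 + q z"
        have k: "?k > 0" using A.p_nonneg[OF z(1)] by simp
        then obtain N where N: "\<And>m n. m \<ge> N \<Longrightarrow> n \<ge> N \<Longrightarrow> q (h (x m) \<ominus>\<^bsub>A\<^esub> h (x n)) < e / ?k"
          using hxC e unfolding Cauchy_for_def by (meson divide_pos_pos)
        have "p (x m \<ominus>\<^bsub>F\<^esub> x n) < e" if "m \<ge> N" "n \<ge> N" for m n
        proof -
          let ?d = "h (x m) \<ominus>\<^bsub>A\<^esub> h (x n)"
          have d: "?d \<in> carrier A" using hx by simp
          have "p (x m \<ominus>\<^bsub>F\<^esub> x n) = q (\<psi> (x m \<ominus>\<^bsub>F\<^esub> x n))" using x by (simp add: q\<psi>)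
          also have "\<dots> = q (?d \<ominus>\<^bsub>A\<^esub> z \<otimes>\<^bsub>A\<^esub> ?d)"
            unfolding \<psi>_def cut_off_def star_hom_minus[OF F.complex_star_algebra_axioms A.complex_star_algebra_axioms h x(1) x(1)] ..
          also have "\<dots> \<le> q ?d + q z * q ?d"
            using A.p_minus[OF d, of "z \<otimes>\<^bsub>A\<^esub> ?d"] A.p_mult[OF z(1) d] d z by simp
          also have "\<dots> = ?k * q ?d" by (simp add: algebra_simps)
          also have "\<dots> < ?k * (e / ?k)" using N[OF that] k by (rule mult_strict_left_mono)
          finally show ?thesis using k by simp
        qed
        then show "\<exists>N. \<forall>m\<ge>N. \<forall>n\<ge>N. p (x m \<ominus>\<^bsub>F\<^esub> x n) < e" by blast
      qed
      have "clA Y = clA (\<lambda>n. h (x n))" using A_eq[OF Y hxC] D0 by (simp add: D_def)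
      then have "W = \<kappa> (clF x)" using WY \<kappa>cl[OF xC] cos_h[OF xC hxC] by simp
      then show ?thesis using iffD2[OF F_car, OF exI, of x] xC by blast
    qed
    then show "\<kappa> ` carrier K = carrier ?Q"
      using star_homD(1)[OF \<open>\<kappa> \<in> star_hom K ?Q\<close>] by auto
  qed
  ultimately have "\<kappa> \<in> star_iso K ?Q" by (simp add: star_iso_def)
  then show ?thesis using \<kappa>gen unfolding K_def C_def by blast
qed

section \<open>Partial bijections and words\<close>

text \<open>The symmetric inverse monoid of partial bijections of \<open>S\<close>; it contains the
  left inverse hull and also the empty map, which the hull may lack.\<close>

definition pmaps :: "'a set \<Rightarrow> ('a \<rightharpoonup> 'a) set" where
  "pmaps S = {f. inj_on f (dom f) \<and> dom f \<subseteq> S \<and> ran f \<subseteq> S}"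

definition id_map :: "'a set \<Rightarrow> ('a \<rightharpoonup> 'a)" where
  "id_map X = (\<lambda>x. if x \<in> X then Some x else None)"

lemma map_eqI: "(\<And>x y. f x = Some y \<longleftrightarrow> g x = Some y) \<Longrightarrow> f = g"
  by (rule ext) (metis option.exhaust)

lemma partial_inverse_Some:
  assumes "inj_on f (dom f)" shows "partial_inverse f y = Some x \<longleftrightarrow> f x = Some y"
proof -
  have "(THE z. f z = Some y) = x'" if "f x' = Some y" for x'
    using that inj_onD[OF assms] by (intro the_equality) (auto simp: dom_def)
  then show ?thesis by (force simp: partial_inverse_def ran_def)
qed

lemma id_map_Some: "id_map X x = Some y \<longleftrightarrow> x \<in> X \<and> y = x"
  by (auto simp: id_map_def)

lemma pmapsD:
  assumes "f \<in> pmaps S"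
  shows "inj_on f (dom f)" "f x = Some y \<Longrightarrow> x \<in> S" "f x = Some y \<Longrightarrow> y \<in> S"
    "partial_inverse f y = Some x \<longleftrightarrow> f x = Some y"
    "\<lbrakk>f x = Some y; f x' = Some y\<rbrakk> \<Longrightarrow> x = x'"
  using assms inj_onD[of f "dom f" x x'] by (auto simp: pmaps_def partial_inverse_Some intro: ranI)

lemma pmapsI:
  assumes "\<And>x y. f x = Some y \<Longrightarrow> x \<in> S \<and> y \<in> S" "\<And>x x' y. \<lbrakk>f x = Some y; f x' = Some y\<rbrakk> \<Longrightarrow> x = x'"
  shows "f \<in> pmaps S"
  using assms by (auto simp: pmaps_def inj_on_def ran_def)

lemma partial_inverse_pmaps: "f \<in> pmaps S \<Longrightarrow> partial_inverse f \<in> pmaps S"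
  by (rule pmapsI) (auto simp: pmapsD(4)[of _ S] dest: pmapsD(2,3))

lemma partial_inverse_invol: "f \<in> pmaps S \<Longrightarrow> partial_inverse (partial_inverse f) = f"
  by (rule map_eqI) (simp add: pmapsD(4)[of _ S] partial_inverse_pmaps)

lemma comp_pmaps: "\<lbrakk>f \<in> pmaps S; g \<in> pmaps S\<rbrakk> \<Longrightarrow> f \<circ>\<^sub>m g \<in> pmaps S"
  by (rule pmapsI) (auto simp: map_comp_Some_iff dest: pmapsD(2,3) pmapsD(5)[of f] pmapsD(5)[of g])

lemma partial_inverse_comp:
  "\<lbrakk>f \<in> pmaps S; g \<in> pmaps S\<rbrakk> \<Longrightarrow> partial_inverse (f \<circ>\<^sub>m g) = partial_inverse g \<circ>\<^sub>m partial_inverse f"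
  by (rule map_eqI) (auto simp: map_comp_Some_iff pmapsD(4)[of _ S] comp_pmaps)

lemma map_comp_assoc: "(f \<circ>\<^sub>m g) \<circ>\<^sub>m h = f \<circ>\<^sub>m (g \<circ>\<^sub>m h)"
  by (rule map_eqI) (auto simp: map_comp_Some_iff)

lemma id_map_pmaps: "X \<subseteq> S \<Longrightarrow> id_map X \<in> pmaps S"
  by (rule pmapsI) (auto simp: id_map_Some)

lemma id_map_comp: "f \<in> pmaps S \<Longrightarrow> id_map S \<circ>\<^sub>m f = f" "f \<in> pmaps S \<Longrightarrow> f \<circ>\<^sub>m id_map S = f"
  by (rule map_eqI, auto simp: map_comp_Some_iff id_map_Some dest: pmapsD(2,3))+

lemma id_map_comp_id_map: "id_map X \<circ>\<^sub>m id_map Y = id_map (X \<inter> Y)"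
  by (rule map_eqI) (auto simp: map_comp_Some_iff id_map_Some)

lemma partial_inverse_id_map: "partial_inverse (id_map X) = id_map X"
  by (rule map_eqI) (auto simp: pmapsD(4)[OF id_map_pmaps[OF order_refl]] id_map_Some)

lemma comp_partial_inverse: "f \<in> pmaps S \<Longrightarrow> f \<circ>\<^sub>m partial_inverse f = id_map (ran f)"
  by (rule map_eqI) (auto simp: map_comp_Some_iff id_map_Some ran_def pmapsD(4)[of f S] dest: pmapsD(5)[of f S])

lemma partial_inverse_comp_self: "f \<in> pmaps S \<Longrightarrow> partial_inverse f \<circ>\<^sub>m f = id_map (dom f)"
  by (rule map_eqI) (auto simp: map_comp_Some_iff id_map_Some pmapsD(4)[of f S] dest: pmapsD(5)[of f S])

lemma id_map_empty: "id_map {} = Map.empty"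
  by (simp add: id_map_def)

lemma map_comp_empty: "f \<circ>\<^sub>m Map.empty = Map.empty" "Map.empty \<circ>\<^sub>m f = Map.empty"
  by (rule map_eqI, simp add: map_comp_Some_iff)+

lemma partial_inverse_empty: "partial_inverse (Map.empty :: 'a \<rightharpoonup> 'a) = Map.empty"
  using partial_inverse_id_map[of "{} :: 'a set"] unfolding id_map_empty .

section \<open>Words in the generators as partial bijections of the submonoid\<close>

locale group_submonoid = group G + S: submonoid S G for G :: "('g, 'b) monoid_scheme" (structure) and S
begin

lemma S_G: "s \<in> S \<Longrightarrow> s \<in> carrier G" using S.subset by auto

lemma left_mult_Some: "left_mult G S s x = Some y \<longleftrightarrow> x \<in> S \<and> y = s \<otimes> x"
  by (auto simp: left_mult_def)

lemma left_mult_pmaps: "s \<in> S \<Longrightarrow> left_mult G S s \<in> pmaps S"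
  by (rule pmapsI) (auto simp: left_mult_Some S_G)

lemma left_mult_one: "left_mult G S \<one> = id_map S"
  by (rule map_eqI) (auto simp: left_mult_Some id_map_Some S_G)

lemma hull_pmaps: "f \<in> left_hull_set G S \<Longrightarrow> f \<in> pmaps S"
  by (induction rule: left_hull_set.induct) (auto simp: left_mult_pmaps comp_pmaps partial_inverse_pmaps)

lemma id_map_hull: "id_map S \<in> left_hull_set G S"
  using left_hull_set.gen[OF S.one_closed, of G] by (simp add: left_mult_one)

lemma left_hull_simps:
  "carrier (left_hull G S) = left_hull_set G S" "f \<otimes>\<^bsub>left_hull G S\<^esub> g = f \<circ>\<^sub>m g"
  "\<one>\<^bsub>left_hull G S\<^esub> = id_map S" "mstar (left_hull G S) = partial_inverse"
  by (simp_all add: left_hull_def left_mult_one)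

lemma left_hull_involutive: "involutive_monoid (left_hull G S)"
  by unfold_locales
    (auto simp: left_hull_simps map_comp_assoc id_map_hull
      intro: left_hull_set.intros id_map_comp hull_pmaps partial_inverse_comp partial_inverse_invol)

primrec gen_map :: "'g li_generator \<Rightarrow> ('g \<rightharpoonup> 'g)" where
  "gen_map (V s) = left_mult G S s"
| "gen_map (E X) = id_map X"

definition letter_map :: "'g li_generator \<times> bool \<Rightarrow> ('g \<rightharpoonup> 'g)" where
  "letter_map l = (if snd l then partial_inverse (gen_map (fst l)) else gen_map (fst l))"

text \<open>The empty word acts as the identity of \<open>S\<close>, which is the unit of the hull,
  and not of the whole type.\<close>

definition word_map :: "('g li_generator \<times> bool) list \<Rightarrow> ('g \<rightharpoonup> 'g)" where
  "word_map w = foldr (\<lambda>l f. letter_map l \<circ>\<^sub>m f) w (id_map S)"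

abbreviation "W \<equiv> lists (li_generators G S \<times> (UNIV :: bool set))"

abbreviation "wstar w \<equiv> rev (map (\<lambda>(x, b). (x, \<not> b)) w)"

text \<open>The left-hand words of the relation \<open>word\<close>. They serve as normal forms:
  every word will be shown equivalent to one of them or to zero.\<close>

definition nword :: "('g \<times> 'g) list \<Rightarrow> ('g li_generator \<times> bool) list" where
  "nword ts = concat (map (\<lambda>(t, s). [(V t, True), (V s, False)]) ts)"

abbreviation (input) "flip ts \<equiv> rev (map prod.swap ts)"

lemma free_star_monoid_simps:
  "carrier (free_star_monoid X) = lists (X \<times> UNIV)" "mult (free_star_monoid X) = (@)"
  "one (free_star_monoid X) = []" "mstar (free_star_monoid X) w = wstar w"
  by (simp_all add: free_star_monoid_def)

lemma free_involutive: "involutive_monoid (free_star_monoid X)"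
proof
  fix w assume "w \<in> carrier (free_star_monoid X)"
  show "mstar (free_star_monoid X) (mstar (free_star_monoid X) w) = w"
    by (simp add: free_star_monoid_simps rev_map case_prod_unfold comp_def)
qed (auto simp: free_star_monoid_simps)

lemma word_ideal_subset: "word_ideal G S ts \<subseteq> S"
  by (cases ts) (auto simp: word_ideal_def)

lemma constructible_subset: "X \<in> constructible_ideals G S \<Longrightarrow> X \<subseteq> S"
  unfolding constructible_ideals_def using word_ideal_subset by (blast intro: Inter_lower)

lemma letter_map_pmaps:
  assumes "l \<in> li_generators G S \<times> UNIV" shows "letter_map l \<in> pmaps S"
proof -
  have "gen_map x \<in> pmaps S" if "x \<in> li_generators G S" for x
    using that by (auto simp: li_generators_def left_mult_pmaps intro!: id_map_pmaps dest: subsetD[OF constructible_subset])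
  then show ?thesis using assms by (auto simp: letter_map_def partial_inverse_pmaps)
qed

lemma word_map_simps: "word_map [] = id_map S" "word_map (l # w) = letter_map l \<circ>\<^sub>m word_map w"
  by (simp_all add: word_map_def)

lemma word_map_pmaps: "w \<in> W \<Longrightarrow> word_map w \<in> pmaps S"
  by (induction w) (auto simp: word_map_simps id_map_pmaps letter_map_pmaps comp_pmaps)

lemma word_map_append: "\<lbrakk>u \<in> W; v \<in> W\<rbrakk> \<Longrightarrow> word_map (u @ v) = word_map u \<circ>\<^sub>m word_map v"
  by (induction u) (auto simp: word_map_simps id_map_comp word_map_pmaps map_comp_assoc)

lemma wstar_W: "w \<in> W \<Longrightarrow> wstar w \<in> W"
  by auto

lemma word_map_letter: "l \<in> li_generators G S \<times> UNIV \<Longrightarrow> word_map [l] = letter_map l"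
  by (simp add: word_map_simps id_map_comp letter_map_pmaps)

lemma letter_map_star:
  "l \<in> li_generators G S \<times> UNIV \<Longrightarrow> letter_map (fst l, \<not> snd l) = partial_inverse (letter_map l)"
  using letter_map_pmaps[of "(fst l, False)"] by (auto simp: letter_map_def partial_inverse_invol)

lemma word_map_star: "w \<in> W \<Longrightarrow> word_map (wstar w) = partial_inverse (word_map w)"
proof (induction w)
  case Nil
  then show ?case by (simp add: word_map_simps partial_inverse_id_map)
next
  case (Cons l w)
  then have l: "l \<in> li_generators G S \<times> UNIV" and w: "w \<in> W" by auto
  then have l': "(fst l, \<not> snd l) \<in> li_generators G S \<times> UNIV" by auto
  have "word_map (wstar (l # w)) = word_map (wstar w) \<circ>\<^sub>m word_map [(fst l, \<not> snd l)]"
    using word_map_append[OF wstar_W[OF w], of "[(fst l, \<not> snd l)]"] l' by (simp add: case_prod_unfold)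
  also have "\<dots> = partial_inverse (word_map w) \<circ>\<^sub>m partial_inverse (letter_map l)"
    using Cons.IH w by (simp add: word_map_letter[OF l'] letter_map_star[OF l])
  also have "\<dots> = partial_inverse (word_map (l # w))"
    by (simp add: word_map_simps partial_inverse_comp[OF letter_map_pmaps[OF l] word_map_pmaps[OF w]])
  finally show ?case .
qed

lemma V_generator: "s \<in> S \<Longrightarrow> V s \<in> li_generators G S"
  by (simp add: li_generators_def)

lemma hull_eq_word_map: "f \<in> left_hull_set G S \<Longrightarrow> \<exists>w\<in>W. word_map w = f"
proof (induction rule: left_hull_set.induct)
  case (gen s)
  then have "(V s, False) \<in> li_generators G S \<times> UNIV" by (simp add: V_generator)
  then show ?case using word_map_letter by (intro bexI[of _ "[(V s, False)]"]) (auto simp: letter_map_def)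
next
  case (comp f g)
  then obtain u v where "u \<in> W" "v \<in> W" "word_map u = f" "word_map v = g" by blast
  then show ?case by (intro bexI[of _ "u @ v"]) (auto simp: word_map_append)
next
  case (inv f)
  then obtain w where "w \<in> W" "word_map w = f" by blast
  then show ?case by (intro bexI[of _ "wstar w"] word_map_star wstar_W) (simp add: word_map_star)
qed

lemma nword_simps: "nword [] = []" "nword ((t, s) # ts) = (V t, True) # (V s, False) # nword ts"
  "nword (ts @ us) = nword ts @ nword us"
  by (simp_all add: nword_def)

lemma nword_W: "set ts \<subseteq> S \<times> S \<Longrightarrow> nword ts \<in> W"
  by (induction ts) (auto simp: nword_simps V_generator)

text \<open>Taking adjoints reverses the order of the blocks and turns the block of
  \<open>(t, s)\<close> into that of \<open>(s, t)\<close>, so words of this form are closed under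
  adjoints.\<close>

lemma wstar_nword: "wstar (nword ts) = nword (flip ts)"
  by (induction ts) (auto simp: nword_simps)

lemma word_value_simps: "word_value G [] = \<one>" "word_value G ((t, s) # ts) = inv t \<otimes> s \<otimes> word_value G ts"
  by (simp_all add: word_value_def)

lemma word_value_closed: "set ts \<subseteq> S \<times> S \<Longrightarrow> word_value G ts \<in> carrier G"
  by (induction ts) (auto simp: word_value_simps S_G)

lemma word_value_append:
  "\<lbrakk>set ts \<subseteq> S \<times> S; set us \<subseteq> S \<times> S\<rbrakk> \<Longrightarrow> word_value G (ts @ us) = word_value G ts \<otimes> word_value G us"
  by (induction ts) (auto simp: word_value_simps S_G word_value_closed m_assoc)

lemma word_value_flip: "set ts \<subseteq> S \<times> S \<Longrightarrow> word_value G (flip ts) = inv (word_value G ts)"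
proof (induction ts)
  case (Cons p ts)
  obtain t s where p: "p = (t, s)" by force
  have c: "t \<in> carrier G" "s \<in> carrier G" "word_value G ts \<in> carrier G"
    using Cons.prems p word_value_closed[of ts] by (auto simp: S_G)
  have "word_value G (flip (p # ts)) = word_value G (flip ts) \<otimes> word_value G [(s, t)]"
    using Cons.prems p by (auto intro!: word_value_append)
  then show ?case
    using Cons c p by (simp add: word_value_simps inv_mult_group m_assoc)
qed (simp add: word_value_simps)

lemma nword_map_step:
  assumes "t \<in> S" "s \<in> S"
  shows "word_map (nword ((t, s) # ts)) x = Some y \<longleftrightarrow> (\<exists>r\<in>S. word_map (nword ts) x = Some r \<and> y \<in> S \<and> t \<otimes> y = s \<otimes> r)"
  using assms by (auto simp: nword_simps word_map_simps letter_map_def map_comp_Some_iff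
      pmapsD(4)[OF left_mult_pmaps] left_mult_Some) 

text \<open>Here the embedding into a group enters. Each block sends \<open>r\<close> to the
  solution \<open>y\<close> of \<open>t \<otimes> y = s \<otimes> r\<close>, which in
  \<open>G\<close> is unique and equals \<open>inv t \<otimes> s \<otimes> r\<close>.\<close>

lemma nword_map_value:
  assumes "set ts \<subseteq> S \<times> S" "word_map (nword ts) x = Some y"
  shows "y = word_value G ts \<otimes> x"
  using assms
proof (induction ts arbitrary: y)
  case Nil
  then show ?case by (simp add: nword_simps word_map_simps id_map_Some word_value_simps S_G)
next
  case (Cons p ts)
  obtain t s where p: "p = (t, s)" by force
  have ts: "t \<in> S" "s \<in> S" "set ts \<subseteq> S \<times> S" using Cons.prems p by auto
  obtain r where r: "r \<in> S" "word_map (nword ts) x = Some r" "y \<in> S" "t \<otimes> y = s \<otimes> r"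
    using Cons.prems(2) unfolding p nword_map_step[OF ts(1,2)] by blast
  have x: "x \<in> carrier G" using S_G[OF pmapsD(2)[OF word_map_pmaps[OF nword_W[OF ts(3)]] r(2)]] .
  have "y = inv t \<otimes> (s \<otimes> r)" using r ts by (simp add: S_G inv_solve_left)
  also have "r = word_value G ts \<otimes> x" using Cons.IH ts r by blast
  finally show ?case using ts x p by (simp add: word_value_simps S_G word_value_closed m_assoc)
qed

text \<open>Ranges and ideals obey the same recursion: a block in front replaces the range by the
  preimage under \<open>t\<close> of its translate by \<open>s\<close>.\<close>

lemma ran_nword_map: "set ts \<subseteq> S \<times> S \<Longrightarrow> ran (word_map (nword ts)) = word_ideal G S ts"
proof (induction ts)
  case Nil
  then show ?case by (auto simp: nword_simps word_map_simps word_ideal_def ran_def id_map_Some)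
next
  case (Cons p ts)
  obtain t s where p: "p = (t, s)" by force
  have ts: "t \<in> S" "s \<in> S" "set ts \<subseteq> S \<times> S" using Cons.prems p by auto
  have "word_ideal G S (p # ts) = {y \<in> S. t \<otimes> y \<in> (\<lambda>x. s \<otimes> x) ` word_ideal G S ts}"
    by (simp add: word_ideal_def p)
  also have "word_ideal G S ts = ran (word_map (nword ts))" using Cons ts by simp
  also have "{y \<in> S. t \<otimes> y \<in> (\<lambda>x. s \<otimes> x) ` \<dots>} = ran (word_map (nword (p # ts)))"
    using pmapsD(3)[OF word_map_pmaps[OF nword_W[OF ts(3)]]]
    unfolding p by (auto simp: ran_def nword_map_step[OF ts(1,2)])
  finally show ?case by simp
qed

text \<open>With trivial value the map fixes every point of its domain, so it is the identity on its
  range.\<close>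

lemma nword_map_id:
  assumes "set ts \<subseteq> S \<times> S" "word_value G ts = \<one>"
  shows "word_map (nword ts) = id_map (word_ideal G S ts)"
proof (rule map_eqI)
  fix x y
  have eq: "y = x \<and> x \<in> S" if "word_map (nword ts) x = Some y" for x y
    using nword_map_value[OF assms(1) that] pmapsD(2)[OF word_map_pmaps[OF nword_W[OF assms(1)]] that]
    by (simp add: assms(2) S_G)
  show "word_map (nword ts) x = Some y \<longleftrightarrow> id_map (word_ideal G S ts) x = Some y"
    unfolding id_map_Some ran_nword_map[OF assms(1), symmetric] ran_def using eq by fastforce
qed

lemma nword_map_flip:
  assumes "set ts \<subseteq> S \<times> S" shows "word_map (nword (flip ts)) = partial_inverse (word_map (nword ts))"
  using word_map_star[OF nword_W[OF assms]] by (simp add: wstar_nword)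

lemma nword_map_append:
  "\<lbrakk>set ts \<subseteq> S \<times> S; set us \<subseteq> S \<times> S\<rbrakk> \<Longrightarrow> word_map (nword (ts @ us)) = word_map (nword ts) \<circ>\<^sub>m word_map (nword us)"
  by (simp add: nword_simps word_map_append nword_W)

text \<open>If the map \<open>f\<close> of \<open>ts\<close> has range \<open>Y\<close>, then
  \<open>ts @ flip ts\<close> has trivial value and acts by \<open>f\<close> composed with its
  inverse, the identity on \<open>Y\<close>. Concatenation multiplies such identities and hence
  intersects the ideals. So the relation \<open>word\<close> reaches every generator
  \<open>E X\<close> with \<open>X\<close> constructible.\<close>

lemma constructible_word:
  assumes "X \<in> constructible_ideals G S"
  shows "\<exists>ts. ts \<noteq> [] \<and> set ts \<subseteq> S \<times> S \<and> word_value G ts = \<one> \<and> word_ideal G S ts = X"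
proof -
  obtain \<X> where \<X>: "finite \<X>" "\<X> \<noteq> {}" "\<X> \<subseteq> {word_ideal G S ts | ts. ts \<noteq> [] \<and> set ts \<subseteq> S \<times> S}" "X = \<Inter>\<X>"
    using assms unfolding constructible_ideals_def by blast
  have ideal: "word_ideal G S ts = Y" if "word_map (nword ts) = id_map Y" "set ts \<subseteq> S \<times> S" for ts Y
    using ran_nword_map[OF that(2)] by (auto simp: that(1) ran_def id_map_Some)
  have "\<exists>ts. ts \<noteq> [] \<and> set ts \<subseteq> S \<times> S \<and> word_value G ts = \<one> \<and> word_ideal G S ts = \<Inter>\<X>"
    using \<X>(1-3)
  proof (induction \<X> rule: finite_ne_induct)
    case (singleton Y)
    then obtain ts where ts: "ts \<noteq> []" "set ts \<subseteq> S \<times> S" "Y = word_ideal G S ts" by blast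
    then have f: "set (flip ts) \<subseteq> S \<times> S" by auto
    have "word_map (nword (ts @ flip ts)) = id_map Y"
      unfolding nword_map_append[OF ts(2) f] nword_map_flip[OF ts(2)] ts(3) ran_nword_map[OF ts(2), symmetric]
      by (rule comp_partial_inverse[OF word_map_pmaps[OF nword_W[OF ts(2)]]])
    then show ?case
      using ts f ideal[of "ts @ flip ts"] word_value_append[OF ts(2) f] word_value_flip[OF ts(2)] word_value_closed[OF ts(2)]
      by (intro exI[of _ "ts @ flip ts"]) (simp add: r_inv)
  next
    case (insert Y \<Y>)
    then obtain us where us: "us \<noteq> []" "set us \<subseteq> S \<times> S" "word_value G us = \<one>" "word_ideal G S us = \<Inter>\<Y>" by auto
    obtain ts where ts: "ts \<noteq> []" "set ts \<subseteq> S \<times> S" "Y = word_ideal G S ts" using insert.prems by blast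
    then have f: "set (flip ts) \<subseteq> S \<times> S" by auto
    have tt: "set (ts @ flip ts) \<subseteq> S \<times> S" using ts f by auto
    have "word_map (nword (ts @ flip ts)) = id_map Y"
      unfolding nword_map_append[OF ts(2) f] nword_map_flip[OF ts(2)] ts(3) ran_nword_map[OF ts(2), symmetric]
      by (rule comp_partial_inverse[OF word_map_pmaps[OF nword_W[OF ts(2)]]])
    then have "word_map (nword ((ts @ flip ts) @ us)) = id_map (Y \<inter> \<Inter>\<Y>)"
      unfolding nword_map_append[OF tt us(2)] nword_map_id[OF us(2,3)] us(4) by (simp add: id_map_comp_id_map)
    then show ?case
      using ts us f tt ideal[of "(ts @ flip ts) @ us"] word_value_append[OF tt us(2)] word_value_append[OF ts(2) f]
        word_value_flip[OF ts(2)] word_value_closed[OF ts(2)]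
      by (intro exI[of _ "(ts @ flip ts) @ us"]) (simp add: r_inv)
  qed
  then show ?thesis using \<X>(4) by simp
qed

lemma word_ideal_constructible:
  "\<lbrakk>ts \<noteq> []; set ts \<subseteq> S \<times> S\<rbrakk> \<Longrightarrow> word_ideal G S ts \<in> constructible_ideals G S"
  unfolding constructible_ideals_def by (auto intro!: exI[of _ "{word_ideal G S ts}"])

lemma V_word_map_hull: "w \<in> lists (V ` S \<times> UNIV) \<Longrightarrow> word_map w \<in> left_hull_set G S"
  by (induction w) (auto simp: word_map_simps id_map_hull letter_map_def
      intro!: left_hull_set.comp left_hull_set.inv left_hull_set.gen)

lemma nword_map_hull: "set ts \<subseteq> S \<times> S \<Longrightarrow> word_map (nword ts) \<in> left_hull_set G S"
  by (intro V_word_map_hull, induction ts) (auto simp: nword_simps)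

text \<open>A letter of a constructible ideal acts like a word in the \<open>V s\<close> by
  \<open>constructible_word\<close>. Only \<open>E {}\<close> can leave the hull, which need not
  contain the empty map.\<close>

lemma word_map_hull: "w \<in> W \<Longrightarrow> word_map w \<in> left_hull_set G S \<or> word_map w = Map.empty"
proof (induction w)
  case Nil
  then show ?case by (simp add: word_map_simps id_map_hull)
next
  case (Cons l w)
  obtain x b where l: "l = (x, b)" by force
  have "letter_map l \<in> left_hull_set G S \<or> letter_map l = Map.empty"
  proof (cases x)
    case (V s)
    then show ?thesis using Cons.prems l by (auto simp: letter_map_def li_generators_def intro: left_hull_set.intros)
  next
    case (E X)
    then have lm: "letter_map l = id_map X" by (simp add: l letter_map_def partial_inverse_id_map)
    have "X \<in> constructible_ideals G S \<or> X = {}" using Cons.prems l E by (auto simp: li_generators_def)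
    then show ?thesis
      unfolding lm using constructible_word[of X] nword_map_hull nword_map_id by (metis id_map_empty)
  qed
  then show ?case using Cons by (auto simp: word_map_simps map_comp_empty intro: left_hull_set.intros)
qed

end

section \<open>The star-homomorphism to the convolution algebra of the hull\<close>

context group_submonoid
begin

abbreviation "Fr \<equiv> free_star_algebra (li_generators G S)"
abbreviation "H \<equiv> left_hull_set G S"
abbreviation "A \<equiv> ell1_algebra (left_hull G S)"

interpretation FM: involutive_monoid "free_star_monoid (li_generators G S)" by (rule free_involutive)
interpretation P: involutive_monoid "left_hull G S" by (rule left_hull_involutive)

text \<open>Linear extension of \<open>word_map\<close>. Words acting outside the hull, necessarily
  by the empty map, are dropped.\<close>

definition Phi :: "(('g li_generator \<times> bool) list \<Rightarrow> complex) \<Rightarrow> ('g \<rightharpoonup> 'g) \<Rightarrow> complex" where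
  "Phi x = push word_map {w \<in> W. word_map w \<in> H} x"

lemma Fr_carrier: "carrier Fr = {x. finite {w. x w \<noteq> 0} \<and> {w. x w \<noteq> 0} \<subseteq> W}"
  by (simp add: FM.finite_algebra_simps free_star_monoid_simps)

lemma Fr_summable: "x \<in> carrier Fr \<Longrightarrow> x abs_summable_on T"
  by (rule abs_summable_finite) (simp add: Fr_carrier)

lemma delta_Fr: "w \<in> W \<Longrightarrow> delta w \<in> carrier Fr"
  by (simp add: Fr_carrier delta_finite)

lemma Phi_delta: "\<lbrakk>w \<in> W; word_map w \<in> H\<rbrakk> \<Longrightarrow> Phi (delta w) = delta (word_map w)"
  by (simp add: Phi_def push_delta)

lemma Phi_delta_0: "word_map w \<notin> H \<Longrightarrow> Phi (delta w) = (\<lambda>_. 0)"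
  unfolding Phi_def push_def by (intro ext infsum_0) (auto simp: delta_def)

lemma Phi_ell1: "x \<in> carrier Fr \<Longrightarrow> Phi x \<in> P.ell1"
  using push_supp[of word_map "{w \<in> W. word_map w \<in> H}" x]
  by (auto simp: Phi_def P.ell1_def left_hull_simps intro!: push_abs_summable(1) Fr_summable)

text \<open>If a factor acts outside the hull, it acts by the empty map and so does the product.
  Hence the dropped words form an ideal of words, and dropping them is multiplicative.\<close>

lemma word_map_append_hull:
  assumes "u \<in> W" "v \<in> W"
  shows "word_map (u @ v) \<in> H \<longleftrightarrow> word_map u \<in> H \<and> word_map v \<in> H"
  using word_map_hull[OF assms(1)] word_map_hull[OF assms(2)]
  unfolding word_map_append[OF assms] by (auto simp: map_comp_empty intro: left_hull_set.comp)

lemma Phi_mult: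
  assumes x: "x \<in> carrier Fr" and y: "y \<in> carrier Fr"
  shows "Phi (x \<otimes>\<^bsub>Fr\<^esub> y) = Phi x \<otimes>\<^bsub>A\<^esub> Phi y"
proof -
  let ?W' = "{w \<in> W. word_map w \<in> H}"
  have t: "tensor x y abs_summable_on (W \<times> W)"
    by (intro tensor_abs_summable(1) Fr_summable x y)
  have "Phi (x \<otimes>\<^bsub>Fr\<^esub> y) = push word_map ?W' (push (\<lambda>(u, v). u @ v) (W \<times> W) (tensor x y))"
    by (simp add: FM.finite_algebra_simps free_star_monoid_simps Phi_def)
  also have "\<dots> = push (\<lambda>(u, v). word_map u \<circ>\<^sub>m word_map v) (?W' \<times> ?W') (tensor x y)"
    unfolding push_push[OF t]
  proof (rule push_cong)
    show "{a \<in> W \<times> W. (case a of (u, v) \<Rightarrow> u @ v) \<in> ?W'} = ?W' \<times> ?W'"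
      using word_map_append_hull by (auto simp del: in_lists_conv_set)
  qed (simp_all add: word_map_append case_prod_unfold mem_Times_iff)
  also have "\<dots> = Phi x \<otimes>\<^bsub>A\<^esub> Phi y"
    unfolding Phi_def P.ell1_algebra_simps
    by (subst P.conv_push) (auto simp: left_hull_simps Fr_summable x y)
  finally show ?thesis .
qed

lemma Phi_star:
  assumes x: "x \<in> carrier Fr"
  shows "Phi (astar Fr x) = astar A (Phi x)"
proof -
  let ?W' = "{w \<in> W. word_map w \<in> H}"
  have t: "(\<lambda>w. cnj (x w)) abs_summable_on T" for T using Fr_summable[OF x, of T] by simp
  have inv: "partial_inverse (word_map w) \<in> H \<longleftrightarrow> word_map w \<in> H" if "w \<in> W" for w
    using partial_inverse_invol[OF word_map_pmaps[OF that]] left_hull_set.inv by metis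
  have "mstar (free_star_monoid (li_generators G S)) = (\<lambda>w. wstar w)"
    by (rule ext) (simp add: free_star_monoid_simps)
  then have "astar Fr x = push wstar W (\<lambda>w. cnj (x w))"
    using FM.star_eq_push[of x] by (simp add: FM.finite_algebra_simps free_star_monoid_simps)
  then have "Phi (astar Fr x) = push (\<lambda>w. word_map (wstar w)) {w \<in> W. wstar w \<in> ?W'} (\<lambda>w. cnj (x w))"
    by (simp add: Phi_def push_push[OF t])
  also have "\<dots> = push (\<lambda>w. partial_inverse (word_map w)) {w \<in> ?W'. word_map w \<in> H} (\<lambda>w. cnj (x w))"
  proof (rule push_cong)
    show "{w \<in> W. wstar w \<in> ?W'} = {w \<in> ?W'. word_map w \<in> H}"
      by (intro Collect_cong) (use word_map_star inv wstar_W in \<open>simp cong: conj_cong\<close>)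
  qed (simp_all add: word_map_star)
  also have "\<dots> = push partial_inverse H (push word_map ?W' (\<lambda>w. cnj (x w)))"
    by (simp add: push_push[OF t])
  also have "\<dots> = astar A (Phi x)"
    unfolding P.ell1_algebra_simps P.star_eq_push by (simp add: left_hull_simps Phi_def cnj_push)
  finally show ?thesis .
qed

lemma Phi_hom: "Phi \<in> star_hom Fr A"
  unfolding star_hom_def mem_Collect_eq
proof (intro conjI ballI allI ring_hom_memI)
  fix x y c assume x: "x \<in> carrier Fr"
  show "Phi x \<in> carrier A" using Phi_ell1[OF x] by (simp add: P.ell1_algebra_simps)
  show "Phi (c \<odot>\<^bsub>Fr\<^esub> x) = c \<odot>\<^bsub>A\<^esub> Phi x"
    by (simp add: FM.finite_algebra_simps P.ell1_algebra_simps Phi_def push_cmult)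
  show "Phi (astar Fr x) = astar A (Phi x)" by (rule Phi_star[OF x])
  assume y: "y \<in> carrier Fr"
  show "Phi (x \<otimes>\<^bsub>Fr\<^esub> y) = Phi x \<otimes>\<^bsub>A\<^esub> Phi y" by (rule Phi_mult[OF x y])
  show "Phi (x \<oplus>\<^bsub>Fr\<^esub> y) = Phi x \<oplus>\<^bsub>A\<^esub> Phi y"
    by (simp add: FM.finite_algebra_simps P.ell1_algebra_simps Phi_def
        push_add[OF Fr_summable[OF x] Fr_summable[OF y]])
next
  show "Phi \<one>\<^bsub>Fr\<^esub> = \<one>\<^bsub>A\<^esub>"
    by (simp add: FM.finite_algebra_simps P.ell1_algebra_simps free_star_monoid_simps Phi_delta
        word_map_simps id_map_hull left_hull_simps)
qed

text \<open>Choosing one word for each element of the hull lifts every finitely supported function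
  exactly, and these functions are dense in the \<ell>1 norm.\<close>

lemma Phi_dense:
  assumes "a \<in> carrier A" "e > 0"
  shows "\<exists>x\<in>carrier Fr. ell1_norm (left_hull G S) (a \<ominus>\<^bsub>A\<^esub> Phi x) < e"
proof -
  have a: "a \<in> P.ell1" using assms by (simp add: P.ell1_algebra_simps)
  obtain g where g: "g \<in> carrier (finite_algebra (left_hull G S))" "ell1_norm (left_hull G S) (\<lambda>r. a r - g r) < e"
    using P.ell1_approx[OF a assms(2)] by blast
  have gH: "finite {r. g r \<noteq> 0}" "{r. g r \<noteq> 0} \<subseteq> H"
    using g(1) by (auto simp: P.finite_algebra_simps left_hull_simps)
  obtain k where k: "\<And>r. r \<in> H \<Longrightarrow> k r \<in> W \<and> word_map (k r) = r" using hull_eq_word_map by metis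
  define x where "x = push k H g"
  have x: "x \<in> carrier Fr"
    using order_trans[OF push_supp[of k H g], of W] push_finite[OF gH(1), of k H] k
    by (auto simp: Fr_carrier x_def simp del: in_lists_conv_set)
  have "Phi x = push (\<lambda>r. word_map (k r)) {r \<in> H. k r \<in> {w \<in> W. word_map w \<in> H}} g"
    unfolding Phi_def x_def by (rule push_push[OF abs_summable_finite[OF gH(1)]])
  also have "\<dots> = push (\<lambda>r. r) H g" by (rule push_cong) (use k in auto)
  also have "\<dots> = g" by (rule push_id[OF gH(2)])
  finally show ?thesis using g(2) x a Phi_ell1[OF x] by (intro bexI[of _ x]) (simp_all add: P.ell1_minus)
qed

lemma Fr_induct [consumes 1, case_names zero add]:
  assumes x: "x \<in> carrier Fr" and zero: "R (\<lambda>w. 0)"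
    and add: "\<And>x c w. \<lbrakk>x \<in> carrier Fr; w \<in> W; R x\<rbrakk> \<Longrightarrow> R (\<lambda>v. x v + c * delta w v)"
  shows "R x"
proof -
  have fin: "finite {w. x w \<noteq> 0}" and sub: "{w. x w \<noteq> 0} \<subseteq> W" using x by (auto simp: Fr_carrier)
  have "R (\<lambda>v. if v \<in> T then x v else 0)" if "finite T" "T \<subseteq> W" for T
    using that
  proof (induction T rule: finite_induct)
    case empty
    then show ?case using zero by simp
  next
    case (insert w T)
    have "(\<lambda>v. if v \<in> T then x v else 0) \<in> carrier Fr"
      using insert by (auto simp: Fr_carrier intro: finite_subset[of _ T])
    from add[OF this, of w "x w"] insert
    have "R (\<lambda>v. (if v \<in> T then x v else 0) + x w * delta w v)" by simp
    also have "(\<lambda>v. (if v \<in> T then x v else 0) + x w * delta w v) = (\<lambda>v. if v \<in> insert w T then x v else 0)"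
      using insert by (auto simp: delta_def)
    finally show ?case .
  qed
  from this[OF fin sub] show ?thesis by (rule back_subst[of R]) auto
qed

lemma E_generator: "X \<in> constructible_ideals G S \<union> {{}} \<Longrightarrow> E X \<in> li_generators G S"
  by (auto simp: li_generators_def)

lemma li_relations_Fr:
  "(x, y) \<in> li_relations G S \<Longrightarrow> x \<in> carrier Fr \<and> y \<in> carrier Fr"
proof (induction rule: li_relations.induct)
  case (word ts)
  then have "E (word_ideal G S ts) \<in> li_generators G S"
    using word_ideal_constructible by (auto simp: li_generators_def)
  then show ?case using delta_Fr[OF nword_W[of ts]] word by (auto simp: nword_def intro!: delta_Fr)
next
  case empty
  have "E {} \<in> li_generators G S" by (simp add: li_generators_def)
  then show ?case by (auto simp: Fr_carrier delta_finite)
qed (simp_all add: delta_Fr V_generator E_generator)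

lemma word_map_nword_relation:
  "\<lbrakk>set ts \<subseteq> S \<times> S; word_value G ts = \<one>\<rbrakk> \<Longrightarrow> word_map (nword ts) = letter_map (E (word_ideal G S ts), False)"
  by (simp add: nword_map_id letter_map_def)

text \<open>All relations between words hold for partial bijections. The relation for
  \<open>E {}\<close> is kept apart, since the empty map need not be zero in the convolution
  algebra.\<close>

lemma word_map_relations:
  assumes "(x, y) \<in> li_relations G S"
  shows "(\<exists>u\<in>W. \<exists>v\<in>W. x = delta u \<and> y = delta v \<and> word_map u = word_map v)
    \<or> x = delta [(E {}, False)] \<and> y = (\<lambda>w. 0)"
  using assms
proof cases
  case (isometry s)
  have "word_map [(V s, True), (V s, False)] = word_map []"
    using isometry partial_inverse_comp_self[OF left_mult_pmaps[of s]]
    by (simp add: word_map_simps letter_map_def id_map_comp left_mult_pmaps)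
      (auto simp: left_mult_def dom_def)
  then show ?thesis using isometry V_generator[of s]
    by (intro disjI1 bexI[of _ "[]"] bexI[of _ "[(V s, True), (V s, False)]"]) auto
next
  case (idempotent X)
  then have E: "E X \<in> li_generators G S" by (simp add: E_generator)
  have "word_map [(E X, False), (E X, False)] = word_map [(E X, False)]"
    using letter_map_pmaps[of "(E X, False)"] E
    by (simp add: word_map_simps id_map_comp) (simp add: letter_map_def id_map_comp_id_map)
  then show ?thesis using idempotent(1,2) E
    by (intro disjI1 bexI[of _ "[(E X, False), (E X, False)]"] bexI[of _ "[(E X, False)]"]) auto
next
  case (selfadjoint X)
  then have E: "E X \<in> li_generators G S" by (simp add: E_generator)
  have "word_map [(E X, True)] = word_map [(E X, False)]"
    by (simp add: word_map_simps letter_map_def partial_inverse_id_map)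
  then show ?thesis using selfadjoint(1,2) E
    by (intro disjI1 bexI[of _ "[(E X, True)]"] bexI[of _ "[(E X, False)]"]) auto
next
  case (mult s t)
  have "left_mult G S (s \<otimes> t) = left_mult G S s \<circ>\<^sub>m left_mult G S t"
    using mult by (intro map_eqI) (auto simp: map_comp_Some_iff left_mult_Some S_G m_assoc)
  then have "word_map [(V (s \<otimes> t), False)] = word_map [(V s, False), (V t, False)]"
    using mult by (simp add: word_map_simps letter_map_def id_map_comp left_mult_pmaps comp_pmaps)
  then show ?thesis using mult
    by (intro disjI1 bexI[of _ "[(V (s \<otimes> t), False)]"] bexI[of _ "[(V s, False), (V t, False)]"])
      (auto simp: V_generator)
next
  case empty
  then show ?thesis by simp
next
  case (word ts)
  have E: "E (word_ideal G S ts) \<in> li_generators G S"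
    using word word_ideal_constructible by (auto simp: li_generators_def)
  have "word_map (nword ts) = word_map [(E (word_ideal G S ts), False)]"
    using word E by (simp add: word_map_letter word_map_nword_relation)
  moreover have "x = delta (nword ts)" using word by (simp add: nword_def)
  ultimately show ?thesis using word(2) E nword_W[OF word(4)]
    by (intro disjI1 bexI[of _ "nword ts"] bexI[of _ "[(E (word_ideal G S ts), False)]"]) simp_all
qed

end

section \<open>Seminorms respecting the relations of Li\<close>

text \<open>The seminorms of which \<open>presented_seminorm\<close> is the supremum. Working with a
  single one keeps the argument independent of the finiteness of that supremum, which is derived
  from it.\<close>

locale li_seminorm = group_submonoid G S for G :: "('g, 'b) monoid_scheme" (structure) and S +
  fixes p :: "(('g li_generator \<times> bool) list \<Rightarrow> complex) \<Rightarrow> real"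
  assumes seminorm: "cstar_seminorm Fr p"
    and relations: "\<And>x y. (x, y) \<in> li_relations G S \<Longrightarrow> p (x \<ominus>\<^bsub>Fr\<^esub> y) = 0"
begin

interpretation FM: involutive_monoid "free_star_monoid (li_generators G S)" by (rule free_involutive)
interpretation P: involutive_monoid "left_hull G S" by (rule left_hull_involutive)
interpretation F: seminormed_star_algebra Fr p
  using FM.finite_algebra_star_algebra seminorm
  by (simp add: seminormed_star_algebra_def seminormed_star_algebra_axioms_def)
interpretation Q: cstar_algebra "completion Fr p" by (rule F.completion_cstar)
interpretation Q: seminormed_star_algebra "completion Fr p" "nrm (completion Fr p)"
  using Q.complex_star_algebra_axioms Q.cstar_norm
  by (simp add: seminormed_star_algebra_def seminormed_star_algebra_axioms_def)

abbreviation "Q \<equiv> completion Fr p"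
abbreviation "\<iota> \<equiv> to_completion Fr p"

text \<open>The image of a word in the Hausdorff completion, where Li's relations become equations
  and the norm is definite.\<close>

definition \<pi> :: "('g li_generator \<times> bool) list \<Rightarrow> (nat \<Rightarrow> ('g li_generator \<times> bool) list \<Rightarrow> complex) set" where
  "\<pi> w = \<iota> (delta w)"

lemma \<pi>_carrier: "w \<in> W \<Longrightarrow> \<pi> w \<in> carrier Q"
  by (simp add: \<pi>_def F.iota_carrier delta_Fr)

lemma iota_ops:
  assumes "x \<in> carrier Fr"
  shows "y \<in> carrier Fr \<Longrightarrow> \<iota> (x \<oplus>\<^bsub>Fr\<^esub> y) = \<iota> x \<oplus>\<^bsub>Q\<^esub> \<iota> y"
    "y \<in> carrier Fr \<Longrightarrow> \<iota> (x \<otimes>\<^bsub>Fr\<^esub> y) = \<iota> x \<otimes>\<^bsub>Q\<^esub> \<iota> y"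
    "\<iota> (c \<odot>\<^bsub>Fr\<^esub> x) = c \<odot>\<^bsub>Q\<^esub> \<iota> x"
    "\<iota> (astar Fr x) = astar Q (\<iota> x)"
    "\<iota> \<one>\<^bsub>Fr\<^esub> = \<one>\<^bsub>Q\<^esub>" "\<iota> \<zero>\<^bsub>Fr\<^esub> = \<zero>\<^bsub>Q\<^esub>"
  using F.cls_ops[OF F.Cauchy_const[OF assms]] by (simp_all add: F.iota_eq F.Cauchy_const)

lemma iota_eqI: "\<lbrakk>x \<in> carrier Fr; y \<in> carrier Fr; p (x \<ominus>\<^bsub>Fr\<^esub> y) = 0\<rbrakk> \<Longrightarrow> \<iota> x = \<iota> y"
  unfolding F.iota_eq by (subst F.cls_eq_iff) (auto simp: F.Cauchy_const)

lemma iota_relation: "(x, y) \<in> li_relations G S \<Longrightarrow> \<iota> x = \<iota> y"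
  using li_relations_Fr relations iota_eqI by blast

lemma \<pi>_append: "\<lbrakk>u \<in> W; v \<in> W\<rbrakk> \<Longrightarrow> \<pi> (u @ v) = \<pi> u \<otimes>\<^bsub>Q\<^esub> \<pi> v"
  using iota_ops(2)[OF delta_Fr delta_Fr, of u v] FM.delta_conv_delta[of u v]
  by (simp add: \<pi>_def FM.finite_algebra_simps free_star_monoid_simps)

lemma \<pi>_star: "w \<in> W \<Longrightarrow> \<pi> (wstar w) = astar Q (\<pi> w)"
  using iota_ops(4)[OF delta_Fr, of w] FM.star_delta[of w]
  by (simp add: \<pi>_def FM.finite_algebra_simps free_star_monoid_simps)

lemma \<pi>_Nil: "\<pi> [] = \<one>\<^bsub>Q\<^esub>"
  using iota_ops(5)[OF F.one_closed] by (simp add: \<pi>_def FM.finite_algebra_simps free_star_monoid_simps)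

lemma VW: "s \<in> S \<Longrightarrow> [(V s, b)] \<in> W" by (simp add: V_generator)

lemma EW: "X \<in> constructible_ideals G S \<union> {{}} \<Longrightarrow> [(E X, b)] \<in> W" by (simp add: E_generator)

lemma \<pi>_isometry: "s \<in> S \<Longrightarrow> astar Q (\<pi> [(V s, False)]) \<otimes>\<^bsub>Q\<^esub> \<pi> [(V s, False)] = \<one>\<^bsub>Q\<^esub>"
  using iota_relation[OF li_relations.isometry[of s]] \<pi>_append[OF VW VW, of s s True False] \<pi>_star[OF VW, of s False]
  by (simp add: \<pi>_def[symmetric] \<pi>_Nil)

lemma \<pi>_idempotent: "X \<in> constructible_ideals G S \<union> {{}} \<Longrightarrow> \<pi> [(E X, False)] \<otimes>\<^bsub>Q\<^esub> \<pi> [(E X, False)] = \<pi> [(E X, False)]"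
  using iota_relation[OF li_relations.idempotent[of X]] \<pi>_append[OF EW EW, of X X False False]
  by (simp add: \<pi>_def[symmetric])

lemma \<pi>_selfadjoint: "X \<in> constructible_ideals G S \<union> {{}} \<Longrightarrow> \<pi> [(E X, True)] = \<pi> [(E X, False)]"
  using iota_relation[OF li_relations.selfadjoint[of X]] by (simp add: \<pi>_def[symmetric])

lemma \<pi>_empty: "\<pi> [(E {}, b)] = \<zero>\<^bsub>Q\<^esub>"
  using iota_relation[OF li_relations.empty] iota_ops(6)[OF F.zero_closed] \<pi>_selfadjoint[of "{}"]
  by (cases b) (simp_all add: \<pi>_def[symmetric] FM.finite_algebra_simps)

lemma \<pi>_nword:
  "\<lbrakk>ts \<noteq> []; set ts \<subseteq> S \<times> S; word_value G ts = \<one>\<rbrakk> \<Longrightarrow> \<pi> (nword ts) = \<pi> [(E (word_ideal G S ts), False)]"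
  using iota_relation[OF li_relations.word[of ts]] by (simp add: \<pi>_def nword_def)

text \<open>Multiplicativity makes the isometry of the unit idempotent, and an idempotent isometry
  is one: \<open>a\<close> equals the adjoint of \<open>a\<close> times \<open>a\<close> times
  \<open>a\<close>, hence the adjoint of \<open>a\<close> times \<open>a\<close>.\<close>

lemma \<pi>_V_one: "\<pi> [(V \<one>, b)] = \<one>\<^bsub>Q\<^esub>"
proof -
  let ?a = "\<pi> [(V \<one>, False)]"
  have a: "?a \<in> carrier Q" by (rule \<pi>_carrier[OF VW[OF S.one_closed]])
  have aa: "?a \<otimes>\<^bsub>Q\<^esub> ?a = ?a"
    using iota_relation[OF li_relations.mult[of \<one> S \<one>]] \<pi>_append[OF VW VW, of \<one> \<one> False False]
    by (simp add: \<pi>_def[symmetric])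
  have i: "astar Q ?a \<otimes>\<^bsub>Q\<^esub> ?a = \<one>\<^bsub>Q\<^esub>" by (rule \<pi>_isometry[OF S.one_closed])
  have "?a = (astar Q ?a \<otimes>\<^bsub>Q\<^esub> ?a) \<otimes>\<^bsub>Q\<^esub> ?a" using a i by simp
  also have "\<dots> = \<one>\<^bsub>Q\<^esub>" unfolding Q.m_assoc[OF Q.star_closed[OF a] a a] aa by (rule i)
  finally have one: "?a = \<one>\<^bsub>Q\<^esub>" .
  then have "astar Q \<one>\<^bsub>Q\<^esub> = \<one>\<^bsub>Q\<^esub>" using i a by (simp add: Q.star_closed)
  then show ?thesis using one \<pi>_star[OF VW[OF S.one_closed], of False] by (cases b) simp_all
qed

text \<open>Normal form simultaneously in the completion and as a partial bijection. The second
  alternative accounts for \<open>E {}\<close>.\<close>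

definition nform :: "('g li_generator \<times> bool) list \<Rightarrow> bool" where
  "nform w \<longleftrightarrow> (\<exists>ts. ts \<noteq> [] \<and> set ts \<subseteq> S \<times> S \<and> \<pi> (nword ts) = \<pi> w \<and> word_map (nword ts) = word_map w)
    \<or> \<pi> w = \<zero>\<^bsub>Q\<^esub> \<and> word_map w = Map.empty"

lemma nformI:
  "\<lbrakk>ts \<noteq> []; set ts \<subseteq> S \<times> S; \<pi> (nword ts) = \<pi> w; word_map (nword ts) = word_map w\<rbrakk> \<Longrightarrow> nform w"
  by (auto simp: nform_def)

lemma nform_append:
  assumes u: "u \<in> W" "nform u" and v: "v \<in> W" "nform v" shows "nform (u @ v)"
  using u(2) v(2) unfolding nform_def
proof (elim disjE exE conjE, goal_cases)
  case (1 ts us)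
  then show ?case
    by (intro disjI1 exI[of _ "ts @ us"])
      (simp add: nword_simps \<pi>_append word_map_append nword_W u v)
qed (simp_all add: \<pi>_append word_map_append u v map_comp_empty \<pi>_carrier)

text \<open>A letter of \<open>V s\<close> is padded to a full block by the trivial letter of
  \<open>V \<one>\<close>, while \<open>E X\<close> is rewritten by the trivial-value word of
  \<open>constructible_word\<close> and the relation \<open>word\<close>.\<close>

lemma nform_letter:
  assumes l: "l \<in> li_generators G S \<times> UNIV" shows "nform [l]"
proof -
  obtain x b where l_eq: "l = (x, b)" by force
  show ?thesis
  proof (cases x)
    case (V s)
    then have s: "s \<in> S" and l': "l = (V s, b)" using l l_eq by (auto simp: li_generators_def)
    have nw: "\<pi> (nword [(t, r)]) = \<pi> [(V t, True)] \<otimes>\<^bsub>Q\<^esub> \<pi> [(V r, False)]"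
      "word_map (nword [(t, r)]) = word_map [(V t, True)] \<circ>\<^sub>m word_map [(V r, False)]"
      if "t \<in> S" "r \<in> S" for t r
      using \<pi>_append[OF VW VW, OF that, of True False] word_map_append[OF VW VW, OF that, of True False]
      by (simp_all add: nword_simps)
    have wm: "word_map [(V \<one>, b)] = id_map S" for b
      by (simp add: word_map_letter V_generator letter_map_def left_mult_one partial_inverse_id_map)
    show ?thesis
    proof (cases b)
      case True
      have "nform [(V s, True)]"
        by (rule nformI[of "[(s, \<one>)]"])
          (use s in \<open>simp_all add: nw \<pi>_V_one wm \<pi>_carrier[OF VW] id_map_comp(2)[OF word_map_pmaps[OF VW]]\<close>)
      then show ?thesis using l' True by simp
    next
      case False
      have "nform [(V s, False)]"
        by (rule nformI[of "[(\<one>, s)]"])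
          (use s in \<open>simp_all add: nw \<pi>_V_one wm \<pi>_carrier[OF VW] id_map_comp(1)[OF word_map_pmaps[OF VW]]\<close>)
      then show ?thesis using l' False by simp
    qed
  next
    case (E X)
    then have l': "l = (E X, b)" and X: "X \<in> constructible_ideals G S \<union> {{}}"
      using l l_eq by (auto simp: li_generators_def)
    have wm: "word_map [l] = id_map X"
      using l l' by (simp add: word_map_letter letter_map_def partial_inverse_id_map)
    have pl: "\<pi> [l] = \<pi> [(E X, False)]" using \<pi>_selfadjoint[OF X] l' by (cases b) simp_all
    show ?thesis
    proof (cases "X = {}")
      case True
      then show ?thesis using pl wm \<pi>_empty by (simp add: nform_def id_map_empty)
    next
      case False
      then obtain ts where "ts \<noteq> []" "set ts \<subseteq> S \<times> S" "word_value G ts = \<one>" "word_ideal G S ts = X"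
        using constructible_word X by blast
      then show ?thesis using pl wm \<pi>_nword nword_map_id by (intro nformI[of ts]) auto
    qed
  qed
qed

lemma nform_W: "w \<in> W \<Longrightarrow> nform w"
proof (induction w)
  case Nil
  \<comment> \<open>Normal forms are nonempty, as in the relation \<open>word\<close>; so the empty
    word is represented by the block of units.\<close>
  have "\<pi> (nword [(\<one>, \<one>)]) = \<pi> [(V \<one>, True)] \<otimes>\<^bsub>Q\<^esub> \<pi> [(V \<one>, False)]"
    using \<pi>_append[OF VW VW, of \<one> \<one> True False] by (simp add: nword_simps)
  moreover have "word_map (nword [(\<one>, \<one>)]) = id_map S"
    by (simp add: nword_simps word_map_simps letter_map_def left_mult_one partial_inverse_id_map id_map_comp_id_map)
  ultimately show ?case by (intro nformI[of "[(\<one>, \<one>)]"]) (simp_all add: \<pi>_V_one \<pi>_Nil word_map_simps)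
next
  case (Cons l w)
  then have "[l] \<in> W" "w \<in> W" "nform [l]" "nform w" by (auto intro!: nform_letter)
  then show ?case using nform_append[of "[l]" w] by simp
qed

lemma norm_definite_mult_star:
  assumes "a \<in> carrier Q" "a \<otimes>\<^bsub>Q\<^esub> astar Q a = \<zero>\<^bsub>Q\<^esub>" shows "a = \<zero>\<^bsub>Q\<^esub>"
proof -
  have "(nrm Q (astar Q a))\<^sup>2 = 0"
    using Q.p_cstar[OF Q.star_closed[OF assms(1)]] assms by (simp add: Q.star_star Q.p_zero)
  then show ?thesis using assms(1) by (intro Q.norm_definite) (simp_all add: Q.p_star)
qed

text \<open>The combined word \<open>ts @ flip us\<close> has trivial value, so the relation
  \<open>word\<close> makes it a projection. Its map is the common bijection composed with its
  inverse, which determines the ideal as the range.\<close>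

lemma \<pi>_nword_star:
  assumes "ts \<noteq> []" "set ts \<subseteq> S \<times> S" "us \<noteq> []" "set us \<subseteq> S \<times> S" and v: "word_value G ts = word_value G us"
    and eq: "word_map (nword ts) = word_map (nword us)"
  shows "\<pi> (nword ts) \<otimes>\<^bsub>Q\<^esub> astar Q (\<pi> (nword us)) = \<pi> [(E (ran (word_map (nword ts))), False)]"
proof -
  have f: "set (flip us) \<subseteq> S \<times> S" using assms by auto
  then have tf: "set (ts @ flip us) \<subseteq> S \<times> S" using assms by auto
  have "word_value G (ts @ flip us) = \<one>"
    using word_value_append[OF assms(2) f] word_value_flip[OF assms(4)] v word_value_closed[OF assms(4)] by (simp add: r_inv)
  then have "\<pi> (nword (ts @ flip us)) = \<pi> [(E (word_ideal G S (ts @ flip us)), False)]"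
    using \<pi>_nword[OF _ tf] assms by simp
  also have "word_ideal G S (ts @ flip us) = ran (word_map (nword ts))"
  proof -
    have "word_map (nword (ts @ flip us)) = word_map (nword ts) \<circ>\<^sub>m partial_inverse (word_map (nword ts))"
      unfolding nword_map_append[OF assms(2) f] nword_map_flip[OF assms(4)] eq ..
    also have "\<dots> = id_map (ran (word_map (nword ts)))"
      by (rule comp_partial_inverse[OF word_map_pmaps[OF nword_W[OF assms(2)]]])
    finally show ?thesis using ran_nword_map[OF tf] by (auto simp: ran_def id_map_Some)
  qed
  finally show ?thesis
    using \<pi>_append[OF nword_W[OF assms(2)] nword_W[OF f]] \<pi>_star[OF nword_W[OF assms(4)]]
    by (simp add: nword_simps wstar_nword)
qed

lemma \<pi>_nword_empty:
  assumes "ts \<noteq> []" "set ts \<subseteq> S \<times> S" "word_map (nword ts) = Map.empty"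
  shows "\<pi> (nword ts) = \<zero>\<^bsub>Q\<^esub>"
proof (rule norm_definite_mult_star[OF \<pi>_carrier[OF nword_W[OF assms(2)]]])
  show "\<pi> (nword ts) \<otimes>\<^bsub>Q\<^esub> astar Q (\<pi> (nword ts)) = \<zero>\<^bsub>Q\<^esub>"
    unfolding \<pi>_nword_star[OF assms(1,2,1,2) refl refl] assms(3) ran_empty by (rule \<pi>_empty)
qed

lemma \<pi>_nword_eq:
  assumes ts: "ts \<noteq> []" "set ts \<subseteq> S \<times> S" and us: "us \<noteq> []" "set us \<subseteq> S \<times> S"
    and eq: "word_map (nword ts) = word_map (nword us)"
  shows "\<pi> (nword ts) = \<pi> (nword us)"
proof (cases "word_map (nword ts) = Map.empty")
  case True
  then show ?thesis using \<pi>_nword_empty ts us eq by simp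
next
  case False
  \<comment> \<open>A single point of the domain recovers the group value: both words send
    \<open>x\<close> to \<open>y\<close>, and \<open>x\<close> cancels in \<open>G\<close>.\<close>
  then obtain x y where xy: "word_map (nword ts) x = Some y" by (metis option.exhaust)
  have x: "x \<in> carrier G"
    by (rule S_G[OF pmapsD(2)[OF word_map_pmaps[OF nword_W[OF ts(2)]] xy]])
  have "word_value G ts \<otimes> x = word_value G us \<otimes> x"
    using nword_map_value[OF ts(2) xy] nword_map_value[OF us(2), of x y] xy eq by simp
  then have v: "word_value G ts = word_value G us" using x word_value_closed ts us by simp
  let ?a = "\<pi> (nword ts)" and ?b = "\<pi> (nword us)" and ?e = "\<pi> [(E (ran (word_map (nword ts))), False)]"
  have c: "?a \<in> carrier Q" "?b \<in> carrier Q" using \<pi>_carrier nword_W ts us by auto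
  \<comment> \<open>Equal values and equal maps make all four products the same projection, so the
    expansion of the difference times its adjoint cancels.\<close>
  have e: "?a \<otimes>\<^bsub>Q\<^esub> astar Q ?a = ?e" "?a \<otimes>\<^bsub>Q\<^esub> astar Q ?b = ?e"
    "?b \<otimes>\<^bsub>Q\<^esub> astar Q ?a = ?e" "?b \<otimes>\<^bsub>Q\<^esub> astar Q ?b = ?e"
    by (rule \<pi>_nword_star[OF ts ts refl refl], rule \<pi>_nword_star[OF ts us v eq],
      rule \<pi>_nword_star[OF us ts v[symmetric] eq[symmetric], folded eq],
      rule \<pi>_nword_star[OF us us refl refl, folded eq])
  have ec: "?e \<in> carrier Q" using e(1) c Q.m_closed Q.star_closed by metis
  have sc: "astar Q ?a \<in> carrier Q" "astar Q ?b \<in> carrier Q" using c Q.star_closed by auto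
  have "(?a \<ominus>\<^bsub>Q\<^esub> ?b) \<otimes>\<^bsub>Q\<^esub> astar Q (?a \<ominus>\<^bsub>Q\<^esub> ?b)
    = (?a \<otimes>\<^bsub>Q\<^esub> astar Q ?a \<ominus>\<^bsub>Q\<^esub> ?a \<otimes>\<^bsub>Q\<^esub> astar Q ?b) \<ominus>\<^bsub>Q\<^esub> (?b \<otimes>\<^bsub>Q\<^esub> astar Q ?a \<ominus>\<^bsub>Q\<^esub> ?b \<otimes>\<^bsub>Q\<^esub> astar Q ?b)"
    unfolding Q.star_minus[OF c] using c sc by algebra
  also have "\<dots> = \<zero>\<^bsub>Q\<^esub>" unfolding e using ec by algebra
  finally have "?a \<ominus>\<^bsub>Q\<^esub> ?b = \<zero>\<^bsub>Q\<^esub>" by (rule norm_definite_mult_star[OF Q.minus_closed[OF c]])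
  moreover have "?a = (?a \<ominus>\<^bsub>Q\<^esub> ?b) \<oplus>\<^bsub>Q\<^esub> ?b" using c by algebra
  ultimately show ?thesis using c by simp
qed

lemma \<pi>_word_map_empty:
  assumes "w \<in> W" "word_map w = Map.empty" shows "\<pi> w = \<zero>\<^bsub>Q\<^esub>"
  using nform_W[OF assms(1)] unfolding nform_def
proof (elim disjE exE conjE)
  fix ts assume ts: "ts \<noteq> []" "set ts \<subseteq> S \<times> S" "\<pi> (nword ts) = \<pi> w" "word_map (nword ts) = word_map w"
  show ?thesis using \<pi>_nword_empty[OF ts(1,2)] ts(3,4) assms(2) by simp
qed

theorem \<pi>_word_map:
  assumes "u \<in> W" "v \<in> W" "word_map u = word_map v" shows "\<pi> u = \<pi> v"
proof (cases "word_map u = Map.empty")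
  case True
  then show ?thesis using \<pi>_word_map_empty assms by metis
next
  case False
  obtain ts where ts: "ts \<noteq> []" "set ts \<subseteq> S \<times> S" "\<pi> (nword ts) = \<pi> u" "word_map (nword ts) = word_map u"
    using nform_W[OF assms(1)] False unfolding nform_def by blast
  obtain us where us: "us \<noteq> []" "set us \<subseteq> S \<times> S" "\<pi> (nword us) = \<pi> v" "word_map (nword us) = word_map v"
    using nform_W[OF assms(2)] False assms(3) unfolding nform_def by auto
  show ?thesis using \<pi>_nword_eq[OF ts(1,2) us(1,2)] ts(3,4) us(3,4) assms(3) by simp
qed

section \<open>Comparison with the \<ell>1 norm\<close>

lemma nrm_one: "nrm Q \<one>\<^bsub>Q\<^esub> \<le> 1"
proof -
  have "nrm Q (astar Q \<one>\<^bsub>Q\<^esub>) = (nrm Q \<one>\<^bsub>Q\<^esub>)\<^sup>2" using Q.p_cstar[of "\<one>\<^bsub>Q\<^esub>"] by (simp add: Q.star_closed)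
  then have "nrm Q \<one>\<^bsub>Q\<^esub> = (nrm Q \<one>\<^bsub>Q\<^esub>)\<^sup>2" by (simp add: Q.p_star)
  \<comment> \<open>The norm of the unit equals its own square, so it is 0 or 1; the value 0 occurs
    for the zero seminorm.\<close>
  then show ?thesis by (cases "nrm Q \<one>\<^bsub>Q\<^esub> = 0") (simp_all add: power2_eq_square)
qed

lemma p_delta: "w \<in> W \<Longrightarrow> p (delta w) = nrm Q (\<pi> w)"
  by (simp add: \<pi>_def F.nrm_iota delta_Fr)

text \<open>By the C*-identity, the square of the norm is the norm of the unit for an isometry and
  the norm itself for a projection. Adjoints have the same norm.\<close>

lemma nrm_letter: assumes l: "l \<in> li_generators G S \<times> UNIV" shows "nrm Q (\<pi> [l]) \<le> 1"
proof -
  obtain x b where lx: "l = (x, b)" by force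
  have xW: "[(x, False)] \<in> W" using l lx by auto
  have "nrm Q (\<pi> [(x, False)]) \<le> 1"
  proof (cases x)
    case (V s)
    then have s: "s \<in> S" using l lx by (auto simp: li_generators_def)
    have "(nrm Q (\<pi> [(x, False)]))\<^sup>2 \<le> 1"
      using Q.p_cstar[OF \<pi>_carrier[OF xW]] \<pi>_isometry[OF s] nrm_one V by simp
    then show ?thesis using power2_le_imp_le[of "nrm Q (\<pi> [(x, False)])" 1] by simp
  next
    case (E X)
    then have X: "X \<in> constructible_ideals G S \<union> {{}}" using l lx by (auto simp: li_generators_def)
    have "astar Q (\<pi> [(x, False)]) = \<pi> [(x, False)]"
      using \<pi>_star[OF xW] \<pi>_selfadjoint[OF X] E by simp
    then have "nrm Q (\<pi> [(x, False)]) = (nrm Q (\<pi> [(x, False)]))\<^sup>2"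
      using Q.p_cstar[OF \<pi>_carrier[OF xW]] \<pi>_idempotent[OF X] E by simp
    then show ?thesis by (cases "nrm Q (\<pi> [(x, False)]) = 0") (simp_all add: power2_eq_square)
  qed
  moreover have "nrm Q (\<pi> [(x, True)]) = nrm Q (\<pi> [(x, False)])"
    using \<pi>_star[OF xW] Q.p_star[OF \<pi>_carrier[OF xW]] by simp
  ultimately show ?thesis using lx by (cases b) simp_all
qed

lemma nrm_\<pi>: "w \<in> W \<Longrightarrow> nrm Q (\<pi> w) \<le> 1"
proof (induction w)
  case Nil
  then show ?case using nrm_one by (simp add: \<pi>_Nil)
next
  case (Cons l w)
  then have l: "[l] \<in> W" "l \<in> li_generators G S \<times> UNIV" and w: "w \<in> W" by auto
  have "nrm Q (\<pi> (l # w)) \<le> nrm Q (\<pi> [l]) * nrm Q (\<pi> w)"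
    using \<pi>_append[OF l(1) w] Q.p_mult[OF \<pi>_carrier[OF l(1)] \<pi>_carrier[OF w]] by simp
  also have "\<dots> \<le> 1 * 1"
    using Cons.IH w nrm_letter[OF l(2)] by (intro mult_mono) (auto simp: Q.p_nonneg \<pi>_carrier)
  finally show ?case by simp
qed

lemma p_sum_delta:
  assumes "finite T" "T \<subseteq> W"
  shows "(\<lambda>v. \<Sum>w\<in>T. c w * delta w v) \<in> carrier Fr \<and>
    p (\<lambda>v. \<Sum>w\<in>T. c w * delta w v) \<le> (\<Sum>w\<in>T. cmod (c w) * p (delta w))"
  using assms
proof (induction T rule: finite_induct)
  case empty
  show ?case using F.p_zero F.zero_closed by (simp add: FM.finite_algebra_simps)
next
  case (insert w T)
  let ?y = "\<lambda>v. \<Sum>w\<in>T. c w * delta w v"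
  have y: "?y \<in> carrier Fr" and IH: "p ?y \<le> (\<Sum>w\<in>T. cmod (c w) * p (delta w))" using insert by auto
  have d: "delta w \<in> carrier Fr" using insert by (simp add: delta_Fr)
  have cd: "c w \<odot>\<^bsub>Fr\<^esub> delta w \<in> carrier Fr" by (rule F.smult_closed[OF d])
  have eq: "(\<lambda>v. \<Sum>w\<in>insert w T. c w * delta w v) = (c w \<odot>\<^bsub>Fr\<^esub> delta w) \<oplus>\<^bsub>Fr\<^esub> ?y"
    using insert by (simp add: FM.finite_algebra_simps)
  show ?case
    unfolding eq using F.add.m_closed[OF cd y] F.p_add[OF cd y] F.p_smult[OF d, of "c w"] IH insert by simp
qed

text \<open>Replacing each word by another one with the same image in the completion does not change
  the class of a linear combination.\<close>

lemma iota_push: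
  assumes k: "\<And>w. w \<in> W \<Longrightarrow> k w \<in> W \<and> \<pi> (k w) = \<pi> w" and x: "x \<in> carrier Fr"
  shows "push k W x \<in> carrier Fr \<and> \<iota> (push k W x) = \<iota> x"
  using x
proof (induction rule: Fr_induct)
  case zero
  have "push k W (\<lambda>_. 0) = (\<lambda>_. 0)" by (simp add: push_def)
  then show ?case using F.zero_closed by (simp add: FM.finite_algebra_simps)
next
  case (add x c w)
  let ?y = "push k W x"
  have y: "?y \<in> carrier Fr" "\<iota> ?y = \<iota> x" using add by auto
  have d: "delta w \<in> carrier Fr" "delta (k w) \<in> carrier Fr" using add k delta_Fr by auto
  have x': "(\<lambda>v. x v + c * delta w v) = x \<oplus>\<^bsub>Fr\<^esub> c \<odot>\<^bsub>Fr\<^esub> delta w" by (simp add: FM.finite_algebra_simps)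
  have sm: "(\<lambda>v. c * delta w v) abs_summable_on W"
    using Fr_summable[OF F.smult_closed[OF d(1), of c]] by (simp add: FM.finite_algebra_simps)
  have "push k W (\<lambda>v. x v + c * delta w v) = ?y \<oplus>\<^bsub>Fr\<^esub> c \<odot>\<^bsub>Fr\<^esub> delta (k w)"
    unfolding push_add[OF Fr_summable[OF add(1)] sm] push_cmult push_delta[OF add(2)]
    by (simp add: FM.finite_algebra_simps)
  then show ?case
    unfolding x' using add y d k[OF add(2)]
    by (simp add: iota_ops F.smult_closed \<pi>_def)
qed

text \<open>By \<open>\<pi>_word_map\<close>, \<open>x\<close> may be replaced by a combination
  \<open>y\<close> that uses one chosen word per partial bijection. The coefficients of
  \<open>y\<close> over the hull are then those of \<open>Phi x\<close>, and the triangle inequality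
  with words of norm at most 1 yields the \<ell>1 norm.\<close>

theorem p_le_ell1_norm:
  assumes x: "x \<in> carrier Fr" shows "p x \<le> ell1_norm (left_hull G S) (Phi x)"
proof -
  have "\<forall>f. \<exists>w. f \<in> word_map ` W \<longrightarrow> w \<in> W \<and> word_map w = f" by auto
  then obtain r where r: "\<And>f. f \<in> word_map ` W \<Longrightarrow> r f \<in> W \<and> word_map (r f) = f" by metis
  define k where "k w = r (word_map w)" for w
  have k: "k w \<in> W" "word_map (k w) = word_map w" if "w \<in> W" for w using r that by (auto simp: k_def)
  define y where "y = push k W x"
  have "k w \<in> W \<and> \<pi> (k w) = \<pi> w" if "w \<in> W" for w
    using k(1)[OF that] \<pi>_word_map[OF k(1)[OF that] that k(2)[OF that]] by blast
  then have y: "y \<in> carrier Fr" "\<iota> y = \<iota> x"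
    using iota_push[OF _ x, of k] unfolding y_def by blast+
  define T where "T = {w. y w \<noteq> 0}"
  have T: "finite T" "T \<subseteq> W" using y by (auto simp: T_def Fr_carrier)
  \<comment> \<open>Words in the support of \<open>y\<close> are chosen representatives, and these
    are fixed by \<open>k\<close>; so \<open>word_map\<close> is injective on the support.\<close>
  have Tk: "k w = w" if "w \<in> T" for w
  proof -
    obtain a where a: "a \<in> W" "w = k a"
      using subsetD[OF push_supp[of k W x], of w] \<open>w \<in> T\<close> unfolding T_def y_def by blast
    then show ?thesis using k(2)[OF a(1)] by (simp add: k_def)
  qed
  have inj: "inj_on word_map T"
    using Tk by (intro inj_onI) (metis k_def)
  \<comment> \<open>Both coefficients sum \<open>x\<close> over the words acting in the same way as
    \<open>w\<close>.\<close>
  have yP: "y w = Phi x (word_map w)" if w: "w \<in> T" "word_map w \<in> H" for w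
  proof -
    have "{a \<in> W. k a = w} = {a \<in> {w \<in> W. word_map w \<in> H}. word_map a = word_map w}"
    proof (rule Collect_cong)
      fix a
      have "k a = w \<longleftrightarrow> word_map a = word_map w" if "a \<in> W"
        using k[OF that] Tk[OF w(1)] by (metis k_def)
      then show "a \<in> W \<and> k a = w \<longleftrightarrow> a \<in> {w \<in> W. word_map w \<in> H} \<and> word_map a = word_map w"
        using w(2) by (simp cong: conj_cong) metis
    qed
    then show ?thesis by (simp add: y_def Phi_def push_def)
  qed
  have "p x = p y" using y x F.nrm_iota by metis
  also have "y = (\<lambda>v. \<Sum>w\<in>T. y w * delta w v)"
    using T by (auto simp: delta_def fun_eq_iff if_distrib T_def sum.If_cases cong: if_cong)
  also have "p \<dots> \<le> (\<Sum>w\<in>T. cmod (y w) * p (delta w))" using p_sum_delta[OF T] by blast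
  also have "\<dots> \<le> (\<Sum>w\<in>{w \<in> T. word_map w \<in> H}. cmod (Phi x (word_map w)))"
  proof -
    \<comment> \<open>A word acting outside the hull acts by the empty map, so it vanishes in the
      completion and contributes nothing.\<close>
    have "(\<Sum>w\<in>T. cmod (y w) * p (delta w)) = (\<Sum>w\<in>{w \<in> T. word_map w \<in> H}. cmod (y w) * p (delta w))"
    proof (rule sum.mono_neutral_right[OF T(1)])
      show "\<forall>w\<in>T - {w \<in> T. word_map w \<in> H}. cmod (y w) * p (delta w) = 0"
      proof
        fix w assume "w \<in> T - {w \<in> T. word_map w \<in> H}"
        then have w: "w \<in> W" "word_map w \<notin> H" using T(2) by blast+
        then have "\<pi> w = \<zero>\<^bsub>Q\<^esub>" using word_map_hull[OF w(1)] \<pi>_word_map_empty[OF w(1)] by blast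
        then show "cmod (y w) * p (delta w) = 0" by (simp add: p_delta[OF w(1)] Q.p_zero)
      qed
    qed auto
    also have "\<dots> \<le> (\<Sum>w\<in>{w \<in> T. word_map w \<in> H}. cmod (Phi x (word_map w)))"
    proof (rule sum_mono)
      fix w assume w: "w \<in> {w \<in> T. word_map w \<in> H}"
      then have "w \<in> W" using T(2) by blast
      then have "p (delta w) \<le> 1" using nrm_\<pi>[of w] p_delta[of w] by simp
      then show "cmod (y w) * p (delta w) \<le> cmod (Phi x (word_map w))"
        using w yP[of w] mult_left_mono[of "p (delta w)" 1 "cmod (y w)"] by simp
    qed
    finally show ?thesis .
  qed
  also have "\<dots> = (\<Sum>f\<in>word_map ` {w \<in> T. word_map w \<in> H}. cmod (Phi x f))"
    by (rule sum.reindex[symmetric, unfolded comp_def], rule inj_on_subset[OF inj]) auto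
  also have "\<dots> \<le> ell1_norm (left_hull G S) (Phi x)"
    unfolding ell1_norm_def left_hull_simps
    by (rule finite_sum_le_infsum) (use T P.ell1D(1)[OF Phi_ell1[OF x]] in \<open>auto simp: left_hull_simps\<close>)
  finally show ?thesis .
qed

end

section \<open>The full $C^*$-algebra and the ideal of the empty map\<close>

lemma cstar_seminorm_zero: "cstar_seminorm A (\<lambda>_. 0)"
  by (simp add: cstar_seminorm_def)

text \<open>Formulated for maps that may fail to preserve the unit, so that it applies to
  \<open>cut_off\<close>.\<close>

lemma cstar_seminorm_comp:
  assumes F: "complex_star_algebra F" and A: "seminormed_star_algebra A q"
    and g: "\<And>x. x \<in> carrier F \<Longrightarrow> g x \<in> carrier A"
      "\<And>x y. \<lbrakk>x \<in> carrier F; y \<in> carrier F\<rbrakk> \<Longrightarrow> g (x \<oplus>\<^bsub>F\<^esub> y) = g x \<oplus>\<^bsub>A\<^esub> g y"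
      "\<And>x c. x \<in> carrier F \<Longrightarrow> g (c \<odot>\<^bsub>F\<^esub> x) = c \<odot>\<^bsub>A\<^esub> g x"
      "\<And>x. x \<in> carrier F \<Longrightarrow> g (astar F x) = astar A (g x)"
      "\<And>x y. \<lbrakk>x \<in> carrier F; y \<in> carrier F\<rbrakk> \<Longrightarrow> g (x \<otimes>\<^bsub>F\<^esub> y) = g x \<otimes>\<^bsub>A\<^esub> g y"
  shows "cstar_seminorm F (\<lambda>x. q (g x))"
proof -
  interpret F: complex_star_algebra F by (rule F)
  interpret A: seminormed_star_algebra A q by (rule A)
  show ?thesis
    by (simp add: cstar_seminorm_def g F.star_closed A.p_nonneg A.p_smult A.p_add A.p_mult A.p_cstar)
qed

section \<open>The full seminorm, and the ideal generated by an absorbing element\<close>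

context involutive_monoid
begin

interpretation A: complex_star_algebra "ell1_algebra P" by (rule ell1_algebra_star_algebra)

lemma ell1_star_normed: "star_normed_algebra (ell1_algebra P) (ell1_norm P)"
  by unfold_locales
    (simp_all add: ell1_algebra_simps ell1_norm_nonneg ell1_norm_smult ell1_norm_add ell1_norm_conv ell1_norm_star)

abbreviation (input) "bounded_seminorms \<equiv> {p. cstar_seminorm (ell1_algebra P) p \<and>
     (\<forall>f\<in>carrier (ell1_algebra P). p f \<le> ell1_norm P f)}"

text \<open>The \<ell>1 bound keeps the supremum finite, and the zero seminorm makes the family
  nonempty.\<close>

lemma
  shows full_seminormed: "seminormed_star_algebra (ell1_algebra P) (full_seminorm P)"
    and full_seminorm_le: "f \<in> ell1 \<Longrightarrow> full_seminorm P f \<le> ell1_norm P f"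
    and full_seminorm_upper: "\<lbrakk>cstar_seminorm (ell1_algebra P) p;
      \<And>f. f \<in> ell1 \<Longrightarrow> p f \<le> ell1_norm P f; f \<in> ell1\<rbrakk> \<Longrightarrow> p f \<le> full_seminorm P f"
proof -
  have ne: "(\<lambda>_. 0) \<in> bounded_seminorms" by (simp add: cstar_seminorm_zero ell1_norm_nonneg)
  have bdd: "bdd_above ((\<lambda>p. p f) ` bounded_seminorms)" if "f \<in> carrier (ell1_algebra P)" for f
    using that by (intro bdd_aboveI2[of _ _ "ell1_norm P f"]) auto
  note sup = A.cstar_seminorm_sup[of bounded_seminorms, OF _ _ bdd]
  show "seminormed_star_algebra (ell1_algebra P) (full_seminorm P)"
    unfolding full_seminorm_def using sup(1) ne
    by (intro seminormed_star_algebra.intro seminormed_star_algebra_axioms.intro A.complex_star_algebra_axioms) blast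
  show "full_seminorm P f \<le> ell1_norm P f" if "f \<in> ell1"
    unfolding full_seminorm_def sup_seminorm_def
    using ne that by (intro cSUP_least) (auto simp: ell1_algebra_simps)
  show "p f \<le> full_seminorm P f"
    if "cstar_seminorm (ell1_algebra P) p" "\<And>f. f \<in> ell1 \<Longrightarrow> p f \<le> ell1_norm P f" "f \<in> ell1"
    unfolding full_seminorm_def using ne that
    by (intro sup(2)) (auto simp: ell1_algebra_simps)
qed

text \<open>The augmentation character: the scalar by which \<open>f\<close> acts on the point mass
  at an absorbing element.\<close>

definition aug :: "('a \<Rightarrow> complex) \<Rightarrow> complex" where
  "aug f = (\<Sum>\<^sub>\<infinity>r\<in>carrier P. f r)"

lemma delta_zero_mult:
  assumes z: "z \<in> carrier P" and zl: "\<And>t. t \<in> carrier P \<Longrightarrow> z \<otimes> t = z" and zr: "\<And>t. t \<in> carrier P \<Longrightarrow> t \<otimes> z = z"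
    and f: "f \<in> ell1"
  shows "delta z \<otimes>\<^bsub>ell1_algebra P\<^esub> f = aug f \<odot>\<^bsub>ell1_algebra P\<^esub> delta z"
    and "f \<otimes>\<^bsub>ell1_algebra P\<^esub> delta z = aug f \<odot>\<^bsub>ell1_algebra P\<^esub> delta z"
proof -
  have p: "push (\<lambda>_. z) (carrier P) f = (\<lambda>r. aug f * delta z r)"
    by (rule ext) (auto simp: push_def aug_def delta_def)
  have "push (\<lambda>t. z \<otimes> t) (carrier P) f = push (\<lambda>_. z) (carrier P) f"
    "push (\<lambda>t. t \<otimes> z) (carrier P) f = push (\<lambda>_. z) (carrier P) f"
    using zl zr by (auto intro: push_cong)
  then show "delta z \<otimes>\<^bsub>ell1_algebra P\<^esub> f = aug f \<odot>\<^bsub>ell1_algebra P\<^esub> delta z"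
    "f \<otimes>\<^bsub>ell1_algebra P\<^esub> delta z = aug f \<odot>\<^bsub>ell1_algebra P\<^esub> delta z"
    using conv_delta[OF z f] p by (simp_all add: ell1_algebra_simps)
qed

lemma aug_diff: "\<lbrakk>f \<in> ell1; g \<in> ell1\<rbrakk> \<Longrightarrow> aug (f \<ominus>\<^bsub>ell1_algebra P\<^esub> g) = aug f - aug g"
  using infsum_add[OF abs_summable_summable[OF ell1D(1)] abs_summable_summable[OF ell1D(1)], of f "\<lambda>r. - 1 * g r"]
    ell1_smult[of g "-1"]
  by (simp add: aug_def ell1_minus infsum_uminus)

text \<open>Already in the \<ell>1 algebra, multiplying \<open>delta z\<close> by \<open>f\<close>
  gives the multiple \<open>aug f\<close>. These scalars converge along Cauchy sequences, so in the
  completion the ideal generated by \<open>delta z\<close> is still its complex span.\<close>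

lemma zero_ideal_eq:
  assumes z: "z \<in> carrier P" and zl: "\<And>t. t \<in> carrier P \<Longrightarrow> z \<otimes> t = z" and zr: "\<And>t. t \<in> carrier P \<Longrightarrow> t \<otimes> z = z"
  shows "{c \<odot>\<^bsub>full_cstar P\<^esub> full_gen P z | c. True}
    = (\<lambda>U. full_gen P z \<otimes>\<^bsub>full_cstar P\<^esub> U) ` carrier (full_cstar P)"
proof -
  interpret A: seminormed_star_algebra "ell1_algebra P" "full_seminorm P" by (rule full_seminormed)
  interpret C: cstar_algebra "full_cstar P" unfolding full_cstar_def by (rule A.completion_cstar)
  let ?A = "ell1_algebra P" and ?q = "full_seminorm P" and ?C = "full_cstar P" and ?g = "full_gen P z"
  define cl where "cl X = null_sequences ?A ?q +>\<^bsub>Cauchy_algebra ?A ?q\<^esub> X" for X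
  note ops = A.cls_ops[folded cl_def full_cstar_def]
  have gc: "?g = cl (\<lambda>n. delta z)" by (simp add: full_gen_def A.iota_eq cl_def)
  have d: "delta z \<in> carrier ?A" by (simp add: ell1_algebra_simps ell1_delta z)
  have gC: "?g \<in> carrier ?C" unfolding full_gen_def full_cstar_def by (rule A.iota_carrier[OF d])
  have dm: "delta z \<otimes>\<^bsub>?A\<^esub> f = aug f \<odot>\<^bsub>?A\<^esub> delta z" if "f \<in> carrier ?A" for f
    using delta_zero_mult(1)[OF z zl zr, of f] that by (simp add: ell1_algebra_simps)
  have gg: "?g \<otimes>\<^bsub>?C\<^esub> ?g = ?g"
    unfolding gc ops(2)[OF A.Cauchy_const[OF d] A.Cauchy_const[OF d]]
    using delta_conv_delta[OF z z] zl[OF z] by (simp add: ell1_algebra_simps)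
  have "\<exists>c. ?g \<otimes>\<^bsub>?C\<^esub> U = c \<odot>\<^bsub>?C\<^esub> ?g" if U: "U \<in> carrier ?C" for U
  proof (cases "?q (delta z) = 0")
    case True
    then have "nrm ?C ?g = 0" unfolding full_gen_def full_cstar_def A.nrm_iota[OF d] .
    then have "?g = \<zero>\<^bsub>?C\<^esub>" using gC by (intro C.norm_definite)
    then show ?thesis using U C.smult_0_left[OF C.zero_closed] by (intro exI[of _ 0]) simp
  next
    case False
    then have pos: "?q (delta z) > 0" using A.p_nonneg[OF d] by simp
    obtain X where X: "Cauchy_for ?A ?q X" and UX: "U = cl X"
      using iffD1[OF A.cls_carrier[folded cl_def full_cstar_def] U] by blast
    have Xn: "X n \<in> carrier ?A" "X n \<in> ell1" for n
      using A.Cauchy_carr[OF X] by (simp_all add: ell1_algebra_simps)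
    \<comment> \<open>Multiplying \<open>f\<close> by \<open>delta z\<close> scales
      \<open>q (delta z)\<close> by \<open>cmod (aug f)\<close>. Submultiplicativity and division by
      the positive \<open>q (delta z)\<close> then bound \<open>aug\<close> by the full
      seminorm.\<close>
    have le: "cmod (aug f) \<le> ?q f" if f: "f \<in> carrier ?A" for f
    proof -
      have "cmod (aug f) * ?q (delta z) \<le> ?q f * ?q (delta z)"
        using A.p_mult[OF d f] unfolding dm[OF f] A.p_smult[OF d] by (simp add: mult.commute)
      then show ?thesis using pos by simp
    qed
    have "Cauchy (\<lambda>n. aug (X n))"
    proof (rule metric_CauchyI)
      fix e :: real assume "e > 0"
      then obtain N where N: "\<And>m n. m \<ge> N \<Longrightarrow> n \<ge> N \<Longrightarrow> ?q (X m \<ominus>\<^bsub>?A\<^esub> X n) < e"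
        using X unfolding Cauchy_for_def by meson
      have "dist (aug (X m)) (aug (X n)) < e" if "m \<ge> N" "n \<ge> N" for m n
        using le[OF A.minus_closed[OF Xn(1) Xn(1)], of m n] N[OF that] aug_diff[OF Xn(2) Xn(2), of m n]
        by (simp add: dist_norm)
      then show "\<exists>N. \<forall>m\<ge>N. \<forall>n\<ge>N. dist (aug (X m)) (aug (X n)) < e" by blast
    qed
    then obtain c where c: "(\<lambda>n. aug (X n)) \<longlonglongrightarrow> c" by (auto simp: Cauchy_convergent_iff convergent_def)
    have "cl (\<lambda>n. delta z \<otimes>\<^bsub>?A\<^esub> X n) = cl (\<lambda>n. c \<odot>\<^bsub>?A\<^esub> delta z)"
      unfolding cl_def
    proof (subst A.cls_eq_iff[OF A.Cauchy_mult[OF A.Cauchy_const[OF d] X] A.Cauchy_const[OF A.smult_closed[OF d]]])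
      have "?q (delta z \<otimes>\<^bsub>?A\<^esub> X n \<ominus>\<^bsub>?A\<^esub> c \<odot>\<^bsub>?A\<^esub> delta z) = cmod (aug (X n) - c) * ?q (delta z)" for n
      proof -
        have "delta z \<otimes>\<^bsub>?A\<^esub> X n \<ominus>\<^bsub>?A\<^esub> c \<odot>\<^bsub>?A\<^esub> delta z = (aug (X n) - c) \<odot>\<^bsub>?A\<^esub> delta z"
          unfolding dm[OF Xn(1)] ell1_algebra_simps(6)
          using ell1_minus[OF ell1_smult[OF ell1_delta[OF z]] ell1_smult[OF ell1_delta[OF z]], of "aug (X n)" c]
          by (simp add: left_diff_distrib)
        then show ?thesis by (simp add: A.p_smult[OF d])
      qed
      then show "(\<lambda>n. ?q (delta z \<otimes>\<^bsub>?A\<^esub> X n \<ominus>\<^bsub>?A\<^esub> c \<odot>\<^bsub>?A\<^esub> delta z)) \<longlonglongrightarrow> 0"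
        using tendsto_mult_left_zero[OF tendsto_norm_zero[OF LIM_zero[OF c]], of "?q (delta z)"] by simp
    qed
    then show ?thesis
      unfolding UX gc using ops(2)[OF A.Cauchy_const[OF d] X] ops(3)[OF A.Cauchy_const[OF d]] by auto
  qed
  moreover have "c \<odot>\<^bsub>?C\<^esub> ?g = ?g \<otimes>\<^bsub>?C\<^esub> (c \<odot>\<^bsub>?C\<^esub> ?g)" for c
    using C.smult_mult_right[OF gC gC, of c] gg by simp
  ultimately show ?thesis using C.smult_closed[OF gC] by (auto simp: image_iff) metis+
qed

end

section \<open>The universal seminorm as the cut-down full seminorm, and the isomorphism\<close>

context group_submonoid
begin

interpretation FM: involutive_monoid "free_star_monoid (li_generators G S)" by (rule free_involutive)
interpretation P: involutive_monoid "left_hull G S" by (rule left_hull_involutive)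
interpretation F: complex_star_algebra Fr by (rule FM.finite_algebra_star_algebra)

abbreviation "q \<equiv> full_seminorm (left_hull G S)"

interpretation A: seminormed_star_algebra A q by (rule P.full_seminormed)
interpretation AN: star_normed_algebra A "ell1_norm (left_hull G S)" by (rule P.ell1_star_normed)

text \<open>A central projection in both cases, so that a hull with and a hull without the empty map
  are treated together.\<close>

definition z :: "('g \<rightharpoonup> 'g) \<Rightarrow> complex" where
  "z = (if Map.empty \<in> H then delta Map.empty else (\<lambda>_. 0))"

lemma z_props: "z \<in> carrier A" "z \<otimes>\<^bsub>A\<^esub> z = z" "astar A z = z"
  "f \<in> carrier A \<Longrightarrow> f \<otimes>\<^bsub>A\<^esub> z = z \<otimes>\<^bsub>A\<^esub> f"
proof -
  have "z \<in> carrier A \<and> z \<otimes>\<^bsub>A\<^esub> z = z \<and> astar A z = z \<and> (\<forall>f\<in>carrier A. f \<otimes>\<^bsub>A\<^esub> z = z \<otimes>\<^bsub>A\<^esub> f)"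
  proof (cases "Map.empty \<in> H")
    case True
    then have e: "Map.empty \<in> carrier (left_hull G S)" by (simp add: left_hull_simps)
    note dz = P.delta_zero_mult[OF e]
    have z: "z = delta Map.empty" using True by (simp add: z_def)
    show ?thesis
      unfolding z using P.delta_conv_delta[OF e e] P.star_delta[OF e] dz P.ell1_delta[OF e]
      by (simp add: P.ell1_algebra_simps left_hull_simps map_comp_empty partial_inverse_empty)
  next
    case False
    then have z: "z = \<zero>\<^bsub>A\<^esub>" by (simp add: z_def P.ell1_algebra_simps)
    show ?thesis unfolding z by (simp add: A.star_zero)
  qed
  then show "z \<in> carrier A" "z \<otimes>\<^bsub>A\<^esub> z = z" "astar A z = z"
    "f \<in> carrier A \<Longrightarrow> f \<otimes>\<^bsub>A\<^esub> z = z \<otimes>\<^bsub>A\<^esub> f" by auto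
qed

lemma cutD:
  shows "\<And>x. x \<in> carrier Fr \<Longrightarrow> cut_off A z Phi x \<in> carrier A"
    and "\<And>x y. \<lbrakk>x \<in> carrier Fr; y \<in> carrier Fr\<rbrakk> \<Longrightarrow> cut_off A z Phi (x \<oplus>\<^bsub>Fr\<^esub> y) = cut_off A z Phi x \<oplus>\<^bsub>A\<^esub> cut_off A z Phi y"
    and "\<And>x c. x \<in> carrier Fr \<Longrightarrow> cut_off A z Phi (c \<odot>\<^bsub>Fr\<^esub> x) = c \<odot>\<^bsub>A\<^esub> cut_off A z Phi x"
    and "\<And>x. x \<in> carrier Fr \<Longrightarrow> cut_off A z Phi (astar Fr x) = astar A (cut_off A z Phi x)"
    and "\<And>x y. \<lbrakk>x \<in> carrier Fr; y \<in> carrier Fr\<rbrakk> \<Longrightarrow> cut_off A z Phi (x \<otimes>\<^bsub>Fr\<^esub> y) = cut_off A z Phi x \<otimes>\<^bsub>A\<^esub> cut_off A z Phi y"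
    and "\<And>x y. \<lbrakk>x \<in> carrier Fr; y \<in> carrier Fr\<rbrakk> \<Longrightarrow> cut_off A z Phi (x \<ominus>\<^bsub>Fr\<^esub> y) = cut_off A z Phi x \<ominus>\<^bsub>A\<^esub> cut_off A z Phi y"
  by (rule central_cut[OF F.complex_star_algebra_axioms A.complex_star_algebra_axioms Phi_hom z_props]; assumption)+

text \<open>If the hull lacks the empty map, \<open>Phi\<close> drops this word and \<open>z\<close>
  is zero, so the identity holds in both cases.\<close>

lemma Phi_E_empty: "Phi (delta [(E {}, False)]) = z"
proof -
  have w: "[(E {}, False)] \<in> W" by (simp add: E_generator)
  have "word_map [(E {}, False)] = Map.empty"
    by (simp add: word_map_simps letter_map_def id_map_empty map_comp_empty)
  then show ?thesis using Phi_delta[OF w] Phi_delta_0[of "[(E {}, False)]"] by (simp add: z_def)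
qed

abbreviation "pl \<equiv> presented_seminorm (li_generators G S) (li_relations G S)"

text \<open>The bound \<open>p_le_ell1_norm\<close> is uniform in the seminorm. It makes the
  supremum defining the universal seminorm finite, so that this supremum is again a C*-seminorm
  respecting the relations.\<close>

lemma
  shows presented_seminormed: "li_seminorm G S pl"
    and presented_upper: "\<lbrakk>li_seminorm G S p; x \<in> carrier Fr\<rbrakk> \<Longrightarrow> p x \<le> pl x"
proof -
  let ?N = "{p. cstar_seminorm Fr p \<and> (\<forall>(x, y)\<in>li_relations G S. p (x \<ominus>\<^bsub>Fr\<^esub> y) = 0)}"
  have N: "p \<in> ?N \<longleftrightarrow> li_seminorm G S p" for p
    using group_submonoid_axioms by (auto simp: li_seminorm_def li_seminorm_axioms_def)
  have ne: "(\<lambda>_. 0) \<in> ?N" by (auto simp: cstar_seminorm_zero)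
  have bdd: "bdd_above ((\<lambda>p. p x) ` ?N)" if "x \<in> carrier Fr" for x
    using that N by (intro bdd_aboveI2[of _ _ "ell1_norm (left_hull G S) (Phi x)"]) (auto intro: li_seminorm.p_le_ell1_norm)
  note sup = F.cstar_seminorm_sup[of ?N, OF _ _ bdd, folded presented_seminorm_def]
  have "cstar_seminorm Fr pl" using sup(1) ne by blast
  moreover have "pl (x \<ominus>\<^bsub>Fr\<^esub> y) = 0" if "(x, y) \<in> li_relations G S" for x y
    using sup(3)[of "x \<ominus>\<^bsub>Fr\<^esub> y"] ne li_relations_Fr[OF that] that by blast
  ultimately show "li_seminorm G S pl"
    using group_submonoid_axioms by (simp add: li_seminorm_def li_seminorm_axioms_def)
  show "p x \<le> pl x" if "li_seminorm G S p" "x \<in> carrier Fr"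
    using sup(2)[of p x] ne N that by blast
qed

text \<open>Relations between words hold already under \<open>Phi\<close>. The relation for
  \<open>E {}\<close> holds after cutting, because \<open>Phi\<close> sends that word to
  \<open>z\<close>.\<close>

lemma cut_seminorm: "li_seminorm G S (\<lambda>x. q (cut_off A z Phi x))"
proof -
  have "cstar_seminorm Fr (\<lambda>x. q (cut_off A z Phi x))"
    by (rule cstar_seminorm_comp[OF F.complex_star_algebra_axioms A.seminormed_star_algebra_axioms];
        rule cutD(1-5); assumption)
  moreover have "q (cut_off A z Phi (x \<ominus>\<^bsub>Fr\<^esub> y)) = 0" if r: "(x, y) \<in> li_relations G S" for x y
  proof -
    have c: "x \<in> carrier Fr" "y \<in> carrier Fr" using li_relations_Fr[OF r] by auto
    have "cut_off A z Phi x = cut_off A z Phi y"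
      using word_map_relations[OF r]
    proof (elim disjE bexE conjE)
      fix u v assume uv: "u \<in> W" "v \<in> W" "x = delta u" "y = delta v" "word_map u = word_map v"
      then have "Phi x = Phi y"
        using Phi_delta[of u] Phi_delta[of v] Phi_delta_0[of u] Phi_delta_0[of v] by (cases "word_map u \<in> H") auto
      then show ?thesis by (simp add: cut_off_def)
    next
      assume xy: "x = delta [(E {}, False)]" "y = (\<lambda>w. 0)"
      have "Phi y = \<zero>\<^bsub>A\<^esub>" by (simp add: xy Phi_def push_def P.ell1_algebra_simps)
      then show ?thesis
        using z_props(1-3) by (simp add: cut_off_def xy(1) Phi_E_empty A.minus_eq A.r_neg)
    qed
    then show ?thesis using c cutD(1)[OF c(1)] cutD(1)[OF c(2)] by (simp add: cutD(6) A.minus_eq A.r_neg A.p_zero)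
  qed
  ultimately show ?thesis
    using group_submonoid_axioms by (simp add: li_seminorm_def li_seminorm_axioms_def)
qed

text \<open>One inequality is universality applied to \<open>cut_seminorm\<close>. For the other,
  the universal seminorm extends along \<open>Phi\<close> to a seminorm that is bounded by the
  \<ell>1 norm and kills \<open>z\<close>; this extension is below \<open>q\<close> and does not see
  the cut.\<close>

lemma cut_isometric:
  assumes x: "x \<in> carrier Fr" shows "q (cut_off A z Phi x) = pl x"
proof (rule antisym)
  show "q (cut_off A z Phi x) \<le> pl x" by (rule presented_upper[OF cut_seminorm x])
  interpret L: li_seminorm G S pl by (rule presented_seminormed)
  have pl: "seminormed_star_algebra Fr pl"
    by (intro seminormed_star_algebra.intro seminormed_star_algebra_axioms.intro F.complex_star_algebra_axioms L.seminorm)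
  obtain p' where p': "cstar_seminorm A p'" "\<And>a. a \<in> carrier A \<Longrightarrow> p' a \<le> ell1_norm (left_hull G S) a"
    "\<And>x. x \<in> carrier Fr \<Longrightarrow> p' (Phi x) = pl x"
    using AN.cstar_seminorm_extension[OF pl Phi_hom Phi_dense L.p_le_ell1_norm] by blast
  interpret A': seminormed_star_algebra A p'
    by (intro seminormed_star_algebra.intro seminormed_star_algebra_axioms.intro A.complex_star_algebra_axioms p'(1))
  have dE: "delta [(E {}, False)] \<in> carrier Fr" by (rule delta_Fr) (simp add: E_generator)
  have "p' z = pl (delta [(E {}, False)])" using p'(3)[OF dE] by (simp add: Phi_E_empty)
  also have "\<dots> = 0"
    using L.relations[OF li_relations.empty] by (simp add: FM.finite_minus FM.finite_algebra_simps)
  finally have z0: "p' z = 0" .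
  let ?a = "Phi x" and ?y = "cut_off A z Phi x"
  have a: "?a \<in> carrier A" by (rule star_homD(1)[OF Phi_hom x])
  have y: "?y \<in> carrier A" by (rule cutD(1)[OF x])
  have za: "z \<otimes>\<^bsub>A\<^esub> ?a \<in> carrier A" using z_props(1) a by simp
  \<comment> \<open>Splitting \<open>Phi x\<close> along \<open>z\<close>: the second summand has
    \<open>p'\<close>-value zero because \<open>p' z = 0\<close>, so \<open>p'\<close> is bounded by
    its value at the cut-off.\<close>
  have "?a = ?y \<oplus>\<^bsub>A\<^esub> z \<otimes>\<^bsub>A\<^esub> ?a" unfolding cut_off_def using a za by algebra
  then have "pl x \<le> p' ?y + p' (z \<otimes>\<^bsub>A\<^esub> ?a)" using p'(3)[OF x] A'.p_add[OF y za] by simp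
  also have "p' (z \<otimes>\<^bsub>A\<^esub> ?a) \<le> 0" using A'.p_mult[OF z_props(1) a] z0 by simp
  also have "p' ?y \<le> q ?y" using p' y by (intro P.full_seminorm_upper) (auto simp: P.ell1_algebra_simps)
  finally show "pl x \<le> q ?y" by simp
qed

text \<open>The empty map is absorbing, so \<open>zero_ideal_eq\<close> applies; if it is absent,
  both sides are the zero ideal. This matches the ideal \<open>J\<close> of
  \<open>completion_quotient_iso\<close>.\<close>

lemma zero_ideal_z:
  "zero_ideal (left_hull G S) = (\<lambda>U. to_completion A q z \<otimes>\<^bsub>completion A q\<^esub> U) ` carrier (completion A q)"
proof (cases "Map.empty \<in> H")
  case True
  then have e: "Map.empty \<in> carrier (left_hull G S)" by (simp add: left_hull_simps)
  have "z = delta Map.empty" using True by (simp add: z_def)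
  then show ?thesis
    using P.zero_ideal_eq[OF e] e
    by (simp add: zero_ideal_def full_gen_def full_cstar_def left_hull_simps map_comp_empty)
next
  case False
  interpret C: cstar_algebra "completion A q" by (rule A.completion_cstar)
  have "z = \<zero>\<^bsub>A\<^esub>" using False by (simp add: z_def P.ell1_algebra_simps)
  then have "to_completion A q z = \<zero>\<^bsub>completion A q\<^esub>"
    using A.cls_ops(6)[OF A.Cauchy_const[OF A.zero_closed]] by (simp add: A.iota_eq)
  then show ?thesis
    using False C.zero_closed by (auto simp: zero_ideal_def left_hull_simps full_cstar_def)
qed

lemma Phi_q_dense:
  assumes "a \<in> carrier A" "0 < e" shows "\<exists>x\<in>carrier Fr. q (a \<ominus>\<^bsub>A\<^esub> Phi x) < e"
proof -
  obtain x where x: "x \<in> carrier Fr" "ell1_norm (left_hull G S) (a \<ominus>\<^bsub>A\<^esub> Phi x) < e"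
    using Phi_dense[OF assms] by blast
  have "a \<ominus>\<^bsub>A\<^esub> Phi x \<in> carrier A" using assms star_homD(1)[OF Phi_hom x(1)] by simp
  then show ?thesis using x P.full_seminorm_le[of "a \<ominus>\<^bsub>A\<^esub> Phi x"] by (intro bexI[of _ x]) (auto simp: P.ell1_algebra_simps(1))
qed

theorem li_cstar_iso:
  "\<exists>\<kappa> \<in> star_iso (li_cstar G S) (full_cstar0 (left_hull G S)).
    \<forall>s\<in>S. \<kappa> (li_v G S s) = full_gen0 (left_hull G S) (left_mult G S s)"
proof -
  interpret L: li_seminorm G S pl by (rule presented_seminormed)
  have pl: "seminormed_star_algebra Fr pl"
    by (intro seminormed_star_algebra.intro seminormed_star_algebra_axioms.intro F.complex_star_algebra_axioms L.seminorm)
  \<comment> \<open>The isomorphism comes from \<open>Phi\<close> with isometry supplied by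
    \<open>cut_isometric\<close>. On generators no cut is visible, as passing to the quotient
    removes the component along \<open>z\<close>.\<close>
  have "\<exists>\<kappa>\<in>star_iso (completion Fr pl) (star_quot (completion A q) (nrm (completion A q)) (zero_ideal (left_hull G S))).
    \<forall>x\<in>carrier Fr. \<kappa> (to_completion Fr pl x)
      = zero_ideal (left_hull G S) +>\<^bsub>completion A q\<^esub> to_completion A q (Phi x)"
    unfolding zero_ideal_z
    by (rule completion_quotient_iso[OF pl A.seminormed_star_algebra_axioms Phi_hom z_props(1-3)];
        (rule z_props(4) cut_isometric Phi_q_dense; assumption))
  then obtain \<kappa> where \<kappa>: "\<kappa> \<in> star_iso (completion Fr pl) (full_cstar0 (left_hull G S))"
    "\<And>x. x \<in> carrier Fr \<Longrightarrow> \<kappa> (to_completion Fr pl x)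
      = zero_ideal (left_hull G S) +>\<^bsub>completion A q\<^esub> to_completion A q (Phi x)"
    unfolding full_cstar0_def full_cstar_def by blast
  have "\<kappa> (li_v G S s) = full_gen0 (left_hull G S) (left_mult G S s)" if s: "s \<in> S" for s
  proof -
    have w: "[(V s, False)] \<in> W" using s by (simp add: V_generator)
    have m: "word_map [(V s, False)] = left_mult G S s"
      using s by (simp add: word_map_letter V_generator letter_map_def)
    have "Phi (delta [(V s, False)]) = delta (left_mult G S s)"
      using Phi_delta[OF w] s by (simp add: m left_hull_set.gen)
    then show ?thesis
      using \<kappa>(2)[OF delta_Fr[OF w]]
      by (simp add: li_v_def presented_generator_def full_gen0_def full_gen_def full_cstar_def)
  qed
  then show ?thesis using \<kappa>(1) unfolding li_cstar_def presented_cstar_def by blast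
qed

end

theorem proposition3p3p1:
  fixes G :: "('g, 'b) monoid_scheme" and S :: "'g set"
  assumes "group G" and "submonoid S G"
  shows "\<exists>\<kappa> \<in> star_iso (li_cstar G S) (full_cstar0 (left_hull G S)).
    \<forall>s\<in>S. \<kappa> (li_v G S s) = full_gen0 (left_hull G S) (left_mult G S s)"
  by (rule group_submonoid.li_cstar_iso) (intro group_submonoid.intro assms)

end
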